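(* Let $\overline{\mathrm{Spec}}:\mathbf{HA}^{\mathrm{op}}\to\mathcal K$ be the functor sending a Heyting algebra $A$ to the sheaf $P\mapsto \mathbf{HA}(A,\mathcal UP)$ on $\mathbf{Kp}$. Then $\overline{\mathrm{Spec}}$ factors through the full subcategory $\mathbf{IKp}\hookrightarrow\mathcal K$, and the resulting functor $\overline{\mathrm{Spec}}:\mathbf{HA}^{\mathrm{op}}\to\mathbf{IKp}$ is right adjoint to the functor $\mathcal U:\mathbf{IKp}\to\mathbf{HA}^{\mathrm{op}}$, $X\mapsto\mathcal UX$. Under the equivalence $\mathcal U:\mathbf{IKp}\simeq\mathbf{Pro}(\mathbf{HA}_f)^{\mathrm{op}}$, $\overline{\mathrm{Spec}}$ corresponds to the dual of the profinite completion functor $\widehat{(-)}:\mathbf{HA}\to\mathbf{Pro}(\mathbf{HA}_f)$; i.e. $\mathcal U\,\overline{\mathrm{Spec}}\,A\cong\widehat A$ naturally in $A$, and the counit $A\to\mathcal U(\overline{\mathrm{Spec}}A)$ is the profinite completion map $A\to\widehat A$.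
   Context: $\mathbf{HA}$ is the category of Heyting algebras. $\mathbf{Kp}$ is the category of finite posets and open maps (monotone $f:P\to Q$ such that whenever $f(p)\le q$ there is $p'\ge p$ with $f(p')=q$). For a poset $X$, $\mathcal UX$ is the Heyting algebra of upward closed subsets of $X$; $\mathcal U$ gives a duality between $\mathbf{Kp}$ and finite Heyting algebras. $J$ is the Grothendieck topology on $\mathbf{Kp}$ whose covering sieves are the jointly surjective ones, and $\mathcal K=\mathbf{Sh}(\mathbf{Kp},J)$. $\mathbf{IKp}$ is the category of image finite posets (each ${\uparrow}x$ finite) with open maps, regarded as a full subcategory of $\mathcal K$ via $X\mapsto\mathbf{IKp}(-,X)|_{\mathbf{Kp}}$. $\mathbf{Pro}(\mathbf{HA}_f)$ is the pro-completion of the category of finite Heyting algebras (profinite Heyting algebras); $X\mapsto\mathcal UX$ gives an equivalence $\mathbf{IKp}\simeq\mathbf{Pro}(\mathbf{HA}_f)^{\mathrm{op}}$. The profinite completion $\widehat{(-)}$ is the left adjoint of the forgetful functor $\mathbf{Pro}(\mathbf{HA}_f)\to\mathbf{HA}$. *)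

theory Defs
  imports "HOL-Algebra.Lattice" "HOL-Library.FuncSet"
begin

text \<open>
  Posets and Heyting algebras are \<^typ>\<open>'a gorder\<close> structures on an arbitrary type \<open>'a\<close>.  A type
  plays the role of a universe, and no type is closed under power sets: if \<open>A\<close> lives in \<open>'a\<close>, the
  points of its spectrum live naturally in \<open>'a set\<close> and their up-sets in \<open>'a set set\<close>.  Hom-sets
  are therefore defined between structures on different types, and a universal property carries
  an argument \<open>TYPE(_)\<close> naming the universe of the test objects.  Morphisms are extensional
  functions, so that equality of morphisms is equality in HOL.
\<close>

section \<open>Categories and functors\<close>

record ('o, 'm) cat =
  Obj :: "'o set"
  Arr :: "'o \<Rightarrow> 'o \<Rightarrow> 'm set"
  Ident :: "'o \<Rightarrow> 'm"
  Cmp :: "'o \<Rightarrow> 'o \<Rightarrow> 'o \<Rightarrow> 'm \<Rightarrow> 'm \<Rightarrow> 'm"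
    \<comment> \<open>\<open>Cmp C x y z g f\<close> is \<open>g \<circ> f\<close> for \<open>f : x \<rightarrow> y\<close> and \<open>g : y \<rightarrow> z\<close>\<close>

definition category :: "('o, 'm) cat \<Rightarrow> bool" where
  "category C \<longleftrightarrow>
     (\<forall>x\<in>Obj C. Ident C x \<in> Arr C x x) \<and>
     (\<forall>x\<in>Obj C. \<forall>y\<in>Obj C. \<forall>z\<in>Obj C. \<forall>f\<in>Arr C x y. \<forall>g\<in>Arr C y z. Cmp C x y z g f \<in> Arr C x z) \<and>
     (\<forall>x\<in>Obj C. \<forall>y\<in>Obj C. \<forall>f\<in>Arr C x y.
        Cmp C x x y f (Ident C x) = f \<and> Cmp C x y y (Ident C y) f = f) \<and>
     (\<forall>w\<in>Obj C. \<forall>x\<in>Obj C. \<forall>y\<in>Obj C. \<forall>z\<in>Obj C.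
        \<forall>f\<in>Arr C w x. \<forall>g\<in>Arr C x y. \<forall>h\<in>Arr C y z.
        Cmp C w y z h (Cmp C w x y g f) = Cmp C w x z (Cmp C x y z h g) f)"

definition op_cat :: "('o, 'm) cat \<Rightarrow> ('o, 'm) cat" where
  "op_cat C = \<lparr>Obj = Obj C, Arr = (\<lambda>x y. Arr C y x), Ident = Ident C,
               Cmp = (\<lambda>x y z g f. Cmp C z y x f g)\<rparr>"

record ('o, 'm, 'p, 'n) functr =
  fobj :: "'o \<Rightarrow> 'p"
  fmap :: "'o \<Rightarrow> 'o \<Rightarrow> 'm \<Rightarrow> 'n"

definition is_functor :: "('o, 'm) cat \<Rightarrow> ('p, 'n) cat \<Rightarrow> ('o, 'm, 'p, 'n) functr \<Rightarrow> bool" where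
  "is_functor C D F \<longleftrightarrow>
     (\<forall>x\<in>Obj C. fobj F x \<in> Obj D) \<and>
     (\<forall>x\<in>Obj C. \<forall>y\<in>Obj C. \<forall>f\<in>Arr C x y. fmap F x y f \<in> Arr D (fobj F x) (fobj F y)) \<and>
     (\<forall>x\<in>Obj C. fmap F x x (Ident C x) = Ident D (fobj F x)) \<and>
     (\<forall>x\<in>Obj C. \<forall>y\<in>Obj C. \<forall>z\<in>Obj C. \<forall>f\<in>Arr C x y. \<forall>g\<in>Arr C y z.
        fmap F x z (Cmp C x y z g f) =
        Cmp D (fobj F x) (fobj F y) (fobj F z) (fmap F y z g) (fmap F x y f))"

definition op_functr :: "('o, 'm, 'p, 'n) functr \<Rightarrow> ('o, 'm, 'p, 'n) functr" where
  "op_functr F = \<lparr>fobj = fobj F, fmap = (\<lambda>x y. fmap F y x)\<rparr>"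

definition comp_functr ::
  "('p, 'n, 'q, 'l) functr \<Rightarrow> ('o, 'm, 'p, 'n) functr \<Rightarrow> ('o, 'm, 'q, 'l) functr" where
  "comp_functr G F = \<lparr>fobj = (\<lambda>x. fobj G (fobj F x)),
                      fmap = (\<lambda>x y f. fmap G (fobj F x) (fobj F y) (fmap F x y f))\<rparr>"

definition Set_cat :: "('v set, 'v \<Rightarrow> 'v) cat" where
  "Set_cat = \<lparr>Obj = UNIV, Arr = (\<lambda>X Y. X \<rightarrow>\<^sub>E Y), Ident = (\<lambda>X. \<lambda>x\<in>X. x),
              Cmp = (\<lambda>X Y Z g f. compose X g f)\<rparr>"


section \<open>Heyting algebras\<close>

definition heyting_algebra :: "'a gorder \<Rightarrow> bool" where
  "heyting_algebra A \<longleftrightarrow> bounded_lattice A \<and>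
     (\<forall>a\<in>carrier A. \<forall>b\<in>carrier A. \<exists>c. greatest A c {x \<in> carrier A. a \<sqinter>\<^bsub>A\<^esub> x \<sqsubseteq>\<^bsub>A\<^esub> b})"

definition himp :: "'a gorder \<Rightarrow> 'a \<Rightarrow> 'a \<Rightarrow> 'a" where
  "himp A a b = (SOME c. greatest A c {x \<in> carrier A. a \<sqinter>\<^bsub>A\<^esub> x \<sqsubseteq>\<^bsub>A\<^esub> b})"

definition ha_hom :: "'a gorder \<Rightarrow> 'b gorder \<Rightarrow> ('a \<Rightarrow> 'b) set" where
  "ha_hom A B = {h \<in> carrier A \<rightarrow>\<^sub>E carrier B.
     h \<top>\<^bsub>A\<^esub> = \<top>\<^bsub>B\<^esub> \<and> h \<bottom>\<^bsub>A\<^esub> = \<bottom>\<^bsub>B\<^esub> \<and>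
     (\<forall>a\<in>carrier A. \<forall>b\<in>carrier A.
        h (a \<sqinter>\<^bsub>A\<^esub> b) = h a \<sqinter>\<^bsub>B\<^esub> h b \<and>
        h (a \<squnion>\<^bsub>A\<^esub> b) = h a \<squnion>\<^bsub>B\<^esub> h b \<and>
        h (himp A a b) = himp B (h a) (h b))}"

definition HA_cat :: "('a gorder, 'a \<Rightarrow> 'a) cat" where
  "HA_cat = \<lparr>Obj = {A. heyting_algebra A}, Arr = ha_hom, Ident = (\<lambda>A. \<lambda>a\<in>carrier A. a),
             Cmp = (\<lambda>A B C g f. compose (carrier A) g f)\<rparr>"

definition HAf_cat :: "('a gorder, 'a \<Rightarrow> 'a) cat" where
  "HAf_cat = HA_cat\<lparr>Obj := {A. heyting_algebra A \<and> finite (carrier A)}\<rparr>"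


section \<open>Posets, open maps and up-sets\<close>

definition open_maps :: "'x gorder \<Rightarrow> 'y gorder \<Rightarrow> ('x \<Rightarrow> 'y) set" where
  "open_maps P Q = {f \<in> carrier P \<rightarrow>\<^sub>E carrier Q.
     (\<forall>p\<in>carrier P. \<forall>p'\<in>carrier P. p \<sqsubseteq>\<^bsub>P\<^esub> p' \<longrightarrow> f p \<sqsubseteq>\<^bsub>Q\<^esub> f p') \<and>
     (\<forall>p\<in>carrier P. \<forall>q\<in>carrier Q. f p \<sqsubseteq>\<^bsub>Q\<^esub> q \<longrightarrow> (\<exists>p'\<in>carrier P. p \<sqsubseteq>\<^bsub>P\<^esub> p' \<and> f p' = q))}"

definition image_finite :: "'x gorder \<Rightarrow> bool" where
  "image_finite X \<longleftrightarrow> (\<forall>x\<in>carrier X. finite {y \<in> carrier X. x \<sqsubseteq>\<^bsub>X\<^esub> y})"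

definition IKp_cat :: "('x gorder, 'x \<Rightarrow> 'x) cat" where
  "IKp_cat = \<lparr>Obj = {X. partial_order X \<and> image_finite X}, Arr = open_maps,
              Ident = (\<lambda>X. \<lambda>x\<in>carrier X. x), Cmp = (\<lambda>X Y Z g f. compose (carrier X) g f)\<rparr>"

text \<open>Every finite poset is isomorphic to one with carrier in \<^typ>\<open>nat\<close>, which makes the site small.\<close>

definition Kp_cat :: "(nat gorder, nat \<Rightarrow> nat) cat" where
  "Kp_cat = IKp_cat\<lparr>Obj := {P. partial_order P \<and> finite (carrier P)}\<rparr>"

definition upsets :: "'x gorder \<Rightarrow> 'x set set" where
  "upsets X = {V. V \<subseteq> carrier X \<and> (\<forall>x\<in>V. \<forall>y\<in>carrier X. x \<sqsubseteq>\<^bsub>X\<^esub> y \<longrightarrow> y \<in> V)}"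

definition UU :: "'x gorder \<Rightarrow> 'x set gorder" where
  "UU X = \<lparr>carrier = upsets X, eq = (=), le = (\<subseteq>)\<rparr>"

definition UU_map :: "'x gorder \<Rightarrow> 'y gorder \<Rightarrow> ('x \<Rightarrow> 'y) \<Rightarrow> 'y set \<Rightarrow> 'x set" where
  "UU_map X Y f = (\<lambda>V\<in>carrier (UU Y). {x \<in> carrier X. f x \<in> V})"

definition U_functor :: "('x gorder, 'x \<Rightarrow> 'x, 'x set gorder, 'x set \<Rightarrow> 'x set) functr"
    \<comment> \<open>\<open>IKp \<rightarrow> HA\<^sup>o\<^sup>p\<close>\<close>
  where "U_functor = \<lparr>fobj = UU, fmap = UU_map\<rparr>"


section \<open>Sheaves on finite posets\<close>

type_synonym 'v psh = "(nat gorder, nat \<Rightarrow> nat, 'v set, 'v \<Rightarrow> 'v) functr"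

definition sieve :: "nat gorder \<Rightarrow> (nat gorder \<times> (nat \<Rightarrow> nat)) set \<Rightarrow> bool" where
  "sieve P R \<longleftrightarrow>
     (\<forall>(Q, f)\<in>R. Q \<in> Obj Kp_cat \<and> f \<in> Arr Kp_cat Q P) \<and>
     (\<forall>(Q, f)\<in>R. \<forall>Q'\<in>Obj Kp_cat. \<forall>g\<in>Arr Kp_cat Q' Q. (Q', Cmp Kp_cat Q' Q P f g) \<in> R)"

definition covering_sieve :: "nat gorder \<Rightarrow> (nat gorder \<times> (nat \<Rightarrow> nat)) set \<Rightarrow> bool" where
  "covering_sieve P R \<longleftrightarrow> sieve P R \<and> (\<Union>(Q, f)\<in>R. f ` carrier Q) = carrier P"

definition matching_family ::
  "'v psh \<Rightarrow> nat gorder \<Rightarrow> (nat gorder \<times> (nat \<Rightarrow> nat)) set \<Rightarrow> (nat gorder \<Rightarrow> (nat \<Rightarrow> nat) \<Rightarrow> 'v) \<Rightarrow> bool"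
  where
  "matching_family F P R s \<longleftrightarrow>
     (\<forall>(Q, f)\<in>R. s Q f \<in> fobj F Q) \<and>
     (\<forall>(Q, f)\<in>R. \<forall>Q'\<in>Obj Kp_cat. \<forall>g\<in>Arr Kp_cat Q' Q.
        s Q' (Cmp Kp_cat Q' Q P f g) = fmap F Q Q' g (s Q f))"

definition is_sheaf :: "'v psh \<Rightarrow> bool" where
  "is_sheaf F \<longleftrightarrow> is_functor (op_cat Kp_cat) Set_cat F \<and>
     (\<forall>P\<in>Obj Kp_cat. \<forall>R s. covering_sieve P R \<and> matching_family F P R s \<longrightarrow>
        (\<exists>!t. t \<in> fobj F P \<and> (\<forall>(Q, f)\<in>R. fmap F P Q f t = s Q f)))"

definition psh_hom :: "'v psh \<Rightarrow> 'w psh \<Rightarrow> (nat gorder \<Rightarrow> 'v \<Rightarrow> 'w) set" where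
  "psh_hom F G = {\<eta> \<in> (\<Pi>\<^sub>E P\<in>Obj Kp_cat. fobj F P \<rightarrow>\<^sub>E fobj G P).
     \<forall>P\<in>Obj Kp_cat. \<forall>Q\<in>Obj Kp_cat. \<forall>f\<in>Arr Kp_cat Q P. \<forall>x\<in>fobj F P.
       \<eta> Q (fmap F P Q f x) = fmap G P Q f (\<eta> P x)}"

definition psh_iso :: "'v psh \<Rightarrow> 'w psh \<Rightarrow> (nat gorder \<Rightarrow> 'v \<Rightarrow> 'w) \<Rightarrow> bool" where
  "psh_iso F G \<eta> \<longleftrightarrow> \<eta> \<in> psh_hom F G \<and> (\<forall>P\<in>Obj Kp_cat. bij_betw (\<eta> P) (fobj F P) (fobj G P))"

definition Sh_cat :: "('v psh, nat gorder \<Rightarrow> 'v \<Rightarrow> 'v) cat" where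
  "Sh_cat = \<lparr>Obj = {F. is_sheaf F}, Arr = psh_hom,
             Ident = (\<lambda>F. \<lambda>P\<in>Obj Kp_cat. \<lambda>x\<in>fobj F P. x),
             Cmp = (\<lambda>F G H \<theta> \<eta>. \<lambda>P\<in>Obj Kp_cat. compose (fobj F P) (\<theta> P) (\<eta> P))\<rparr>"

definition Spec_bar ::
  "('a gorder, 'a \<Rightarrow> 'a, ('a \<Rightarrow> nat set) psh, nat gorder \<Rightarrow> ('a \<Rightarrow> nat set) \<Rightarrow> ('a \<Rightarrow> nat set)) functr"
    \<comment> \<open>\<open>HA\<^sup>o\<^sup>p \<rightarrow> Sh(Kp, J)\<close>\<close>
  where
  "Spec_bar = \<lparr>
     fobj = (\<lambda>A. \<lparr>fobj = (\<lambda>P. ha_hom A (UU P)),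
                  fmap = (\<lambda>P Q f. \<lambda>g\<in>ha_hom A (UU P). compose (carrier A) (UU_map Q P f) g)\<rparr>),
     fmap = (\<lambda>B A h. \<lambda>P\<in>Obj Kp_cat. \<lambda>g\<in>ha_hom B (UU P). compose (carrier A) g h)\<rparr>"

definition IKp_embedding ::
  "('x gorder, 'x \<Rightarrow> 'x, (nat \<Rightarrow> 'x) psh, nat gorder \<Rightarrow> (nat \<Rightarrow> 'x) \<Rightarrow> (nat \<Rightarrow> 'x)) functr"
    \<comment> \<open>\<open>IKp \<rightarrow> Sh(Kp, J)\<close>, \<open>X \<mapsto> IKp(-, X)\<close> restricted to \<open>Kp\<close>\<close>
  where
  "IKp_embedding = \<lparr>
     fobj = (\<lambda>X. \<lparr>fobj = (\<lambda>P. open_maps P X),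
                  fmap = (\<lambda>P Q f. \<lambda>g\<in>open_maps P X. compose (carrier Q) g f)\<rparr>),
     fmap = (\<lambda>X Y k. \<lambda>P\<in>Obj Kp_cat. \<lambda>g\<in>open_maps P X. compose (carrier P) k g)\<rparr>"

text \<open>
  A factorization of \<open>Spec_bar\<close> through \<open>IKp\<close>: a functor \<open>S : HA\<^sup>o\<^sup>p \<rightarrow> IKp\<close> and an isomorphism
  \<open>\<alpha>\<close> from \<open>Spec_bar\<close> to \<open>IKp_embedding \<circ> S\<close>, natural in the algebra and in the finite poset.
\<close>

definition IKp_factorization ::
  "('a gorder, 'a \<Rightarrow> 'a, 's gorder, 's \<Rightarrow> 's) functr \<Rightarrow>
   ('a gorder \<Rightarrow> nat gorder \<Rightarrow> ('a \<Rightarrow> nat set) \<Rightarrow> nat \<Rightarrow> 's) \<Rightarrow> bool" where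
  "IKp_factorization S \<alpha> \<longleftrightarrow>
     is_functor (op_cat HA_cat) IKp_cat S \<and>
     (\<forall>A\<in>Obj HA_cat. psh_iso (fobj Spec_bar A) (fobj IKp_embedding (fobj S A)) (\<alpha> A)) \<and>
     (\<forall>A\<in>Obj HA_cat. \<forall>B\<in>Obj HA_cat. \<forall>h\<in>ha_hom A B.
        \<forall>P\<in>Obj Kp_cat. \<forall>g\<in>fobj (fobj Spec_bar B) P.
          \<alpha> A P (fmap Spec_bar B A h P g) =
          fmap IKp_embedding (fobj S B) (fobj S A) (fmap S B A h) P (\<alpha> B P g))"

text \<open>
  \<open>S : HA\<^sup>o\<^sup>p \<rightarrow> IKp\<close> is right adjoint to \<open>U : IKp \<rightarrow> HA\<^sup>o\<^sup>p\<close> with counit \<open>\<epsilon>\<close>.  The component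
  \<open>U (S A) \<rightarrow> A\<close> of the counit in \<open>HA\<^sup>o\<^sup>p\<close> is a homomorphism \<open>A \<rightarrow> U (S A)\<close>.
\<close>

definition right_adjoint_to_U ::
  "('a gorder, 'a \<Rightarrow> 'a, 's gorder, 's \<Rightarrow> 's) functr \<Rightarrow> ('a gorder \<Rightarrow> 'a \<Rightarrow> 's set) \<Rightarrow>
   'x gorder itself \<Rightarrow> bool" where
  "right_adjoint_to_U S \<epsilon> (T :: 'x gorder itself) \<longleftrightarrow>
     is_functor (op_cat HA_cat) IKp_cat S \<and>
     is_functor IKp_cat (op_cat HA_cat)
       (U_functor :: ('x gorder, 'x \<Rightarrow> 'x, 'x set gorder, 'x set \<Rightarrow> 'x set) functr) \<and>
     (\<forall>A\<in>Obj HA_cat. \<epsilon> A \<in> ha_hom A (UU (fobj S A))) \<and>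
     (\<forall>A\<in>Obj HA_cat. \<forall>B\<in>Obj HA_cat. \<forall>h\<in>ha_hom A B.
        compose (carrier A) (\<epsilon> B) h =
        compose (carrier A) (UU_map (fobj S B) (fobj S A) (fmap S B A h)) (\<epsilon> A)) \<and>
     (\<forall>A\<in>Obj HA_cat. \<forall>X\<in>(Obj IKp_cat :: 'x gorder set).
        bij_betw (\<lambda>f. compose (carrier A) (UU_map X (fobj S A) f) (\<epsilon> A))
          (open_maps X (fobj S A)) (ha_hom A (UU X)))"


section \<open>The pro-completion of finite Heyting algebras\<close>

definition cofiltered :: "('i, 'm) cat \<Rightarrow> bool" where
  "cofiltered I \<longleftrightarrow> category I \<and> Obj I \<noteq> {} \<and>
     (\<forall>i\<in>Obj I. \<forall>j\<in>Obj I. \<exists>k\<in>Obj I. Arr I k i \<noteq> {} \<and> Arr I k j \<noteq> {}) \<and>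
     (\<forall>i\<in>Obj I. \<forall>j\<in>Obj I. \<forall>u\<in>Arr I i j. \<forall>v\<in>Arr I i j.
        \<exists>k\<in>Obj I. \<exists>w\<in>Arr I k i. Cmp I k i j u w = Cmp I k i j v w)"

record ('i, 'm, 'h) pro =
  idx :: "('i, 'm) cat"
  dia :: "('i, 'm, 'h gorder, 'h \<Rightarrow> 'h) functr"

abbreviation pob :: "('i, 'm, 'h) pro \<Rightarrow> 'i \<Rightarrow> 'h gorder" where
  "pob X i \<equiv> fobj (dia X) i"

definition pro_object :: "('i, 'm, 'h) pro \<Rightarrow> bool" where
  "pro_object X \<longleftrightarrow> cofiltered (idx X) \<and> is_functor (idx X) HAf_cat (dia X)"

text \<open>
  Hom-sets are \<open>lim\<^sub>j colim\<^sub>i HA(X\<^sub>i, Y\<^sub>j)\<close>.  An element of the inner colimit is an equivalence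
  class of pairs \<open>(i, f)\<close> with \<open>f : X\<^sub>i \<rightarrow> Y\<^sub>j\<close>.
\<close>

definition pro_rel ::
  "('i, 'm, 'h) pro \<Rightarrow> 'k gorder \<Rightarrow> (('i \<times> ('h \<Rightarrow> 'k)) \<times> ('i \<times> ('h \<Rightarrow> 'k))) set" where
  "pro_rel X B = {((i, f), (i', f')).
     i \<in> Obj (idx X) \<and> f \<in> ha_hom (pob X i) B \<and> i' \<in> Obj (idx X) \<and> f' \<in> ha_hom (pob X i') B \<and>
     (\<exists>k\<in>Obj (idx X). \<exists>u\<in>Arr (idx X) k i. \<exists>u'\<in>Arr (idx X) k i'.
        compose (carrier (pob X k)) f (fmap (dia X) k i u) =
        compose (carrier (pob X k)) f' (fmap (dia X) k i' u'))}"

definition pro_colim :: "('i, 'm, 'h) pro \<Rightarrow> 'k gorder \<Rightarrow> ('i \<times> ('h \<Rightarrow> 'k)) set set" where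
  "pro_colim X B = (SIGMA i : Obj (idx X). ha_hom (pob X i) B) // pro_rel X B"

definition pro_hom ::
  "('i, 'm, 'h) pro \<Rightarrow> ('j, 'n, 'k) pro \<Rightarrow> ('j \<Rightarrow> ('i \<times> ('h \<Rightarrow> 'k)) set) set" where
  "pro_hom X Y = {\<phi> \<in> (\<Pi>\<^sub>E j\<in>Obj (idx Y). pro_colim X (pob Y j)).
     \<forall>j\<in>Obj (idx Y). \<forall>j'\<in>Obj (idx Y). \<forall>v\<in>Arr (idx Y) j j'. \<forall>(i, f)\<in>\<phi> j.
       (i, compose (carrier (pob X i)) (fmap (dia Y) j j' v) f) \<in> \<phi> j'}"

definition pro_id :: "('i, 'm, 'h) pro \<Rightarrow> 'i \<Rightarrow> ('i \<times> ('h \<Rightarrow> 'h)) set" where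
  "pro_id X = (\<lambda>i\<in>Obj (idx X). pro_rel X (pob X i) `` {(i, \<lambda>a\<in>carrier (pob X i). a)})"

definition pro_comp ::
  "('i, 'm, 'h) pro \<Rightarrow> ('j, 'n, 'k) pro \<Rightarrow> ('q, 'l, 'r) pro \<Rightarrow>
   ('q \<Rightarrow> ('j \<times> ('k \<Rightarrow> 'r)) set) \<Rightarrow> ('j \<Rightarrow> ('i \<times> ('h \<Rightarrow> 'k)) set) \<Rightarrow> 'q \<Rightarrow> ('i \<times> ('h \<Rightarrow> 'r)) set"
  where
  "pro_comp X Y Z \<psi> \<phi> = (\<lambda>q\<in>Obj (idx Z). \<Union>(j, g)\<in>\<psi> q. \<Union>(i, f)\<in>\<phi> j.
     pro_rel X (pob Z q) `` {(i, compose (carrier (pob X i)) g f)})"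

definition Pro_cat :: "(('i, 'm, 'h) pro, 'i \<Rightarrow> ('i \<times> ('h \<Rightarrow> 'h)) set) cat" where
  "Pro_cat = \<lparr>Obj = {X. pro_object X}, Arr = pro_hom, Ident = pro_id, Cmp = pro_comp\<rparr>"

definition pro_iso ::
  "('i, 'm, 'h) pro \<Rightarrow> ('j, 'n, 'k) pro \<Rightarrow> ('j \<Rightarrow> ('i \<times> ('h \<Rightarrow> 'k)) set) \<Rightarrow> bool" where
  "pro_iso X Y \<phi> \<longleftrightarrow> \<phi> \<in> pro_hom X Y \<and>
     (\<exists>\<psi>\<in>pro_hom Y X. pro_comp X Y X \<psi> \<phi> = pro_id X \<and> pro_comp Y X Y \<phi> \<psi> = pro_id Y)"

text \<open>The forgetful functor \<open>Pro(HA\<^sub>f) \<rightarrow> HA\<close> takes the limit of a diagram in \<open>HA\<close>.\<close>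

definition pro_lim :: "('i, 'm, 'h) pro \<Rightarrow> ('i \<Rightarrow> 'h) gorder" where
  "pro_lim X = \<lparr>
     carrier = {x \<in> (\<Pi>\<^sub>E i\<in>Obj (idx X). carrier (pob X i)).
       \<forall>i\<in>Obj (idx X). \<forall>j\<in>Obj (idx X). \<forall>u\<in>Arr (idx X) i j. fmap (dia X) i j u (x i) = x j},
     eq = (=),
     le = (\<lambda>x y. \<forall>i\<in>Obj (idx X). x i \<sqsubseteq>\<^bsub>pob X i\<^esub> y i)\<rparr>"

definition pro_lim_map ::
  "('i, 'm, 'h) pro \<Rightarrow> ('j, 'n, 'k) pro \<Rightarrow> ('j \<Rightarrow> ('i \<times> ('h \<Rightarrow> 'k)) set) \<Rightarrow> ('i \<Rightarrow> 'h) \<Rightarrow> 'j \<Rightarrow> 'k"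
  where
  "pro_lim_map X Y \<phi> =
     (\<lambda>x\<in>carrier (pro_lim X). \<lambda>j\<in>Obj (idx Y). THE y. \<exists>(i, f)\<in>\<phi> j. y = f (x i))"

definition forget_functor ::
  "(('i, 'm, 'h) pro, 'i \<Rightarrow> ('i \<times> ('h \<Rightarrow> 'h)) set, ('i \<Rightarrow> 'h) gorder, ('i \<Rightarrow> 'h) \<Rightarrow> ('i \<Rightarrow> 'h)) functr"
  where "forget_functor = \<lparr>fobj = pro_lim, fmap = pro_lim_map\<rparr>"

text \<open>
  \<open>(L, \<eta>)\<close> is a left adjoint \<open>HA \<rightarrow> Pro(HA\<^sub>f)\<close> of the forgetful functor with unit \<open>\<eta>\<close>, that is, a
  profinite completion functor with completion maps \<open>\<eta> A : A \<rightarrow> |L A|\<close>.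
\<close>

definition profinite_completion ::
  "('a gorder, 'a \<Rightarrow> 'a, ('i, 'm, 'h) pro, 'i \<Rightarrow> ('i \<times> ('h \<Rightarrow> 'h)) set) functr \<Rightarrow>
   ('a gorder \<Rightarrow> 'a \<Rightarrow> 'i \<Rightarrow> 'h) \<Rightarrow> ('j, 'n, 'k) pro itself \<Rightarrow> bool" where
  "profinite_completion L \<eta> (T :: ('j, 'n, 'k) pro itself) \<longleftrightarrow>
     is_functor HA_cat Pro_cat L \<and>
     is_functor Pro_cat HA_cat
       (forget_functor :: (('j, 'n, 'k) pro, 'j \<Rightarrow> ('j \<times> ('k \<Rightarrow> 'k)) set,
                           ('j \<Rightarrow> 'k) gorder, ('j \<Rightarrow> 'k) \<Rightarrow> ('j \<Rightarrow> 'k)) functr) \<and>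
     (\<forall>A\<in>Obj HA_cat. \<eta> A \<in> ha_hom A (pro_lim (fobj L A))) \<and>
     (\<forall>A\<in>Obj HA_cat. \<forall>B\<in>Obj HA_cat. \<forall>h\<in>ha_hom A B.
        compose (carrier A) (\<eta> B) h =
        compose (carrier A) (pro_lim_map (fobj L A) (fobj L B) (fmap L A B h)) (\<eta> A)) \<and>
     (\<forall>A\<in>Obj HA_cat. \<forall>Y\<in>(Obj Pro_cat :: ('j, 'n, 'k) pro set).
        bij_betw (\<lambda>\<phi>. compose (carrier A) (pro_lim_map (fobj L A) Y \<phi>) (\<eta> A))
          (pro_hom (fobj L A) Y) (ha_hom A (pro_lim Y)))"

definition pro_nat_iso ::
  "('a gorder, 'a \<Rightarrow> 'a, ('i, 'm, 'h) pro, 'i \<Rightarrow> ('i \<times> ('h \<Rightarrow> 'h)) set) functr \<Rightarrow>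
   ('a gorder, 'a \<Rightarrow> 'a, ('j, 'n, 'k) pro, 'j \<Rightarrow> ('j \<times> ('k \<Rightarrow> 'k)) set) functr \<Rightarrow>
   ('a gorder \<Rightarrow> 'j \<Rightarrow> ('i \<times> ('h \<Rightarrow> 'k)) set) \<Rightarrow> bool" where
  "pro_nat_iso L M \<theta> \<longleftrightarrow>
     (\<forall>A\<in>Obj HA_cat. pro_iso (fobj L A) (fobj M A) (\<theta> A)) \<and>
     (\<forall>A\<in>Obj HA_cat. \<forall>B\<in>Obj HA_cat. \<forall>h\<in>ha_hom A B.
        pro_comp (fobj L A) (fobj L B) (fobj M B) (\<theta> B) (fmap L A B h) =
        pro_comp (fobj L A) (fobj M A) (fobj M B) (fmap M A B h) (\<theta> A))"

text \<open>
  The equivalence \<open>U : IKp \<rightarrow> Pro(HA\<^sub>f)\<^sup>o\<^sup>p\<close>.  An image finite poset \<open>X\<close> is the directed union of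
  its finite up-sets \<open>F\<close>, and \<open>U X\<close> as a profinite algebra is the cofiltered diagram of the
  finite algebras \<open>U F\<close> with restriction maps; \<open>U_pro_lim_iso\<close> identifies the algebra of
  up-sets \<open>UU X\<close> with its limit.
\<close>

definition fin_upsets :: "'x gorder \<Rightarrow> 'x set set" where
  "fin_upsets X = {F \<in> upsets X. finite F}"

definition U_pro_obj :: "'x gorder \<Rightarrow> ('x set, unit, 'x set) pro" where
  "U_pro_obj X = \<lparr>
     idx = \<lparr>Obj = fin_upsets X, Arr = (\<lambda>F G. if G \<subseteq> F then {()} else {}),
            Ident = (\<lambda>_. ()), Cmp = (\<lambda>_ _ _ _ _. ())\<rparr>,
     dia = \<lparr>fobj = (\<lambda>F. UU (X\<lparr>carrier := F\<rparr>)),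
            fmap = (\<lambda>F G _. \<lambda>V\<in>carrier (UU (X\<lparr>carrier := F\<rparr>)). V \<inter> G)\<rparr>\<rparr>"

definition U_pro_map ::
  "'x gorder \<Rightarrow> 'y gorder \<Rightarrow> ('x \<Rightarrow> 'y) \<Rightarrow> 'x set \<Rightarrow> ('y set \<times> ('y set \<Rightarrow> 'x set)) set" where
  "U_pro_map X Y f = (\<lambda>F\<in>fin_upsets X.
     pro_rel (U_pro_obj Y) (UU (X\<lparr>carrier := F\<rparr>)) ``
       {(f ` F, UU_map (X\<lparr>carrier := F\<rparr>) (Y\<lparr>carrier := f ` F\<rparr>) f)})"

definition U_pro_functor ::
  "('x gorder, 'x \<Rightarrow> 'x, ('x set, unit, 'x set) pro, 'x set \<Rightarrow> ('x set \<times> ('x set \<Rightarrow> 'x set)) set) functr"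
  where "U_pro_functor = \<lparr>fobj = U_pro_obj, fmap = U_pro_map\<rparr>"

definition U_pro_lim_iso :: "'x gorder \<Rightarrow> 'x set \<Rightarrow> 'x set \<Rightarrow> 'x set" where
  "U_pro_lim_iso X = (\<lambda>V\<in>carrier (UU X). \<lambda>F\<in>fin_upsets X. V \<inter> F)"

end

theory Submission
  imports Defs
begin

text \<open>
  A homomorphism \<open>g : A \<rightarrow> U P\<close> assigns to each \<open>p\<close> the prime filter \<open>{a. p \<in> g a}\<close>.  Let \<open>Spec A\<close> be
  the set of the prime filters that arise in this way from finite \<open>P\<close>, ordered by inclusion.  Since
  \<open>P\<close> is finite, the map \<open>P \<rightarrow> Spec A\<close> given by \<open>g\<close> is open; hence \<open>Spec A\<close> is image finite, and
  homomorphisms \<open>A \<rightarrow> U X\<close> correspond to open maps \<open>X \<rightarrow> Spec A\<close> for every image finite \<open>X\<close>.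
  Pullbacks of open maps between finite posets give the gluing of sections, and they show that any
  factorization of the sheaf functor through image finite posets is isomorphic to \<open>Spec\<close>.

  For a finite up-set \<open>F\<close> of \<open>Spec A\<close> the restriction \<open>A \<rightarrow> U F\<close> is surjective, and every homomorphism
  from \<open>A\<close> to a finite algebra factors through one of these restrictions.  So the diagram of the
  algebras \<open>U F\<close> pro-represents the homomorphisms from \<open>A\<close> to finite algebras, which is the universal
  property of the profinite completion.
\<close>

section \<open>Heyting algebras\<close>

text \<open>Two obstacles shape the development. A factorization S is arbitrary and its points live
  in a type of their own, so nothing can be computed inside \<open>fobj S A\<close>. A single
  bijection compares its points with those of the canonical spectrum, and the later arguments are
  made for any poset X with a homomorphism \<epsilon> from A into its up-sets whose point map is a
  bijection onto the canonical spectrum (\<open>is_spectrum\<close>). That map is open, and for open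
  maps bijectivity already yields an order isomorphism. The test objects of the completion are
  arbitrary finite algebras, not algebras of up-sets. Each is embedded into the up-sets of its join
  primes. An embedding is enough: the open map that corresponds to the composite has a finite up-set
  of the spectrum as its image, and injectivity shows that the given homomorphism depends only on
  the restriction to that image. The link between algebra and openness is implication. At a point it
  quantifies over all points above, and open maps preserve and reflect such quantification.\<close>

lemma partial_order_eqI:
  fixes L :: "'a gorder" (structure)
  assumes "eq L = (=)"
    and "\<And>x. x \<in> carrier L \<Longrightarrow> x \<sqsubseteq> x"
    and "\<And>x y. x \<in> carrier L \<Longrightarrow> y \<in> carrier L \<Longrightarrow> x \<sqsubseteq> y \<Longrightarrow> y \<sqsubseteq> x \<Longrightarrow> x = y"
    and "\<And>x y z. x \<in> carrier L \<Longrightarrow> y \<in> carrier L \<Longrightarrow> z \<in> carrier L \<Longrightarrow> x \<sqsubseteq> y \<Longrightarrow> y \<sqsubseteq> z \<Longrightarrow> x \<sqsubseteq> z"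
  shows "partial_order L"
  by unfold_locales (unfold assms(1), (blast intro: assms(2-))+)

lemma partial_order_restrict:
  fixes X :: "'x gorder"
  assumes "partial_order X" "F \<subseteq> carrier X"
  shows "partial_order (X\<lparr>carrier := F\<rparr>)"
proof -
  interpret partial_order X by fact
  show ?thesis
    by (rule partial_order_eqI) 
      (simp_all add: eq_is_equal, (meson assms(2) subsetD le_refl le_antisym le_trans)+)
qed

context
  fixes L :: "'a gorder" (structure) and t b m j i
  assumes po: "partial_order L"
    and top: "t \<in> carrier L" "\<And>x. x \<in> carrier L \<Longrightarrow> x \<sqsubseteq> t"
    and bot: "b \<in> carrier L" "\<And>x. x \<in> carrier L \<Longrightarrow> b \<sqsubseteq> x"
    and meet: "\<And>x y. x \<in> carrier L \<Longrightarrow> y \<in> carrier L \<Longrightarrow> m x y \<in> carrier L"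
      "\<And>x y z. x \<in> carrier L \<Longrightarrow> y \<in> carrier L \<Longrightarrow> z \<in> carrier L \<Longrightarrow> z \<sqsubseteq> m x y \<longleftrightarrow> z \<sqsubseteq> x \<and> z \<sqsubseteq> y"
    and join: "\<And>x y. x \<in> carrier L \<Longrightarrow> y \<in> carrier L \<Longrightarrow> j x y \<in> carrier L"
      "\<And>x y z. x \<in> carrier L \<Longrightarrow> y \<in> carrier L \<Longrightarrow> z \<in> carrier L \<Longrightarrow> j x y \<sqsubseteq> z \<longleftrightarrow> x \<sqsubseteq> z \<and> y \<sqsubseteq> z"
    and imp: "\<And>x y. x \<in> carrier L \<Longrightarrow> y \<in> carrier L \<Longrightarrow> i x y \<in> carrier L"
      "\<And>x y z. x \<in> carrier L \<Longrightarrow> y \<in> carrier L \<Longrightarrow> z \<in> carrier L \<Longrightarrow> z \<sqsubseteq> i x y \<longleftrightarrow> m x z \<sqsubseteq> y"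
begin

interpretation partial_order L by (fact po)

text \<open>Bounds, meets, joins and implications are picked by choice from the order, so candidates
  that obey the order laws of this context must agree with them. The same context serves up-sets and
  limits of diagrams.\<close>

lemma bounds_unique: "\<top> = t" "\<bottom> = b"
proof -
  have "greatest L t (carrier L)" "least L b (carrier L)"
    using top bot by (auto simp: greatest_def least_def)
  then show "\<top> = t" "\<bottom> = b"
    unfolding top_def bottom_def by (auto intro: greatest_unique least_unique)
qed

lemma meet_greatest: 
  assumes "x \<in> carrier L" "y \<in> carrier L"
  shows "greatest L (m x y) (Lower L {x, y})"
  using assms meet(1)[OF assms] meet(2)[OF assms] le_refl[OF meet(1)[OF assms]]
  by (auto simp: greatest_def Lower_def)

lemma join_least:
  assumes "x \<in> carrier L" "y \<in> carrier L"
  shows "least L (j x y) (Upper L {x, y})"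
  using assms join(1)[OF assms] join(2)[OF assms] le_refl[OF join(1)[OF assms]]
  by (auto simp: least_def Upper_def)

lemma meet_unique: "x \<in> carrier L \<Longrightarrow> y \<in> carrier L \<Longrightarrow> x \<sqinter> y = m x y"
  unfolding meet_def Lattice.inf_def by (rule some_equality) (blast intro: meet_greatest greatest_unique)+

lemma join_unique: "x \<in> carrier L \<Longrightarrow> y \<in> carrier L \<Longrightarrow> x \<squnion> y = j x y"
  unfolding join_def Lattice.sup_def by (rule some_equality) (blast intro: join_least least_unique)+

lemma greatest_imp:
  assumes "x \<in> carrier L" "y \<in> carrier L"
  shows "greatest L (i x y) {z \<in> carrier L. x \<sqinter> z \<sqsubseteq> y}"
  using assms imp(1)[OF assms] imp(2)[OF assms] le_refl[OF imp(1)[OF assms]]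
  by (auto simp: greatest_def meet_unique)

lemma himp_unique: "x \<in> carrier L \<Longrightarrow> y \<in> carrier L \<Longrightarrow> himp L x y = i x y"
  unfolding himp_def by (rule some_equality) (blast intro: greatest_imp greatest_unique)+

lemma heyting_algebraI: "heyting_algebra L"
  unfolding heyting_algebra_def
proof (intro conjI ballI)
  show "bounded_lattice L"
  proof unfold_locales
    show "\<exists>s. least L s (Upper L {x, y})" "\<exists>s. greatest L s (Lower L {x, y})"
      if "x \<in> carrier L" "y \<in> carrier L" for x y
      using join_least[OF that] meet_greatest[OF that] by blast+
    show "\<exists>x. least L x (carrier L)" "\<exists>x. greatest L x (carrier L)"
      using top bot unfolding least_def greatest_def by blast+
  qed
  show "\<exists>c. greatest L c {z \<in> carrier L. x \<sqinter> z \<sqsubseteq> y}" if "x \<in> carrier L" "y \<in> carrier L" for x y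
    using greatest_imp that by blast
qed

end

context
  fixes A :: "'a gorder" (structure)
  assumes heyting: "heyting_algebra A"
begin

interpretation bounded_lattice A
  using heyting by (simp add: heyting_algebra_def)

lemma heyting_partial_order: "partial_order A"
  by unfold_locales

lemma heyting_top: "\<top> \<in> carrier A" "a \<in> carrier A \<Longrightarrow> a \<sqsubseteq> \<top>"
  by simp_all

lemma heyting_bottom: "\<bottom> \<in> carrier A" "a \<in> carrier A \<Longrightarrow> \<bottom> \<sqsubseteq> a"
  by simp_all

lemma heyting_meet:
  assumes "a \<in> carrier A" "b \<in> carrier A"
  shows "a \<sqinter> b \<in> carrier A" "c \<in> carrier A \<Longrightarrow> c \<sqsubseteq> a \<sqinter> b \<longleftrightarrow> c \<sqsubseteq> a \<and> c \<sqsubseteq> b"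
  using assms meet_le[of c a b] le_trans[OF _ meet_left, of c a b] le_trans[OF _ meet_right, of c a b] by auto

lemma heyting_join:
  assumes "a \<in> carrier A" "b \<in> carrier A"
  shows "a \<squnion> b \<in> carrier A" "c \<in> carrier A \<Longrightarrow> a \<squnion> b \<sqsubseteq> c \<longleftrightarrow> a \<sqsubseteq> c \<and> b \<sqsubseteq> c"
  using assms join_le[of a c b] le_trans[OF join_left, of a b c] le_trans[OF join_right, of a b c] by auto

lemma heyting_himp:
  assumes "a \<in> carrier A" "b \<in> carrier A"
  shows "himp A a b \<in> carrier A" "c \<in> carrier A \<Longrightarrow> c \<sqsubseteq> himp A a b \<longleftrightarrow> a \<sqinter> c \<sqsubseteq> b"
proof -
  have *: "greatest A (himp A a b) {x \<in> carrier A. a \<sqinter> x \<sqsubseteq> b}"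
    unfolding himp_def using heyting assms by (auto simp: heyting_algebra_def intro: someI_ex)
  then show h: "himp A a b \<in> carrier A" by (auto simp: greatest_def)
  show "c \<sqsubseteq> himp A a b \<longleftrightarrow> a \<sqinter> c \<sqsubseteq> b" if c: "c \<in> carrier A"
  proof
    assume "c \<sqsubseteq> himp A a b"
    then have "a \<sqinter> c \<sqsubseteq> a \<sqinter> himp A a b"
      using assms c h by (meson le_trans meet_closed meet_le meet_left meet_right)
    also have "\<dots> \<sqsubseteq> b" using * by (auto simp: greatest_def)
    finally show "a \<sqinter> c \<sqsubseteq> b" using assms c h by simp
  qed (use * c in \<open>auto simp: greatest_def\<close>)
qed

end

lemmas heyting_closed = heyting_top(1) heyting_bottom(1) heyting_meet(1) heyting_join(1) heyting_himp(1)

lemma ha_homI: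
  assumes "h \<in> carrier A \<rightarrow>\<^sub>E carrier B" "h \<top>\<^bsub>A\<^esub> = \<top>\<^bsub>B\<^esub>" "h \<bottom>\<^bsub>A\<^esub> = \<bottom>\<^bsub>B\<^esub>"
    "\<And>a b. a \<in> carrier A \<Longrightarrow> b \<in> carrier A \<Longrightarrow> h (a \<sqinter>\<^bsub>A\<^esub> b) = h a \<sqinter>\<^bsub>B\<^esub> h b"
    "\<And>a b. a \<in> carrier A \<Longrightarrow> b \<in> carrier A \<Longrightarrow> h (a \<squnion>\<^bsub>A\<^esub> b) = h a \<squnion>\<^bsub>B\<^esub> h b"
    "\<And>a b. a \<in> carrier A \<Longrightarrow> b \<in> carrier A \<Longrightarrow> h (himp A a b) = himp B (h a) (h b)"
  shows "h \<in> ha_hom A B"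
  using assms by (simp add: ha_hom_def)

lemma ha_homD:
  assumes "h \<in> ha_hom A B"
  shows "h \<in> carrier A \<rightarrow>\<^sub>E carrier B" "h \<top>\<^bsub>A\<^esub> = \<top>\<^bsub>B\<^esub>" "h \<bottom>\<^bsub>A\<^esub> = \<bottom>\<^bsub>B\<^esub>"
    "\<And>a b. a \<in> carrier A \<Longrightarrow> b \<in> carrier A \<Longrightarrow> h (a \<sqinter>\<^bsub>A\<^esub> b) = h a \<sqinter>\<^bsub>B\<^esub> h b"
    "\<And>a b. a \<in> carrier A \<Longrightarrow> b \<in> carrier A \<Longrightarrow> h (a \<squnion>\<^bsub>A\<^esub> b) = h a \<squnion>\<^bsub>B\<^esub> h b"
    "\<And>a b. a \<in> carrier A \<Longrightarrow> b \<in> carrier A \<Longrightarrow> h (himp A a b) = himp B (h a) (h b)"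
  using assms by (simp_all add: ha_hom_def)

lemma ha_hom_closed: "h \<in> ha_hom A B \<Longrightarrow> a \<in> carrier A \<Longrightarrow> h a \<in> carrier B"
  by (auto simp: ha_hom_def)

lemma ha_hom_eqI:
  assumes "h \<in> ha_hom A B" "k \<in> ha_hom A C" "\<And>a. a \<in> carrier A \<Longrightarrow> h a = k a"
  shows "h = k"
  using assms by (auto simp: ha_hom_def PiE_iff intro: extensionalityI)

lemma ha_hom_id:
  assumes "heyting_algebra A"
  shows "(\<lambda>a\<in>carrier A. a) \<in> ha_hom A A"
  using assms by (intro ha_homI) (simp_all add: heyting_closed)

lemma ha_hom_compose:
  assumes "heyting_algebra A" "h \<in> ha_hom A B" "k \<in> ha_hom B C"
  shows "compose (carrier A) k h \<in> ha_hom A C"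
  using assms ha_hom_closed[OF assms(2)] ha_hom_closed[OF assms(3)]
  by (intro ha_homI) (auto simp: compose_def heyting_closed ha_homD(2-)[OF assms(2)] ha_homD(2-)[OF assms(3)])

text \<open>Descent along a quotient: each law for f on B is the image under r of the same law for
  the composite on A. A map defined on representatives is turned into a homomorphism in this
  way.\<close>

lemma ha_hom_cancel_surj:
  assumes "heyting_algebra A" "r \<in> ha_hom A B" "r ` carrier A = carrier B"
    and "compose (carrier A) f r \<in> ha_hom A C" "f \<in> extensional (carrier B)"
  shows "f \<in> ha_hom B C"
proof -
  note A = heyting_closed[OF assms(1)]
  note r = ha_homD(2-)[OF assms(2), symmetric] ha_hom_closed[OF assms(2)]
  have fr: "f (r a) = compose (carrier A) f r a" if "a \<in> carrier A" for a
    using that by (simp add: compose_def)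
  have ob: "\<exists>a\<in>carrier A. b = r a" if "b \<in> carrier B" for b
    using that assms(3) by auto
  note h = ha_homD(2-)[OF assms(4)] ha_hom_closed[OF assms(4)]
  show ?thesis
  proof (rule ha_homI)
    show "f \<in> carrier B \<rightarrow>\<^sub>E carrier C"
      using assms(5) by (auto simp: PiE_iff dest!: ob) (metis fr h(6))
    show "f \<top>\<^bsub>B\<^esub> = \<top>\<^bsub>C\<^esub>" "f \<bottom>\<^bsub>B\<^esub> = \<bottom>\<^bsub>C\<^esub>"
      by (simp_all add: r(1,2) fr A h)
    show "f (a \<sqinter>\<^bsub>B\<^esub> b) = f a \<sqinter>\<^bsub>C\<^esub> f b" if "a \<in> carrier B" "b \<in> carrier B" for a b
      using ob[OF that(1)] ob[OF that(2)] by (auto simp: r(3) fr A h)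
    show "f (a \<squnion>\<^bsub>B\<^esub> b) = f a \<squnion>\<^bsub>C\<^esub> f b" if "a \<in> carrier B" "b \<in> carrier B" for a b
      using ob[OF that(1)] ob[OF that(2)] by (auto simp: r(4) fr A h)
    show "f (himp B a b) = himp C (f a) (f b)" if "a \<in> carrier B" "b \<in> carrier B" for a b
      using ob[OF that(1)] ob[OF that(2)] by (auto simp: r(5) fr A h)
  qed
qed

section \<open>Heyting algebras of up-sets\<close>

lemma UU_simps [simp]: "carrier (UU X) = upsets X" "le (UU X) = (\<subseteq>)" "eq (UU X) = (=)"
  by (simp_all add: UU_def)

lemma upsets_subset: "V \<in> upsets X \<Longrightarrow> V \<subseteq> carrier X"
  by (simp add: upsets_def)

lemma upsets_upward: "V \<in> upsets X \<Longrightarrow> x \<in> V \<Longrightarrow> y \<in> carrier X \<Longrightarrow> x \<sqsubseteq>\<^bsub>X\<^esub> y \<Longrightarrow> y \<in> V"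
  by (auto simp: upsets_def)

context
  fixes X :: "'x gorder"
  assumes X: "partial_order X"
begin

interpretation partial_order X by (fact X)

text \<open>Kripke's clause for implication. Quantifying over all points above x makes the set
  upward closed by transitivity; for up-sets V and W it is the largest up-set whose intersection
  with V lies in W.\<close>

abbreviation (input) "upset_imp V W \<equiv> {x \<in> carrier X. \<forall>y\<in>carrier X. x \<sqsubseteq>\<^bsub>X\<^esub> y \<longrightarrow> y \<in> V \<longrightarrow> y \<in> W}"

lemma upset_imp_iff:
  assumes "V \<in> upsets X" "W \<in> upsets X" "Z \<in> upsets X"
  shows "Z \<subseteq> upset_imp V W \<longleftrightarrow> V \<inter> Z \<subseteq> W"
  using assms by (auto simp: upsets_def)

lemma upset_imp_upset: "upset_imp V W \<in> upsets X"
  by (simp add: upsets_def) (blast intro: le_trans)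

lemma UU_partial_order: "partial_order (UU X)"
  by (rule partial_order_eqI) auto

lemma UU_heyting: "heyting_algebra (UU X)"
  and UU_top: "\<top>\<^bsub>UU X\<^esub> = carrier X"
  and UU_bottom: "\<bottom>\<^bsub>UU X\<^esub> = {}"
  and UU_meet: "V \<in> upsets X \<Longrightarrow> W \<in> upsets X \<Longrightarrow> V \<sqinter>\<^bsub>UU X\<^esub> W = V \<inter> W"
  and UU_join: "V \<in> upsets X \<Longrightarrow> W \<in> upsets X \<Longrightarrow> V \<squnion>\<^bsub>UU X\<^esub> W = V \<union> W"
  and UU_himp: "V \<in> upsets X \<Longrightarrow> W \<in> upsets X \<Longrightarrow> himp (UU X) V W = upset_imp V W"
proof -
  have t: "carrier X \<in> carrier (UU X)" "\<And>V. V \<in> carrier (UU X) \<Longrightarrow> V \<sqsubseteq>\<^bsub>UU X\<^esub> carrier X"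
    by (auto simp: upsets_def)
  have b: "{} \<in> carrier (UU X)" "\<And>V. V \<in> carrier (UU X) \<Longrightarrow> {} \<sqsubseteq>\<^bsub>UU X\<^esub> V"
    by (auto simp: upsets_def)
  have m: "\<And>V W. V \<in> carrier (UU X) \<Longrightarrow> W \<in> carrier (UU X) \<Longrightarrow> V \<inter> W \<in> carrier (UU X)"
    "\<And>V W Z. V \<in> carrier (UU X) \<Longrightarrow> W \<in> carrier (UU X) \<Longrightarrow> Z \<in> carrier (UU X) \<Longrightarrow>
      Z \<sqsubseteq>\<^bsub>UU X\<^esub> V \<inter> W \<longleftrightarrow> Z \<sqsubseteq>\<^bsub>UU X\<^esub> V \<and> Z \<sqsubseteq>\<^bsub>UU X\<^esub> W"
    by (auto simp: upsets_def)
  have j: "\<And>V W. V \<in> carrier (UU X) \<Longrightarrow> W \<in> carrier (UU X) \<Longrightarrow> V \<union> W \<in> carrier (UU X)"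
    "\<And>V W Z. V \<in> carrier (UU X) \<Longrightarrow> W \<in> carrier (UU X) \<Longrightarrow> Z \<in> carrier (UU X) \<Longrightarrow>
      V \<union> W \<sqsubseteq>\<^bsub>UU X\<^esub> Z \<longleftrightarrow> V \<sqsubseteq>\<^bsub>UU X\<^esub> Z \<and> W \<sqsubseteq>\<^bsub>UU X\<^esub> Z"
    by (auto simp: upsets_def)
  have i: "\<And>V W. V \<in> carrier (UU X) \<Longrightarrow> W \<in> carrier (UU X) \<Longrightarrow> upset_imp V W \<in> carrier (UU X)"
    "\<And>V W Z. V \<in> carrier (UU X) \<Longrightarrow> W \<in> carrier (UU X) \<Longrightarrow> Z \<in> carrier (UU X) \<Longrightarrow>
      Z \<sqsubseteq>\<^bsub>UU X\<^esub> upset_imp V W \<longleftrightarrow> V \<inter> Z \<sqsubseteq>\<^bsub>UU X\<^esub> W"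
    using upset_imp_upset upset_imp_iff by auto
  note ops = UU_partial_order t b m j i
  show "heyting_algebra (UU X)" by (rule heyting_algebraI[OF ops])
  show "\<top>\<^bsub>UU X\<^esub> = carrier X" "\<bottom>\<^bsub>UU X\<^esub> = {}" by (rule bounds_unique[OF ops]; assumption)+
  show "V \<in> upsets X \<Longrightarrow> W \<in> upsets X \<Longrightarrow> V \<sqinter>\<^bsub>UU X\<^esub> W = V \<inter> W"
    using meet_unique[OF ops] by simp
  show "V \<in> upsets X \<Longrightarrow> W \<in> upsets X \<Longrightarrow> V \<squnion>\<^bsub>UU X\<^esub> W = V \<union> W"
    using join_unique[OF ops] by simp
  show "V \<in> upsets X \<Longrightarrow> W \<in> upsets X \<Longrightarrow> himp (UU X) V W = upset_imp V W"
    using himp_unique[OF ops] by simp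
qed

end


section \<open>Up-sets and open maps\<close>

text \<open>A homomorphism into up-sets becomes a forcing relation between points and elements. All
  clauses at x are local to x, as for a prime filter, except implication, which looks at the points
  above x.\<close>

lemma hom_UU_iff:
  assumes A: "heyting_algebra A" and X: "partial_order X"
  shows "g \<in> ha_hom A (UU X) \<longleftrightarrow> g \<in> carrier A \<rightarrow>\<^sub>E upsets X \<and>
    (\<forall>x\<in>carrier X. x \<in> g \<top>\<^bsub>A\<^esub> \<and> x \<notin> g \<bottom>\<^bsub>A\<^esub> \<and> (\<forall>a\<in>carrier A. \<forall>b\<in>carrier A.
      (x \<in> g (a \<sqinter>\<^bsub>A\<^esub> b) \<longleftrightarrow> x \<in> g a \<and> x \<in> g b) \<and>
      (x \<in> g (a \<squnion>\<^bsub>A\<^esub> b) \<longleftrightarrow> x \<in> g a \<or> x \<in> g b) \<and>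
      (x \<in> g (himp A a b) \<longleftrightarrow> (\<forall>y\<in>carrier X. x \<sqsubseteq>\<^bsub>X\<^esub> y \<longrightarrow> y \<in> g a \<longrightarrow> y \<in> g b))))"
    (is "_ \<longleftrightarrow> _ \<and> ?R")
proof (cases "g \<in> carrier A \<rightarrow>\<^sub>E upsets X")
  case True
  then have g: "g a \<in> upsets X" if "a \<in> carrier A" for a using that by auto
  have eq: "U = V \<longleftrightarrow> (\<forall>x\<in>carrier X. x \<in> U \<longleftrightarrow> x \<in> V)" if "U \<subseteq> carrier X" "V \<subseteq> carrier X" for U V
    using that by blast
  note sub = g[THEN upsets_subset]
  have top: "g \<top>\<^bsub>A\<^esub> = \<top>\<^bsub>UU X\<^esub> \<longleftrightarrow> (\<forall>x\<in>carrier X. x \<in> g \<top>\<^bsub>A\<^esub>)"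
    using sub[OF heyting_top(1)[OF A]] by (auto simp: UU_top[OF X])
  have bot: "g \<bottom>\<^bsub>A\<^esub> = \<bottom>\<^bsub>UU X\<^esub> \<longleftrightarrow> (\<forall>x\<in>carrier X. x \<notin> g \<bottom>\<^bsub>A\<^esub>)"
    using sub[OF heyting_bottom(1)[OF A]] by (auto simp: UU_bottom[OF X])
  have ops: "g (a \<sqinter>\<^bsub>A\<^esub> b) = g a \<sqinter>\<^bsub>UU X\<^esub> g b \<longleftrightarrow> (\<forall>x\<in>carrier X. x \<in> g (a \<sqinter>\<^bsub>A\<^esub> b) \<longleftrightarrow> x \<in> g a \<and> x \<in> g b)"
    "g (a \<squnion>\<^bsub>A\<^esub> b) = g a \<squnion>\<^bsub>UU X\<^esub> g b \<longleftrightarrow> (\<forall>x\<in>carrier X. x \<in> g (a \<squnion>\<^bsub>A\<^esub> b) \<longleftrightarrow> x \<in> g a \<or> x \<in> g b)"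
    "g (himp A a b) = himp (UU X) (g a) (g b) \<longleftrightarrow> (\<forall>x\<in>carrier X. x \<in> g (himp A a b) \<longleftrightarrow>
       (\<forall>y\<in>carrier X. x \<sqsubseteq>\<^bsub>X\<^esub> y \<longrightarrow> y \<in> g a \<longrightarrow> y \<in> g b))"
    if ab: "a \<in> carrier A" "b \<in> carrier A" for a b
  proof -
    note s = sub[OF heyting_meet(1)[OF A ab]] sub[OF heyting_join(1)[OF A ab]]
      sub[OF heyting_himp(1)[OF A ab]] sub[OF ab(1)] sub[OF ab(2)]
    show "g (a \<sqinter>\<^bsub>A\<^esub> b) = g a \<sqinter>\<^bsub>UU X\<^esub> g b \<longleftrightarrow> (\<forall>x\<in>carrier X. x \<in> g (a \<sqinter>\<^bsub>A\<^esub> b) \<longleftrightarrow> x \<in> g a \<and> x \<in> g b)"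
      using s unfolding UU_meet[OF X g[OF ab(1)] g[OF ab(2)]] by (subst eq) auto
    show "g (a \<squnion>\<^bsub>A\<^esub> b) = g a \<squnion>\<^bsub>UU X\<^esub> g b \<longleftrightarrow> (\<forall>x\<in>carrier X. x \<in> g (a \<squnion>\<^bsub>A\<^esub> b) \<longleftrightarrow> x \<in> g a \<or> x \<in> g b)"
      using s unfolding UU_join[OF X g[OF ab(1)] g[OF ab(2)]] by (subst eq) auto
    show "g (himp A a b) = himp (UU X) (g a) (g b) \<longleftrightarrow> (\<forall>x\<in>carrier X. x \<in> g (himp A a b) \<longleftrightarrow>
       (\<forall>y\<in>carrier X. x \<sqsubseteq>\<^bsub>X\<^esub> y \<longrightarrow> y \<in> g a \<longrightarrow> y \<in> g b))"
      using s unfolding UU_himp[OF X g[OF ab(1)] g[OF ab(2)]] by (subst eq) auto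
  qed
  \<comment> \<open>The homomorphism laws have the elements outermost, the forcing clauses have the
    points outermost; this exchanges the quantifiers.\<close>
  have swap: "((\<forall>x\<in>S. T x) \<and> (\<forall>x\<in>S. B x) \<and>
      (\<forall>a\<in>C. \<forall>b\<in>C. (\<forall>x\<in>S. M a b x) \<and> (\<forall>x\<in>S. J a b x) \<and> (\<forall>x\<in>S. I a b x))) \<longleftrightarrow>
    (\<forall>x\<in>S. T x \<and> B x \<and> (\<forall>a\<in>C. \<forall>b\<in>C. M a b x \<and> J a b x \<and> I a b x))"
    for S :: "'b set" and C :: "'a set" and T B M J I by blast
  have "g \<in> ha_hom A (UU X) \<longleftrightarrow> g \<top>\<^bsub>A\<^esub> = \<top>\<^bsub>UU X\<^esub> \<and> g \<bottom>\<^bsub>A\<^esub> = \<bottom>\<^bsub>UU X\<^esub> \<and>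
      (\<forall>a\<in>carrier A. \<forall>b\<in>carrier A. g (a \<sqinter>\<^bsub>A\<^esub> b) = g a \<sqinter>\<^bsub>UU X\<^esub> g b \<and>
        g (a \<squnion>\<^bsub>A\<^esub> b) = g a \<squnion>\<^bsub>UU X\<^esub> g b \<and> g (himp A a b) = himp (UU X) (g a) (g b))"
    using True by (simp add: ha_hom_def)
  also have "\<dots> \<longleftrightarrow> ?R"
    by (simp only: top bot ops cong: ball_cong) (rule swap)
  finally show ?thesis using True by simp
qed (auto simp: ha_hom_def)

lemma hom_UU_D:
  assumes "heyting_algebra A" "partial_order X" "g \<in> ha_hom A (UU X)" "x \<in> carrier X"
  shows "x \<in> g \<top>\<^bsub>A\<^esub>" "x \<notin> g \<bottom>\<^bsub>A\<^esub>"
    "a \<in> carrier A \<Longrightarrow> b \<in> carrier A \<Longrightarrow> x \<in> g (a \<sqinter>\<^bsub>A\<^esub> b) \<longleftrightarrow> x \<in> g a \<and> x \<in> g b"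
    "a \<in> carrier A \<Longrightarrow> b \<in> carrier A \<Longrightarrow> x \<in> g (a \<squnion>\<^bsub>A\<^esub> b) \<longleftrightarrow> x \<in> g a \<or> x \<in> g b"
    "a \<in> carrier A \<Longrightarrow> b \<in> carrier A \<Longrightarrow> x \<in> g (himp A a b) \<longleftrightarrow>
       (\<forall>y\<in>carrier X. x \<sqsubseteq>\<^bsub>X\<^esub> y \<longrightarrow> y \<in> g a \<longrightarrow> y \<in> g b)"
  using assms by (simp_all add: hom_UU_iff)

lemma hom_UU_upsets: "g \<in> ha_hom A (UU X) \<Longrightarrow> a \<in> carrier A \<Longrightarrow> g a \<in> upsets X"
  using ha_hom_closed by fastforce

lemma hom_UU_subset: "g \<in> ha_hom A (UU X) \<Longrightarrow> a \<in> carrier A \<Longrightarrow> g a \<subseteq> carrier X"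
  by (rule upsets_subset[OF hom_UU_upsets])

lemma open_mapsI:
  assumes "f \<in> carrier P \<rightarrow>\<^sub>E carrier Q"
    and "\<And>p p'. p \<in> carrier P \<Longrightarrow> p' \<in> carrier P \<Longrightarrow> p \<sqsubseteq>\<^bsub>P\<^esub> p' \<Longrightarrow> f p \<sqsubseteq>\<^bsub>Q\<^esub> f p'"
    and "\<And>p q. p \<in> carrier P \<Longrightarrow> q \<in> carrier Q \<Longrightarrow> f p \<sqsubseteq>\<^bsub>Q\<^esub> q \<Longrightarrow> \<exists>p'\<in>carrier P. p \<sqsubseteq>\<^bsub>P\<^esub> p' \<and> f p' = q"
  shows "f \<in> open_maps P Q"
  using assms by (simp add: open_maps_def)

lemma open_mapsD:
  assumes "f \<in> open_maps P Q"
  shows "f \<in> carrier P \<rightarrow>\<^sub>E carrier Q"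
    and "p \<in> carrier P \<Longrightarrow> p' \<in> carrier P \<Longrightarrow> p \<sqsubseteq>\<^bsub>P\<^esub> p' \<Longrightarrow> f p \<sqsubseteq>\<^bsub>Q\<^esub> f p'"
    and "p \<in> carrier P \<Longrightarrow> q \<in> carrier Q \<Longrightarrow> f p \<sqsubseteq>\<^bsub>Q\<^esub> q \<Longrightarrow> \<exists>p'\<in>carrier P. p \<sqsubseteq>\<^bsub>P\<^esub> p' \<and> f p' = q"
  using assms by (simp_all add: open_maps_def)

lemma open_maps_closed: "f \<in> open_maps P Q \<Longrightarrow> p \<in> carrier P \<Longrightarrow> f p \<in> carrier Q"
  by (auto simp: open_maps_def)

lemma open_maps_eqI:
  assumes "f \<in> open_maps P Q" "g \<in> open_maps P R" "\<And>p. p \<in> carrier P \<Longrightarrow> f p = g p"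
  shows "f = g"
  using assms by (auto simp: open_maps_def PiE_iff intro: extensionalityI)

lemma open_maps_id: "partial_order P \<Longrightarrow> (\<lambda>p\<in>carrier P. p) \<in> open_maps P P"
  by (rule open_mapsI) (auto dest: partial_order.axioms(1) weak_partial_order.le_refl)

lemma open_maps_compose:
  assumes f: "f \<in> open_maps P Q" and g: "g \<in> open_maps Q R"
  shows "compose (carrier P) g f \<in> open_maps P R"
proof (rule open_mapsI)
  note cl = open_maps_closed[OF f] open_maps_closed[OF g]
  show "compose (carrier P) g f \<in> carrier P \<rightarrow>\<^sub>E carrier R"
    using cl by (auto simp: compose_def)
  show "compose (carrier P) g f p \<sqsubseteq>\<^bsub>R\<^esub> compose (carrier P) g f p'"
    if "p \<in> carrier P" "p' \<in> carrier P" "p \<sqsubseteq>\<^bsub>P\<^esub> p'" for p p'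
    using that cl open_mapsD(2)[OF f] open_mapsD(2)[OF g] by (simp add: compose_def)
  show "\<exists>p'\<in>carrier P. p \<sqsubseteq>\<^bsub>P\<^esub> p' \<and> compose (carrier P) g f p' = r"
    if p: "p \<in> carrier P" and r: "r \<in> carrier R" and le: "compose (carrier P) g f p \<sqsubseteq>\<^bsub>R\<^esub> r" for p r
  proof -
    obtain q where "q \<in> carrier Q" "f p \<sqsubseteq>\<^bsub>Q\<^esub> q" "g q = r"
      using open_mapsD(3)[OF g cl(1)[OF p] r] le p by (auto simp: compose_def)
    moreover then obtain p' where "p' \<in> carrier P" "p \<sqsubseteq>\<^bsub>P\<^esub> p'" "f p' = q"
      using open_mapsD(3)[OF f p] by auto
    ultimately show ?thesis by (auto simp: compose_def)
  qed
qed

lemma open_image_upset: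
  assumes "f \<in> open_maps P Q" "V \<in> upsets P"
  shows "f ` V \<in> upsets Q"
  unfolding upsets_def
proof (intro CollectI conjI ballI impI)
  show "f ` V \<subseteq> carrier Q"
    using assms open_maps_closed upsets_subset by fastforce
  show "q \<in> f ` V" if q: "x \<in> f ` V" "q \<in> carrier Q" "x \<sqsubseteq>\<^bsub>Q\<^esub> q" for x q
  proof -
    obtain p where p: "p \<in> V" "x = f p" using q by auto
    with assms obtain p' where "p' \<in> carrier P" "p \<sqsubseteq>\<^bsub>P\<^esub> p'" "f p' = q"
      using open_mapsD(3)[OF assms(1), of p q] q upsets_subset[OF assms(2)] by blast
    with upsets_upward[OF assms(2) p(1)] show ?thesis by blast
  qed
qed

lemma carrier_upset: "carrier X \<in> upsets X"
  by (simp add: upsets_def)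

lemma UU_map_apply: "V \<in> upsets Y \<Longrightarrow> UU_map X Y f V = {x \<in> carrier X. f x \<in> V}"
  by (simp add: UU_map_def)

lemma preimage_upset:
  assumes f: "f \<in> open_maps X Y" and V: "V \<in> upsets Y"
  shows "{x \<in> carrier X. f x \<in> V} \<in> upsets X"
  unfolding upsets_def
proof (intro CollectI conjI ballI impI)
  fix x y assume "x \<in> {x \<in> carrier X. f x \<in> V}" "y \<in> carrier X" "x \<sqsubseteq>\<^bsub>X\<^esub> y"
  then show "y \<in> carrier X" "f y \<in> V"
    using upsets_upward[OF V] open_mapsD(2)[OF f] open_maps_closed[OF f] by blast+
qed blast

text \<open>Monotonicity gives one direction and the lifting condition the other. This invariance is
  why inverse images along open maps preserve implication.\<close>

lemma open_maps_all_above: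
  assumes f: "f \<in> open_maps X Y" and x: "x \<in> carrier X"
  shows "(\<forall>y\<in>carrier Y. f x \<sqsubseteq>\<^bsub>Y\<^esub> y \<longrightarrow> R y) \<longleftrightarrow> (\<forall>x'\<in>carrier X. x \<sqsubseteq>\<^bsub>X\<^esub> x' \<longrightarrow> R (f x'))"
proof (intro iffI ballI impI)
  fix x' assume "\<forall>y\<in>carrier Y. f x \<sqsubseteq>\<^bsub>Y\<^esub> y \<longrightarrow> R y" "x' \<in> carrier X" "x \<sqsubseteq>\<^bsub>X\<^esub> x'"
  then show "R (f x')" using open_mapsD(2)[OF f x] open_maps_closed[OF f] by blast
next
  fix y assume "\<forall>x'\<in>carrier X. x \<sqsubseteq>\<^bsub>X\<^esub> x' \<longrightarrow> R (f x')" "y \<in> carrier Y" "f x \<sqsubseteq>\<^bsub>Y\<^esub> y"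
  then show "R y" using open_mapsD(3)[OF f x] by blast
qed

lemma UU_map_hom:
  assumes X: "partial_order X" and Y: "partial_order Y" and f: "f \<in> open_maps X Y"
  shows "UU_map X Y f \<in> ha_hom (UU Y) (UU X)"
  unfolding hom_UU_iff[OF UU_heyting[OF Y] X]
proof (intro conjI ballI)
  show "UU_map X Y f \<in> carrier (UU Y) \<rightarrow>\<^sub>E upsets X"
    by (rule PiE_I) (simp_all add: UU_map_def preimage_upset[OF f])
  fix x assume x: "x \<in> carrier X"
  have mem: "x \<in> UU_map X Y f V \<longleftrightarrow> f x \<in> V" if "V \<in> upsets Y" "x \<in> carrier X" for x V
    using that by (simp add: UU_map_def)
  note fx = open_maps_closed[OF f x]
  note cl = heyting_closed[OF UU_heyting[OF Y], unfolded UU_simps]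
  show "x \<in> UU_map X Y f \<top>\<^bsub>UU Y\<^esub>"
    using mem[OF cl(1) x] fx by (simp add: UU_top[OF Y])
  show "x \<notin> UU_map X Y f \<bottom>\<^bsub>UU Y\<^esub>"
    using mem[OF cl(2) x] by (simp add: UU_bottom[OF Y])
  fix V W assume "V \<in> carrier (UU Y)" "W \<in> carrier (UU Y)"
  then have VW: "V \<in> upsets Y" "W \<in> upsets Y" by simp_all
  show "x \<in> UU_map X Y f (V \<sqinter>\<^bsub>UU Y\<^esub> W) \<longleftrightarrow> x \<in> UU_map X Y f V \<and> x \<in> UU_map X Y f W"
    using mem[OF cl(3)[OF VW] x] by (simp add: mem VW x UU_meet[OF Y VW])
  show "x \<in> UU_map X Y f (V \<squnion>\<^bsub>UU Y\<^esub> W) \<longleftrightarrow> x \<in> UU_map X Y f V \<or> x \<in> UU_map X Y f W"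
    using mem[OF cl(4)[OF VW] x] by (simp add: mem VW x UU_join[OF Y VW])
  show "x \<in> UU_map X Y f (himp (UU Y) V W) \<longleftrightarrow>
      (\<forall>x'\<in>carrier X. x \<sqsubseteq>\<^bsub>X\<^esub> x' \<longrightarrow> x' \<in> UU_map X Y f V \<longrightarrow> x' \<in> UU_map X Y f W)"
    using mem[OF cl(5)[OF VW] x, unfolded UU_himp[OF Y VW]] open_maps_all_above[OF f x, of "\<lambda>y. y \<in> V \<longrightarrow> y \<in> W"] fx
    by (simp add: mem VW UU_himp[OF Y VW] cong: ball_cong)
qed

section \<open>Finite posets, their copies in the site and pullbacks\<close>

lemma Kp_Obj: "P \<in> Obj Kp_cat \<longleftrightarrow> partial_order P \<and> finite (carrier P)"
  by (simp add: Kp_cat_def)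

lemma IKp_Obj: "X \<in> Obj IKp_cat \<longleftrightarrow> partial_order X \<and> image_finite X"
  by (simp add: IKp_cat_def)

lemma HA_Obj: "A \<in> Obj HA_cat \<longleftrightarrow> heyting_algebra A"
  by (simp add: HA_cat_def)

lemma Kp_image_finite: "P \<in> Obj Kp_cat \<Longrightarrow> image_finite P"
  by (simp add: Kp_Obj image_finite_def)

lemma principal_upset:
  assumes "partial_order X" "x \<in> carrier X"
  shows "{y \<in> carrier X. x \<sqsubseteq>\<^bsub>X\<^esub> y} \<in> upsets X" "x \<in> {y \<in> carrier X. x \<sqsubseteq>\<^bsub>X\<^esub> y}"
proof -
  interpret partial_order X by fact
  show "{y \<in> carrier X. x \<sqsubseteq>\<^bsub>X\<^esub> y} \<in> upsets X"
    unfolding upsets_def using assms(2) by (simp, blast intro: le_trans)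
qed (use assms in \<open>auto dest: partial_order.axioms(1) weak_partial_order.le_refl\<close>)

text \<open>Objects of the site have their carrier in \<open>nat\<close>, so an enumeration of F is
  used, with the order pulled back along it. Injectivity gives antisymmetry, and the enumeration is
  open as a map into X because F is upward closed.\<close>

lemma finite_upset_Kp_copy:
  fixes X :: "'x gorder"
  assumes X: "partial_order X" and F: "F \<in> fin_upsets X"
  shows "\<exists>P\<in>Obj Kp_cat. \<exists>d\<in>open_maps P X. inj_on d (carrier P) \<and> d ` carrier P = F"
proof -
  interpret partial_order X by (fact X)
  have fin: "finite F" and FX: "F \<in> upsets X" using F by (auto simp: fin_upsets_def)
  obtain e where e: "bij_betw e {0..<card F} F"
    using ex_bij_betw_nat_finite[OF fin] by blast
  define d where "d = restrict e {0..<card F}"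
  define P :: "nat gorder" where "P = \<lparr>carrier = {0..<card F}, eq = (=), le = (\<lambda>i j. d i \<sqsubseteq>\<^bsub>X\<^esub> d j)\<rparr>"
  have inj: "inj_on d {0..<card F}" and im: "d ` {0..<card F} = F"
    using e by (auto simp: d_def bij_betw_def)
  have dX: "d i \<in> carrier X" if "i \<in> carrier P" for i
    using im upsets_subset[OF FX] that by (auto simp: P_def)
  have "partial_order P"
  proof (rule partial_order_eqI)
    show "x \<sqsubseteq>\<^bsub>P\<^esub> x" if "x \<in> carrier P" for x
      using dX[OF that] by (simp add: P_def)
    show "x = y" if "x \<in> carrier P" "y \<in> carrier P" "x \<sqsubseteq>\<^bsub>P\<^esub> y" "y \<sqsubseteq>\<^bsub>P\<^esub> x" for x y
      using le_antisym[of "d x" "d y"] dX[OF that(1)] dX[OF that(2)] inj that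
      by (simp add: P_def inj_on_eq_iff)
    show "x \<sqsubseteq>\<^bsub>P\<^esub> z"
      if "x \<in> carrier P" "y \<in> carrier P" "z \<in> carrier P" "x \<sqsubseteq>\<^bsub>P\<^esub> y" "y \<sqsubseteq>\<^bsub>P\<^esub> z" for x y z
      using le_trans[of "d x" "d y" "d z"] dX[OF that(1)] dX[OF that(2)] dX[OF that(3)] that(4,5)
      by (simp add: P_def)
  qed (simp add: P_def)
  moreover have "d \<in> open_maps P X"
  proof (rule open_mapsI)
    show "d \<in> carrier P \<rightarrow>\<^sub>E carrier X"
      using dX by (auto simp: d_def P_def)
    show "\<exists>p'\<in>carrier P. p \<sqsubseteq>\<^bsub>P\<^esub> p' \<and> d p' = q"
      if "p \<in> carrier P" "q \<in> carrier X" "d p \<sqsubseteq>\<^bsub>X\<^esub> q" for p q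
    proof -
      have "d p \<in> F" using that(1) im by (metis P_def imageI partial_object.select_convs(1))
      then have "q \<in> F" using upsets_upward[OF FX] that by metis
      then have "q \<in> d ` {0..<card F}" by (simp only: im)
      then obtain p' where "p' \<in> {0..<card F}" "q = d p'" by (rule imageE)
      then show ?thesis using that(3) by (intro bexI[of _ p']) (simp_all add: P_def)
    qed
  qed (simp add: P_def)
  ultimately show ?thesis
    using inj im by (intro bexI[of _ P] bexI[of _ d]) (simp_all add: P_def Kp_Obj)
qed

text \<open>W is a copy of the fibre product with the componentwise order. Each projection is open:
  a point above one coordinate has its image in X above the common image, and openness of the other
  map lifts that image. Two points with the same image in X are thereby seen from one finite poset
  over both.\<close>

lemma open_maps_pullback:
  fixes X :: "'x gorder"
  assumes PQ: "P \<in> Obj Kp_cat" "Q \<in> Obj Kp_cat"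
    and f: "f \<in> open_maps P X" and g: "g \<in> open_maps Q X"
    and pq: "p \<in> carrier P" "q \<in> carrier Q" "f p = g q"
  obtains W u v w where "W \<in> Obj Kp_cat" "u \<in> open_maps W P" "v \<in> open_maps W Q"
    "w \<in> carrier W" "u w = p" "v w = q" "\<And>w. w \<in> carrier W \<Longrightarrow> f (u w) = g (v w)"
proof -
  interpret P: partial_order P using PQ by (simp add: Kp_Obj)
  interpret Q: partial_order Q using PQ by (simp add: Kp_Obj)
  define R :: "(nat \<times> nat) gorder" where "R = \<lparr>carrier = {(x, y). x \<in> carrier P \<and> y \<in> carrier Q \<and> f x = g y}, eq = (=),
    le = (\<lambda>(x, y) (x', y'). x \<sqsubseteq>\<^bsub>P\<^esub> x' \<and> y \<sqsubseteq>\<^bsub>Q\<^esub> y')\<rparr>"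
  have R: "partial_order R"
  proof (rule partial_order_eqI)
    show "x \<sqsubseteq>\<^bsub>R\<^esub> z" if "x \<in> carrier R" "y \<in> carrier R" "z \<in> carrier R" "x \<sqsubseteq>\<^bsub>R\<^esub> y" "y \<sqsubseteq>\<^bsub>R\<^esub> z" for x y z
      using that P.le_trans[of "fst x" "fst y" "fst z"] Q.le_trans[of "snd x" "snd y" "snd z"]
      by (simp add: R_def split: prod.splits)
    show "x = y" if "x \<in> carrier R" "y \<in> carrier R" "x \<sqsubseteq>\<^bsub>R\<^esub> y" "y \<sqsubseteq>\<^bsub>R\<^esub> x" for x y
      using that P.le_antisym[of "fst x" "fst y"] Q.le_antisym[of "snd x" "snd y"]
      by (simp add: R_def split: prod.splits)
  qed (auto simp: R_def)
  have "finite (carrier R)"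
    by (rule finite_subset[of _ "carrier P \<times> carrier Q"]) (use PQ in \<open>auto simp: R_def Kp_Obj\<close>)
  then have "carrier R \<in> fin_upsets R" by (simp add: fin_upsets_def carrier_upset)
  from finite_upset_Kp_copy[OF R this] obtain W d where W: "W \<in> Obj Kp_cat" "d \<in> open_maps W R"
    "d ` carrier W = carrier R" by blast
  have 1: "restrict fst (carrier R) \<in> open_maps R P"
  proof (rule open_mapsI)
    show "\<exists>r'\<in>carrier R. r \<sqsubseteq>\<^bsub>R\<^esub> r' \<and> restrict fst (carrier R) r' = x"
      if r: "r \<in> carrier R" and x: "x \<in> carrier P" and le: "restrict fst (carrier R) r \<sqsubseteq>\<^bsub>P\<^esub> x" for r x
    proof -
      obtain x0 y0 where r0: "r = (x0, y0)" "x0 \<in> carrier P" "y0 \<in> carrier Q" "f x0 = g y0" "x0 \<sqsubseteq>\<^bsub>P\<^esub> x"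
        using r le by (auto simp: R_def)
      then have "g y0 \<sqsubseteq>\<^bsub>X\<^esub> f x" using open_mapsD(2)[OF f r0(2) x] by simp
      then obtain y where "y \<in> carrier Q" "y0 \<sqsubseteq>\<^bsub>Q\<^esub> y" "g y = f x"
        using open_mapsD(3)[OF g r0(3) open_maps_closed[OF f x]] by blast
      then show ?thesis using r0 x by (intro bexI[of _ "(x, y)"]) (auto simp: R_def)
    qed
  qed (auto simp: R_def)
  have 2: "restrict snd (carrier R) \<in> open_maps R Q"
  proof (rule open_mapsI)
    show "\<exists>r'\<in>carrier R. r \<sqsubseteq>\<^bsub>R\<^esub> r' \<and> restrict snd (carrier R) r' = y"
      if r: "r \<in> carrier R" and y: "y \<in> carrier Q" and le: "restrict snd (carrier R) r \<sqsubseteq>\<^bsub>Q\<^esub> y" for r y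
    proof -
      obtain x0 y0 where r0: "r = (x0, y0)" "x0 \<in> carrier P" "y0 \<in> carrier Q" "f x0 = g y0" "y0 \<sqsubseteq>\<^bsub>Q\<^esub> y"
        using r le by (auto simp: R_def)
      then have "f x0 \<sqsubseteq>\<^bsub>X\<^esub> g y" using open_mapsD(2)[OF g r0(3) y] by simp
      then obtain x where "x \<in> carrier P" "x0 \<sqsubseteq>\<^bsub>P\<^esub> x" "f x = g y"
        using open_mapsD(3)[OF f r0(2) open_maps_closed[OF g y]] by blast
      then show ?thesis using r0 y by (intro bexI[of _ "(x, y)"]) (auto simp: R_def)
    qed
  qed (auto simp: R_def)
  have "(p, q) \<in> carrier R" using pq by (simp add: R_def)
  then obtain w where w: "w \<in> carrier W" "d w = (p, q)" using W(3) by (metis imageE)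
  show ?thesis
  proof (rule that[OF W(1) open_maps_compose[OF W(2) 1] open_maps_compose[OF W(2) 2] w(1)])
    fix w assume w: "w \<in> carrier W"
    then show "f (compose (carrier W) (restrict fst (carrier R)) d w) =
        g (compose (carrier W) (restrict snd (carrier R)) d w)"
      using open_maps_closed[OF W(2) w] by (auto simp: compose_def R_def)
  qed (use w \<open>(p, q) \<in> carrier R\<close> in \<open>auto simp: compose_def\<close>)
qed


section \<open>The spectrum of a Heyting algebra\<close>

definition spec_map :: "'a gorder \<Rightarrow> 'x gorder \<Rightarrow> ('a \<Rightarrow> 'x set) \<Rightarrow> 'x \<Rightarrow> 'a set" where
  "spec_map A X g = (\<lambda>x\<in>carrier X. {a \<in> carrier A. x \<in> g a})"

definition spec_hom :: "'a gorder \<Rightarrow> 'x gorder \<Rightarrow> ('x \<Rightarrow> 'a set) \<Rightarrow> 'a \<Rightarrow> 'x set" where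
  "spec_hom A X k = (\<lambda>a\<in>carrier A. {x \<in> carrier X. a \<in> k x})"

text \<open>The presentations range over the site only. The prime filters presented by an image
  finite poset on any type occur as well, by restriction to a principal up-set.\<close>

definition spec_poset :: "'a gorder \<Rightarrow> 'a set gorder" where
  "spec_poset A = \<lparr>carrier = (\<Union>P\<in>Obj Kp_cat. \<Union>g\<in>ha_hom A (UU P). spec_map A P g ` carrier P),
     eq = (=), le = (\<subseteq>)\<rparr>"

lemma spec_poset_simps [simp]: "le (spec_poset A) = (\<subseteq>)" "eq (spec_poset A) = (=)"
  by (simp_all add: spec_poset_def)

lemma spec_poset_partial_order: "partial_order (spec_poset A)"
  by (rule partial_order_eqI) auto

lemma spec_pointE:
  assumes "y \<in> carrier (spec_poset A)"
  obtains P g p where "P \<in> Obj Kp_cat" "g \<in> ha_hom A (UU P)" "p \<in> carrier P" "y = spec_map A P g p"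
  using assms by (auto simp: spec_poset_def)

lemma spec_map_apply: "x \<in> carrier X \<Longrightarrow> spec_map A X g x = {a \<in> carrier A. x \<in> g a}"
  by (simp add: spec_map_def)

context
  fixes A :: "'a gorder" and X :: "'x gorder" and Y :: "'y gorder" and g h y
  assumes A: "heyting_algebra A" and X: "partial_order X" and Y: "partial_order Y"
    and g: "g \<in> ha_hom A (UU X)" and h: "h \<in> ha_hom A (UU Y)" and y: "y \<in> carrier Y"
begin

text \<open>The elements holding at y are closed under finite meets, and a meet fails at t as soon
  as one factor does. The empty set is served by \<open>\<top>\<close>.\<close>

lemma finite_meet_separation:
  assumes "finite T" "T \<subseteq> carrier X" "\<forall>t\<in>T. \<exists>b\<in>carrier A. y \<in> h b \<and> t \<notin> g b"
  shows "\<exists>b\<in>carrier A. y \<in> h b \<and> (\<forall>t\<in>T. t \<notin> g b)"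
  using assms
proof (induction T)
  case empty
  show ?case using heyting_top(1)[OF A] hom_UU_D(1)[OF A Y h y] by blast
next
  case (insert t T)
  then obtain b where b: "b \<in> carrier A" "y \<in> h b" "\<forall>t\<in>T. t \<notin> g b" by auto
  obtain c where c: "c \<in> carrier A" "y \<in> h c" "t \<notin> g c" using insert.prems(2) by auto
  show ?case
  proof (intro bexI[of _ "b \<sqinter>\<^bsub>A\<^esub> c"] conjI ballI)
    show "b \<sqinter>\<^bsub>A\<^esub> c \<in> carrier A" using b c by (simp add: heyting_meet[OF A])
    show "y \<in> h (b \<sqinter>\<^bsub>A\<^esub> c)" using hom_UU_D(3)[OF A Y h y b(1) c(1)] b(2) c(2) by simp
    fix u assume "u \<in> insert t T"
    then show "u \<notin> g (b \<sqinter>\<^bsub>A\<^esub> c)"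
      using hom_UU_D(3)[OF A X g _ b(1) c(1), of u] insert.prems(1) b(3) c(3) by auto
  qed
qed

text \<open>Primeness enters here: the elements failing at y are closed under finite joins. The
  empty set is served by \<open>\<bottom>\<close>.\<close>

lemma finite_join_separation:
  assumes "finite T" "T \<subseteq> carrier X" "\<forall>t\<in>T. \<exists>b\<in>carrier A. y \<notin> h b \<and> t \<in> g b"
  shows "\<exists>b\<in>carrier A. y \<notin> h b \<and> (\<forall>t\<in>T. t \<in> g b)"
  using assms
proof (induction T)
  case empty
  show ?case using heyting_bottom(1)[OF A] hom_UU_D(2)[OF A Y h y] by blast
next
  case (insert t T)
  then obtain b where b: "b \<in> carrier A" "y \<notin> h b" "\<forall>t\<in>T. t \<in> g b" by auto
  obtain c where c: "c \<in> carrier A" "y \<notin> h c" "t \<in> g c" using insert.prems(2) by auto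
  show ?case
  proof (intro bexI[of _ "b \<squnion>\<^bsub>A\<^esub> c"] conjI ballI)
    show "b \<squnion>\<^bsub>A\<^esub> c \<in> carrier A" using b c by (simp add: heyting_join[OF A])
    show "y \<notin> h (b \<squnion>\<^bsub>A\<^esub> c)" using hom_UU_D(4)[OF A Y h y b(1) c(1)] b(2) c(2) by simp
    fix u assume "u \<in> insert t T"
    then show "u \<in> g (b \<squnion>\<^bsub>A\<^esub> c)"
      using hom_UU_D(4)[OF A X g _ b(1) c(1), of u] insert.prems(1) b(3) c(3) by auto
  qed
qed

text \<open>
  If every point above \<open>x\<close> differed from \<open>y\<close>, a finite meet \<open>b\<close> and a finite join \<open>c\<close> would
  witness all the differences at once, and \<open>b \<rightarrow> c\<close> would hold at \<open>x\<close> but not at \<open>y\<close>.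
\<close>

lemma spec_point_lift:
  assumes x: "x \<in> carrier X" and fin: "finite {x' \<in> carrier X. x \<sqsubseteq>\<^bsub>X\<^esub> x'}"
    and le: "spec_map A X g x \<subseteq> spec_map A Y h y"
  shows "\<exists>x'\<in>carrier X. x \<sqsubseteq>\<^bsub>X\<^esub> x' \<and> spec_map A X g x' = spec_map A Y h y"
proof -
  let ?up = "{x' \<in> carrier X. x \<sqsubseteq>\<^bsub>X\<^esub> x'}"
  let ?T = "{t \<in> ?up. \<exists>b\<in>carrier A. y \<in> h b \<and> t \<notin> g b}"
  let ?U = "{t \<in> ?up. \<exists>b\<in>carrier A. y \<notin> h b \<and> t \<in> g b}"
  obtain b where b: "b \<in> carrier A" "y \<in> h b" "\<forall>t\<in>?T. t \<notin> g b"
    using finite_meet_separation[of ?T, OF finite_subset[OF _ fin]] by blast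
  obtain c where c: "c \<in> carrier A" "y \<notin> h c" "\<forall>t\<in>?U. t \<in> g c"
    using finite_join_separation[of ?U, OF finite_subset[OF _ fin]] by blast
  have "y \<notin> h (himp A b c)"
    using hom_UU_D(5)[OF A Y h y b(1) c(1)] b(2) c(2) y principal_upset(2)[OF Y y] by blast
  then have "x \<notin> g (himp A b c)"
    using le x y heyting_himp(1)[OF A b(1) c(1)] by (auto simp: spec_map_apply)
  then obtain t where t: "t \<in> carrier X" "x \<sqsubseteq>\<^bsub>X\<^esub> t" "t \<in> g b" "t \<notin> g c"
    using hom_UU_D(5)[OF A X g x b(1) c(1)] by blast
  then have "t \<notin> ?T" "t \<notin> ?U" using b(3) c(3) by blast+
  then have "spec_map A X g t = spec_map A Y h y"
    using t(1,2) y by (auto simp: spec_map_apply)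
  then show ?thesis using t by blast
qed

end

lemma hom_UU_restrict:
  assumes "heyting_algebra A" "partial_order X" "partial_order Y" "d \<in> open_maps X Y" "g \<in> ha_hom A (UU Y)"
  shows "compose (carrier A) (UU_map X Y d) g \<in> ha_hom A (UU X)"
    and "spec_map A X (compose (carrier A) (UU_map X Y d) g) = compose (carrier X) (spec_map A Y g) d"
proof -
  show "compose (carrier A) (UU_map X Y d) g \<in> ha_hom A (UU X)"
    using ha_hom_compose[OF assms(1,5) UU_map_hom[OF assms(2-4)]] .
  show "spec_map A X (compose (carrier A) (UU_map X Y d) g) = compose (carrier X) (spec_map A Y g) d"
    using hom_UU_upsets[OF assms(5)] open_maps_closed[OF assms(4)]
    by (auto simp: spec_map_def compose_def UU_map_apply fun_eq_iff)
qed

context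
  fixes A :: "'a gorder" and X :: "'x gorder"
  assumes A: "heyting_algebra A" and X: "partial_order X" and fin: "image_finite X"
begin

text \<open>The filter at x is visible on the principal up-set of x, which is finite. Restricting g
  along a copy of it in the site presents the same filter.\<close>

lemma spec_map_in_spec:
  assumes g: "g \<in> ha_hom A (UU X)" and x: "x \<in> carrier X"
  shows "spec_map A X g x \<in> carrier (spec_poset A)"
proof -
  have "{y \<in> carrier X. x \<sqsubseteq>\<^bsub>X\<^esub> y} \<in> fin_upsets X"
    using principal_upset[OF X x] fin x by (simp add: fin_upsets_def image_finite_def)
  from finite_upset_Kp_copy[OF X this] obtain P d where P: "P \<in> Obj Kp_cat" "d \<in> open_maps P X"
    "d ` carrier P = {y \<in> carrier X. x \<sqsubseteq>\<^bsub>X\<^esub> y}" by blast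
  obtain p where p: "p \<in> carrier P" "d p = x"
    using principal_upset(2)[OF X x] unfolding P(3)[symmetric] by blast
  have P': "partial_order P" using P(1) by (simp add: Kp_Obj)
  note r = hom_UU_restrict[OF A P' X P(2) g]
  have "spec_map A X g x = spec_map A P (compose (carrier A) (UU_map P X d) g) p"
    unfolding r(2) using p by (simp add: compose_def)
  then show ?thesis
    using P(1) r(1) p(1) by (auto simp: spec_poset_def)
qed

lemma spec_map_open:
  assumes g: "g \<in> ha_hom A (UU X)"
  shows "spec_map A X g \<in> open_maps X (spec_poset A)"
proof (rule open_mapsI)
  show "spec_map A X g \<in> carrier X \<rightarrow>\<^sub>E carrier (spec_poset A)"
    by (rule PiE_I) (simp add: spec_map_in_spec[OF g], simp add: spec_map_def)
  show "spec_map A X g p \<sqsubseteq>\<^bsub>spec_poset A\<^esub> spec_map A X g p'"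
    if "p \<in> carrier X" "p' \<in> carrier X" "p \<sqsubseteq>\<^bsub>X\<^esub> p'" for p p'
    using upsets_upward[OF hom_UU_upsets[OF g], of _ p p'] that by (auto simp: spec_map_apply)
  show "\<exists>p'\<in>carrier X. p \<sqsubseteq>\<^bsub>X\<^esub> p' \<and> spec_map A X g p' = y"
    if p: "p \<in> carrier X" and y: "y \<in> carrier (spec_poset A)" and le: "spec_map A X g p \<sqsubseteq>\<^bsub>spec_poset A\<^esub> y" for p y
  proof -
    obtain Q h q where Q: "Q \<in> Obj Kp_cat" "h \<in> ha_hom A (UU Q)" "q \<in> carrier Q" "y = spec_map A Q h q"
      using y by (rule spec_pointE)
    have Q': "partial_order Q" using Q(1) by (simp add: Kp_Obj)
    show ?thesis
      using spec_point_lift[OF A X Q' g Q(2,3) p] fin p le Q(4) by (simp add: image_finite_def)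
  qed
qed

end

text \<open>The lattice clauses at x concern the filter \<open>k x\<close> alone and are read off a
  finite presentation of it. Implication looks above x; there the lifting condition on k
  enters.\<close>

lemma spec_hom_hom:
  fixes A :: "'a gorder" and X :: "'x gorder"
  assumes A: "heyting_algebra A" and X: "partial_order X"
    and k: "k \<in> open_maps X (spec_poset A)"
  shows "spec_hom A X k \<in> ha_hom A (UU X)"
  unfolding hom_UU_iff[OF A X]
proof (intro conjI ballI)
  have kc: "k x \<in> carrier (spec_poset A)" if "x \<in> carrier X" for x
    using open_maps_closed[OF k that] .
  show "spec_hom A X k \<in> carrier A \<rightarrow>\<^sub>E upsets X"
  proof (rule PiE_I)
    fix a assume "a \<in> carrier A"
    moreover have "{x \<in> carrier X. a \<in> k x} \<in> upsets X"
      unfolding upsets_def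
    proof (intro CollectI conjI ballI impI)
      fix x y assume "x \<in> {x \<in> carrier X. a \<in> k x}" "y \<in> carrier X" "x \<sqsubseteq>\<^bsub>X\<^esub> y"
      then show "y \<in> carrier X" "a \<in> k y" using open_mapsD(2)[OF k, of x y] by auto
    qed blast
    ultimately show "spec_hom A X k a \<in> upsets X" by (simp add: spec_hom_def)
  qed (simp add: spec_hom_def)
  fix x assume x: "x \<in> carrier X"
  have mem: "x \<in> spec_hom A X k a \<longleftrightarrow> a \<in> k x" if "a \<in> carrier A" "x \<in> carrier X" for a x
    using that by (simp add: spec_hom_def)
  obtain Q h q where Q: "Q \<in> Obj Kp_cat" "h \<in> ha_hom A (UU Q)" "q \<in> carrier Q" "k x = spec_map A Q h q"
    using kc[OF x] by (rule spec_pointE)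
  have Q': "partial_order Q" using Q(1) by (simp add: Kp_Obj)
  have kx: "a \<in> k x \<longleftrightarrow> q \<in> h a" if "a \<in> carrier A" for a
    using that Q(3,4) by (simp add: spec_map_apply)
  note D = hom_UU_D[OF A Q' Q(2,3)]
  note cl = heyting_closed[OF A]
  show "x \<in> spec_hom A X k \<top>\<^bsub>A\<^esub>" using D(1) by (simp add: mem x cl kx)
  show "x \<notin> spec_hom A X k \<bottom>\<^bsub>A\<^esub>" using D(2) by (simp add: mem x cl kx)
  fix a b assume ab: "a \<in> carrier A" "b \<in> carrier A"
  show "x \<in> spec_hom A X k (a \<sqinter>\<^bsub>A\<^esub> b) \<longleftrightarrow> x \<in> spec_hom A X k a \<and> x \<in> spec_hom A X k b"
    using D(3)[OF ab] by (simp add: mem x cl kx ab)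
  show "x \<in> spec_hom A X k (a \<squnion>\<^bsub>A\<^esub> b) \<longleftrightarrow> x \<in> spec_hom A X k a \<or> x \<in> spec_hom A X k b"
    using D(4)[OF ab] by (simp add: mem x cl kx ab)
  have Qim: "image_finite Q" using Q(1) by (rule Kp_image_finite)
  note hop = spec_map_open[OF A Q' Qim Q(2)]
  \<comment> \<open>Both sides say that, above \<open>k x\<close> in the spectrum, b holds wherever
    a does. One reading is pulled back along the open map k, the other along the open map that
    presents \<open>k x\<close>.\<close>
  show "x \<in> spec_hom A X k (himp A a b) \<longleftrightarrow>
      (\<forall>y\<in>carrier X. x \<sqsubseteq>\<^bsub>X\<^esub> y \<longrightarrow> y \<in> spec_hom A X k a \<longrightarrow> y \<in> spec_hom A X k b)"
    using D(5)[OF ab] open_maps_all_above[OF k x, of "\<lambda>y. a \<in> y \<longrightarrow> b \<in> y"]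
      open_maps_all_above[OF hop Q(3), of "\<lambda>y. a \<in> y \<longrightarrow> b \<in> y"]
    by (simp add: mem x cl kx ab Q(3,4) spec_map_apply cong: ball_cong)
qed

lemma spec_map_inverse:
  assumes "g \<in> ha_hom A (UU X)"
  shows "spec_hom A X (spec_map A X g) = g"
proof
  fix a show "spec_hom A X (spec_map A X g) a = g a"
  proof (cases "a \<in> carrier A")
    case True
    then show ?thesis using hom_UU_subset[OF assms True] by (auto simp: spec_hom_def spec_map_def)
  next
    case False
    then show ?thesis by (simp add: spec_hom_def PiE_arb[OF ha_homD(1)[OF assms]])
  qed
qed

lemma spec_hom_inverse:
  assumes "k \<in> open_maps X (spec_poset A)"
  shows "spec_map A X (spec_hom A X k) = k"
proof
  fix x show "spec_map A X (spec_hom A X k) x = k x"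
  proof (cases "x \<in> carrier X")
    case True
    have "k x \<subseteq> carrier A"
      using open_maps_closed[OF assms True] by (rule spec_pointE) (auto simp: spec_map_apply)
    then show ?thesis using True by (auto simp: spec_hom_def spec_map_def)
  next
    case False
    then show ?thesis by (simp add: spec_map_def PiE_arb[OF open_mapsD(1)[OF assms]])
  qed
qed

lemma spec_map_bij:
  assumes "heyting_algebra A" "partial_order X" "image_finite X"
  shows "bij_betw (spec_map A X) (ha_hom A (UU X)) (open_maps X (spec_poset A))"
    and "bij_betw (spec_hom A X) (open_maps X (spec_poset A)) (ha_hom A (UU X))"
proof -
  note m = spec_map_open[OF assms] spec_map_inverse spec_hom_hom[OF assms(1,2)] spec_hom_inverse
  show "bij_betw (spec_map A X) (ha_hom A (UU X)) (open_maps X (spec_poset A))"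
    by (rule bij_betwI[where g = "spec_hom A X"]) (simp_all add: m)
  show "bij_betw (spec_hom A X) (open_maps X (spec_poset A)) (ha_hom A (UU X))"
    by (rule bij_betwI[where g = "spec_map A X"]) (simp_all add: m)
qed

lemma spec_poset_image_finite:
  assumes "heyting_algebra A"
  shows "image_finite (spec_poset A)"
  unfolding image_finite_def
proof
  fix y assume "y \<in> carrier (spec_poset A)"
  then obtain P g p where P: "P \<in> Obj Kp_cat" "g \<in> ha_hom A (UU P)" "p \<in> carrier P" "y = spec_map A P g p"
    by (rule spec_pointE)
  have P': "partial_order P" "finite (carrier P)" using P(1) by (auto simp: Kp_Obj)
  note op = spec_map_open[OF assms P'(1) Kp_image_finite[OF P(1)] P(2)]
  have "{z \<in> carrier (spec_poset A). y \<sqsubseteq>\<^bsub>spec_poset A\<^esub> z} \<subseteq> spec_map A P g ` carrier P"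
    using open_mapsD(3)[OF op P(3)] P(4) by blast
  then show "finite {z \<in> carrier (spec_poset A). y \<sqsubseteq>\<^bsub>spec_poset A\<^esub> z}"
    using P'(2) finite_surj by blast
qed


section \<open>Sheaves\<close>

lemma cat_simps [simp]:
  "Arr Kp_cat = open_maps" "Ident Kp_cat = (\<lambda>X. \<lambda>x\<in>carrier X. x)"
  "Cmp Kp_cat = (\<lambda>X Y Z g f. compose (carrier X) g f)"
  "Arr IKp_cat = open_maps" "Ident IKp_cat = (\<lambda>X. \<lambda>x\<in>carrier X. x)"
  "Cmp IKp_cat = (\<lambda>X Y Z g f. compose (carrier X) g f)"
  "Arr HA_cat = ha_hom" "Ident HA_cat = (\<lambda>A. \<lambda>a\<in>carrier A. a)"
  "Cmp HA_cat = (\<lambda>A B C g f. compose (carrier A) g f)"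
  "Obj Set_cat = UNIV" "Arr Set_cat = (\<lambda>X Y. X \<rightarrow>\<^sub>E Y)" "Ident Set_cat = (\<lambda>X. \<lambda>x\<in>X. x)"
  "Cmp Set_cat = (\<lambda>X Y Z g f. compose X g f)"
  "Obj Sh_cat = {F. is_sheaf F}" "Arr Sh_cat = psh_hom"
  "Ident Sh_cat = (\<lambda>F. \<lambda>P\<in>Obj Kp_cat. \<lambda>x\<in>fobj F P. x)"
  "Cmp Sh_cat = (\<lambda>F G H \<theta> \<eta>. \<lambda>P\<in>Obj Kp_cat. compose (fobj F P) (\<theta> P) (\<eta> P))"
  "Obj (op_cat C) = Obj C" "Arr (op_cat C) x y = Arr C y x" "Ident (op_cat C) = Ident C"
  "Cmp (op_cat C) x y z g f = Cmp C z y x f g"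
  by (simp_all add: Kp_cat_def IKp_cat_def HA_cat_def Set_cat_def Sh_cat_def op_cat_def)

lemma Spec_bar_simps [simp]:
  "fobj (fobj Spec_bar A) P = ha_hom A (UU P)"
  "fmap (fobj Spec_bar A) P Q f = (\<lambda>g\<in>ha_hom A (UU P). compose (carrier A) (UU_map Q P f) g)"
  "fmap Spec_bar B A h = (\<lambda>P\<in>Obj Kp_cat. \<lambda>g\<in>ha_hom B (UU P). compose (carrier A) g h)"
  by (simp_all add: Spec_bar_def)

lemma IKp_embedding_simps [simp]:
  "fobj (fobj IKp_embedding X) P = open_maps P X"
  "fmap (fobj IKp_embedding X) P Q f = (\<lambda>g\<in>open_maps P X. compose (carrier Q) g f)"
  "fmap IKp_embedding X Y k = (\<lambda>P\<in>Obj Kp_cat. \<lambda>g\<in>open_maps P X. compose (carrier P) k g)"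
  by (simp_all add: IKp_embedding_def)

lemma Kp_partial_order: "P \<in> Obj Kp_cat \<Longrightarrow> partial_order P"
  by (simp add: Kp_Obj)

text \<open>Openness is local for jointly surjective open families: a point above \<open>f q\<close>
  lifts to a point above q, so both conditions on k at \<open>f q\<close> follow from those on the
  composite at q.\<close>

lemma open_maps_glue:
  assumes k: "k \<in> carrier P \<rightarrow>\<^sub>E carrier X"
    and cover: "\<And>p. p \<in> carrier P \<Longrightarrow> \<exists>(Q :: 'q gorder) f q. f \<in> open_maps Q P \<and> q \<in> carrier Q \<and> f q = p \<and>
        compose (carrier Q) k f \<in> open_maps Q X"
  shows "k \<in> open_maps P X"
proof (rule open_mapsI[OF k])
  fix p assume "p \<in> carrier P"
  from cover[OF this] obtain Q :: "'q gorder" and f q where f: "f \<in> open_maps Q P" and q: "q \<in> carrier Q" "f q = p"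
    and kf: "compose (carrier Q) k f \<in> open_maps Q X" by blast
  show "k p \<sqsubseteq>\<^bsub>X\<^esub> k p'" if p': "p' \<in> carrier P" "p \<sqsubseteq>\<^bsub>P\<^esub> p'" for p'
  proof -
    obtain q' where "q' \<in> carrier Q" "q \<sqsubseteq>\<^bsub>Q\<^esub> q'" "f q' = p'"
      using open_mapsD(3)[OF f q(1) p'(1)] p'(2) q(2) by blast
    then show ?thesis using open_mapsD(2)[OF kf q(1)] q by (force simp: compose_def)
  qed
  show "\<exists>p'\<in>carrier P. p \<sqsubseteq>\<^bsub>P\<^esub> p' \<and> k p' = x" if x: "x \<in> carrier X" "k p \<sqsubseteq>\<^bsub>X\<^esub> x" for x
  proof -
    obtain q' where q': "q' \<in> carrier Q" "q \<sqsubseteq>\<^bsub>Q\<^esub> q'" "k (f q') = x"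
      using open_mapsD(3)[OF kf q(1) x(1)] x(2) q by (auto simp: compose_def)
    then show ?thesis
      using open_mapsD(2)[OF f q(1) q'(1,2)] open_maps_closed[OF f q'(1)] q(2)
      by (intro bexI[of _ "f q'"]) simp_all
  qed
qed

lemma spec_map_inj:
  assumes "spec_map A X g = spec_map A X h" "g \<in> ha_hom A (UU X)" "h \<in> ha_hom A (UU X)"
  shows "g = h"
  using assms spec_map_inverse by metis

lemma UU_map_id: "UU_map X X (\<lambda>x\<in>carrier X. x) = (\<lambda>V\<in>upsets X. V)"
  by (auto simp: UU_map_def upsets_def fun_eq_iff)

lemma UU_map_compose:
  assumes "f \<in> open_maps X Y" "g \<in> open_maps Y Z"
  shows "UU_map X Z (compose (carrier X) g f) = compose (upsets Z) (UU_map X Y f) (UU_map Y Z g)"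
proof
  fix V show "UU_map X Z (compose (carrier X) g f) V = compose (upsets Z) (UU_map X Y f) (UU_map Y Z g) V"
    using open_maps_closed[OF assms(1)] preimage_upset[OF assms(2), of V]
    by (cases "V \<in> upsets Z") (auto simp: UU_map_def compose_def)
qed

lemma U_functor_is_functor: "is_functor IKp_cat (op_cat HA_cat) U_functor"
  unfolding is_functor_def
  by (auto simp: IKp_Obj HA_Obj U_functor_def UU_heyting UU_map_hom UU_map_id UU_map_compose)

lemma Spec_bar_presheaf:
  assumes A: "heyting_algebra A"
  shows "is_functor (op_cat Kp_cat) Set_cat (fobj Spec_bar A)"
  unfolding is_functor_def
proof (intro conjI ballI)
  fix P Q f assume PQ: "P \<in> Obj (op_cat Kp_cat)" "Q \<in> Obj (op_cat Kp_cat)"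
    and f: "f \<in> Arr (op_cat Kp_cat) P Q"
  note po = PQ[simplified, THEN Kp_partial_order]
  show "fmap (fobj Spec_bar A) P Q f \<in> Arr Set_cat (fobj (fobj Spec_bar A) P) (fobj (fobj Spec_bar A) Q)"
    using hom_UU_restrict(1)[OF A po(2,1)] f by simp
  fix R g assume R: "R \<in> Obj (op_cat Kp_cat)" and g: "g \<in> Arr (op_cat Kp_cat) Q R"
  have f': "f \<in> open_maps Q P" and g': "g \<in> open_maps R Q" using f g by simp_all
  show "fmap (fobj Spec_bar A) P R (Cmp (op_cat Kp_cat) P Q R g f) =
    Cmp Set_cat (fobj (fobj Spec_bar A) P) (fobj (fobj Spec_bar A) Q) (fobj (fobj Spec_bar A) R)
      (fmap (fobj Spec_bar A) Q R g) (fmap (fobj Spec_bar A) P Q f)"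
    using hom_UU_restrict(1)[OF A po(2,1) f'] hom_UU_upsets
    by (auto simp: fun_eq_iff compose_def[of "ha_hom A (UU P)"] UU_map_compose[OF g' f'])
      (auto simp: compose_def hom_UU_upsets)
next
  fix P assume "P \<in> Obj (op_cat Kp_cat)"
  then have P: "partial_order P" by (simp add: Kp_Obj)
  have "compose (carrier A) (UU_map P P (\<lambda>x\<in>carrier P. x)) g = g" if g: "g \<in> ha_hom A (UU P)" for g
    using hom_UU_upsets[OF g]
    by (auto simp: UU_map_id compose_def fun_eq_iff PiE_arb[OF ha_homD(1)[OF g]])
  then show "fmap (fobj Spec_bar A) P P (Ident (op_cat Kp_cat) P) = Ident Set_cat (fobj (fobj Spec_bar A) P)"
    by (auto simp: fun_eq_iff)
qed simp

text \<open>Sections over P correspond to open maps from P to the spectrum, and these are glued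
  point by point. Existence uses that openness is local on the cover, uniqueness that every point of
  P is covered.\<close>

lemma Spec_bar_sheaf:
  assumes A: "heyting_algebra A"
  shows "is_sheaf (fobj Spec_bar A)"
  unfolding is_sheaf_def
proof (intro conjI ballI allI impI)
  show "is_functor (op_cat Kp_cat) Set_cat (fobj Spec_bar A)"
    by (rule Spec_bar_presheaf[OF A])
  fix P R s
  assume P: "P \<in> Obj Kp_cat" and "covering_sieve P R \<and> matching_family (fobj Spec_bar A) P R s"
  then have sv: "sieve P R" and cov: "(\<Union>(Q, f)\<in>R. f ` carrier Q) = carrier P"
    and mf: "matching_family (fobj Spec_bar A) P R s" by (auto simp: covering_sieve_def)
  have Rob: "Q \<in> Obj Kp_cat" "f \<in> open_maps Q P" "s Q f \<in> ha_hom A (UU Q)" if "(Q, f) \<in> R" for Q f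
    using sv mf that by (auto simp: sieve_def matching_family_def)
  have Rmatch: "s W (compose (carrier W) f u) = compose (carrier A) (UU_map W Q u) (s Q f)"
    if "(Q, f) \<in> R" "W \<in> Obj Kp_cat" "u \<in> open_maps W Q" for Q f W u
    using mf that Rob[OF that(1)] by (fastforce simp: matching_family_def)
  note po = Kp_partial_order
  \<comment> \<open>The pullback W of two members belongs to the sieve through either leg, and both
    legs give the same arrow to P. The matching condition then equates the two restrictions on W,
    and evaluation at w compares the two points.\<close>
  have wd: "spec_map A Q (s Q f) q = spec_map A Q' (s Q' f') q'"
    if R: "(Q, f) \<in> R" "(Q', f') \<in> R" and q: "q \<in> carrier Q" "q' \<in> carrier Q'" and eq: "f q = f' q'"
    for Q f q Q' f' q'
  proof -
    obtain W u v w where W: "W \<in> Obj Kp_cat" "u \<in> open_maps W Q" "v \<in> open_maps W Q'" "w \<in> carrier W"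
      "u w = q" "v w = q'" "\<And>w. w \<in> carrier W \<Longrightarrow> f (u w) = f' (v w)"
      using open_maps_pullback[OF Rob(1)[OF R(1)] Rob(1)[OF R(2)] Rob(2)[OF R(1)] Rob(2)[OF R(2)] q eq] by metis
    have "compose (carrier W) f u = compose (carrier W) f' v"
      using W(7) by (auto simp: compose_def fun_eq_iff)
    then have "compose (carrier A) (UU_map W Q u) (s Q f) = compose (carrier A) (UU_map W Q' v) (s Q' f')"
      using Rmatch[OF R(1) W(1,2)] Rmatch[OF R(2) W(1,3)] by simp
    then have "compose (carrier W) (spec_map A Q (s Q f)) u = compose (carrier W) (spec_map A Q' (s Q' f')) v"
      using hom_UU_restrict(2)[OF A po[OF W(1)] po[OF Rob(1)[OF R(1)]] W(2) Rob(3)[OF R(1)]]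
        hom_UU_restrict(2)[OF A po[OF W(1)] po[OF Rob(1)[OF R(2)]] W(3) Rob(3)[OF R(2)]] by metis
    then show ?thesis
      using W(4-6) compose_eq by metis
  qed
  \<comment> \<open>By \<open>wd\<close> the chosen filter does not depend on the member of the
    sieve through which p is reached.\<close>
  define k where "k = (\<lambda>p\<in>carrier P. SOME y. \<exists>Q f q. (Q, f) \<in> R \<and> q \<in> carrier Q \<and> f q = p \<and>
    y = spec_map A Q (s Q f) q)"
  have k0: "k (f q) = spec_map A Q (s Q f) q" if R: "(Q, f) \<in> R" and q: "q \<in> carrier Q" for Q f q
  proof -
    have "(SOME y. \<exists>Q' f' q'. (Q', f') \<in> R \<and> q' \<in> carrier Q' \<and> f' q' = f q \<and>
        y = spec_map A Q' (s Q' f') q') = spec_map A Q (s Q f) q"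
    proof (rule some_equality)
      show "\<exists>Q' f' q'. (Q', f') \<in> R \<and> q' \<in> carrier Q' \<and> f' q' = f q \<and>
          spec_map A Q (s Q f) q = spec_map A Q' (s Q' f') q'"
        using R q by blast
      fix y assume "\<exists>Q' f' q'. (Q', f') \<in> R \<and> q' \<in> carrier Q' \<and> f' q' = f q \<and>
          y = spec_map A Q' (s Q' f') q'"
      then obtain Q' f' q' where Q': "(Q', f') \<in> R" "q' \<in> carrier Q'" "f' q' = f q"
        and y: "y = spec_map A Q' (s Q' f') q'" by blast
      show "y = spec_map A Q (s Q f) q" unfolding y by (rule wd[OF Q'(1) R Q'(2) q Q'(3)])
    qed
    then show ?thesis using open_maps_closed[OF Rob(2)[OF R] q] by (simp add: k_def)
  qed
  have kf: "compose (carrier Q) k f = spec_map A Q (s Q f)" if R: "(Q, f) \<in> R" for Q f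
    using k0[OF R] by (simp add: fun_eq_iff compose_def spec_map_def)
  have sop: "spec_map A Q (s Q f) \<in> open_maps Q (spec_poset A)" if R: "(Q, f) \<in> R" for Q f
    using spec_map_open[OF A po[OF Rob(1)[OF R]] Kp_image_finite[OF Rob(1)[OF R]] Rob(3)[OF R]] .
  have cover: "\<exists>Q f q. (Q, f) \<in> R \<and> q \<in> carrier Q \<and> f q = p" if "p \<in> carrier P" for p
    using that unfolding cov[symmetric] by auto
  have k: "k \<in> open_maps P (spec_poset A)"
  proof (rule open_maps_glue)
    show "k \<in> carrier P \<rightarrow>\<^sub>E carrier (spec_poset A)"
    proof (rule PiE_I)
      fix p assume p: "p \<in> carrier P"
      with cover obtain Q f q where Q: "(Q, f) \<in> R" "q \<in> carrier Q" "f q = p" by blast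
      have "k p = spec_map A Q (s Q f) q" using k0[OF Q(1,2)] Q(3) by simp
      then show "k p \<in> carrier (spec_poset A)" using open_maps_closed[OF sop[OF Q(1)] Q(2)] by simp
    qed (simp add: k_def)
    fix p assume "p \<in> carrier P"
    with cover obtain Q f q where Q: "(Q, f) \<in> R" "q \<in> carrier Q" "f q = p" by blast
    then show "\<exists>(Q :: nat gorder) f q. f \<in> open_maps Q P \<and> q \<in> carrier Q \<and> f q = p \<and>
        compose (carrier Q) k f \<in> open_maps Q (spec_poset A)"
      using Rob(2)[OF Q(1)] sop[OF Q(1)] kf[OF Q(1)] by metis
  qed
  have P': "partial_order P" using P by (rule po)
  show "\<exists>!t. t \<in> fobj (fobj Spec_bar A) P \<and> (\<forall>(Q, f)\<in>R. fmap (fobj Spec_bar A) P Q f t = s Q f)"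
  proof (rule ex1I[of _ "spec_hom A P k"])
    have t: "spec_hom A P k \<in> ha_hom A (UU P)" by (rule spec_hom_hom[OF A P' k])
    have "compose (carrier A) (UU_map Q P f) (spec_hom A P k) = s Q f" if R: "(Q, f) \<in> R" for Q f
    proof (rule spec_map_inj)
      note r = hom_UU_restrict[OF A po[OF Rob(1)[OF R]] P' Rob(2)[OF R] t]
      show "spec_map A Q (compose (carrier A) (UU_map Q P f) (spec_hom A P k)) = spec_map A Q (s Q f)"
        unfolding r(2) spec_hom_inverse[OF k] kf[OF R] ..
      show "compose (carrier A) (UU_map Q P f) (spec_hom A P k) \<in> ha_hom A (UU Q)" by (rule r(1))
      show "s Q f \<in> ha_hom A (UU Q)" by (rule Rob(3)[OF R])
    qed
    then show "spec_hom A P k \<in> fobj (fobj Spec_bar A) P \<and>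
        (\<forall>(Q, f)\<in>R. fmap (fobj Spec_bar A) P Q f (spec_hom A P k) = s Q f)"
      using t by auto
  next
    fix t assume "t \<in> fobj (fobj Spec_bar A) P \<and> (\<forall>(Q, f)\<in>R. fmap (fobj Spec_bar A) P Q f t = s Q f)"
    then have t: "t \<in> ha_hom A (UU P)" and
      tf: "\<And>Q f. (Q, f) \<in> R \<Longrightarrow> compose (carrier A) (UU_map Q P f) t = s Q f" by auto
    have "spec_map A P t p = k p" for p
    proof (cases "p \<in> carrier P")
      case True
      with cover obtain Q f q where Q: "(Q, f) \<in> R" "q \<in> carrier Q" "f q = p" by blast
      note r = hom_UU_restrict(2)[OF A po[OF Rob(1)[OF Q(1)]] P' Rob(2)[OF Q(1)] t]
      have "compose (carrier Q) (spec_map A P t) f = compose (carrier Q) k f"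
        using r unfolding tf[OF Q(1)] kf[OF Q(1)] by simp
      then show ?thesis using Q(2,3) compose_eq by metis
    next
      case False
      then show ?thesis by (simp add: k_def spec_map_def)
    qed
    then have "spec_map A P t = k" by (rule ext)
    then show "t = spec_hom A P k" using spec_map_inverse[OF t] by simp
  qed
qed

lemma Spec_bar_functor: "is_functor (op_cat HA_cat) Sh_cat Spec_bar"
  unfolding is_functor_def
proof (intro conjI ballI)
  show "fobj Spec_bar A \<in> Obj Sh_cat" if "A \<in> Obj (op_cat HA_cat)" for A
    using that Spec_bar_sheaf by (simp add: HA_Obj)
  show "fmap Spec_bar A A (Ident (op_cat HA_cat) A) = Ident Sh_cat (fobj Spec_bar A)"
    if "A \<in> Obj (op_cat HA_cat)" for A
  proof -
    have "compose (carrier A) g (\<lambda>a\<in>carrier A. a) = g" if "g \<in> ha_hom A (UU P)" for g and P :: "nat gorder"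
      by (auto simp: compose_def fun_eq_iff PiE_arb[OF ha_homD(1)[OF that]])
    then show ?thesis by (auto simp: fun_eq_iff)
  qed
next
  fix B A h assume "B \<in> Obj (op_cat HA_cat)" "A \<in> Obj (op_cat HA_cat)" "h \<in> Arr (op_cat HA_cat) B A"
  then have A: "heyting_algebra A" and B: "heyting_algebra B" and h: "h \<in> ha_hom A B" by (simp_all add: HA_Obj)
  have comp: "compose (carrier A) g h \<in> ha_hom A (UU P)" if "g \<in> ha_hom B (UU P)" for g and P :: "nat gorder"
    using ha_hom_compose[OF A h that] .
  show "fmap Spec_bar B A h \<in> Arr Sh_cat (fobj Spec_bar B) (fobj Spec_bar A)"
    unfolding cat_simps psh_hom_def
  proof (intro CollectI conjI ballI)
    show "fmap Spec_bar B A h \<in> (\<Pi>\<^sub>E P\<in>Obj Kp_cat. fobj (fobj Spec_bar B) P \<rightarrow>\<^sub>E fobj (fobj Spec_bar A) P)"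
      using comp by auto
    fix P Q :: "nat gorder" and f g
    assume PQ: "P \<in> Obj Kp_cat" "Q \<in> Obj Kp_cat" and f: "f \<in> open_maps Q P" and "g \<in> fobj (fobj Spec_bar B) P"
    then have g: "g \<in> ha_hom B (UU P)" by simp
    have "compose (carrier B) (UU_map Q P f) g \<in> ha_hom B (UU Q)"
      using hom_UU_restrict(1)[OF B] PQ f g Kp_partial_order by blast
    moreover have "compose (carrier A) (compose (carrier B) (UU_map Q P f) g) h =
        compose (carrier A) (UU_map Q P f) (compose (carrier A) g h)"
      using ha_hom_closed[OF h] by (auto simp: compose_def fun_eq_iff)
    ultimately show "fmap Spec_bar B A h Q (fmap (fobj Spec_bar B) P Q f g) =
        fmap (fobj Spec_bar A) P Q f (fmap Spec_bar B A h P g)"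
      using PQ g comp[OF g] by simp
  qed
  fix C k assume "C \<in> Obj (op_cat HA_cat)" "k \<in> Arr (op_cat HA_cat) A C"
  then have C: "heyting_algebra C" and k: "k \<in> ha_hom C A" by (simp_all add: HA_Obj)
  have "compose (carrier C) g (compose (carrier C) h k) = compose (carrier C) (compose (carrier A) g h) k" for g
    using ha_hom_closed[OF k] by (auto simp: compose_def fun_eq_iff)
  then show "fmap Spec_bar B C (Cmp (op_cat HA_cat) B A C k h) =
      Cmp Sh_cat (fobj Spec_bar B) (fobj Spec_bar A) (fobj Spec_bar C) (fmap Spec_bar A C k) (fmap Spec_bar B A h)"
    using comp by (auto simp: fun_eq_iff compose_def[of "ha_hom B _"])
qed


section \<open>Factorizations through image finite posets\<close>

definition spec_poset_map :: "'b gorder \<Rightarrow> 'a gorder \<Rightarrow> ('a \<Rightarrow> 'b) \<Rightarrow> 'b set \<Rightarrow> 'a set" where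
  "spec_poset_map B A h = (\<lambda>x\<in>carrier (spec_poset B). {a \<in> carrier A. h a \<in> x})"

lemma spec_point_subset: "x \<in> carrier (spec_poset A) \<Longrightarrow> x \<subseteq> carrier A"
  by (erule spec_pointE) (auto simp: spec_map_apply)

lemma spec_poset_map_natural:
  assumes A: "heyting_algebra A" and B: "heyting_algebra B" and h: "h \<in> ha_hom A B"
    and X: "partial_order X" "image_finite X" and g: "g \<in> ha_hom B (UU X)"
  shows "compose (carrier X) (spec_poset_map B A h) (spec_map B X g) = spec_map A X (compose (carrier A) g h)"
  using ha_hom_closed[OF h] spec_map_in_spec[OF B X g]
  by (auto simp: fun_eq_iff compose_def spec_poset_map_def spec_map_def)

text \<open>Along a presentation g the map becomes the point map of g after h, which is open.
  Presentations cover the spectrum, so openness glues.\<close>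

lemma spec_poset_map_open:
  assumes A: "heyting_algebra A" and B: "heyting_algebra B" and h: "h \<in> ha_hom A B"
  shows "spec_poset_map B A h \<in> open_maps (spec_poset B) (spec_poset A)"
proof -
  have pt: "\<exists>(Q :: nat gorder) f q. f \<in> open_maps Q (spec_poset B) \<and> q \<in> carrier Q \<and> f q = x \<and>
        compose (carrier Q) (spec_poset_map B A h) f \<in> open_maps Q (spec_poset A)"
    if x: "x \<in> carrier (spec_poset B)" for x
  proof -
    obtain P g p where P: "P \<in> Obj Kp_cat" "g \<in> ha_hom B (UU P)" "p \<in> carrier P" "x = spec_map B P g p"
      using x by (rule spec_pointE)
    note P' = Kp_partial_order[OF P(1)] Kp_image_finite[OF P(1)]
    have "compose (carrier P) (spec_poset_map B A h) (spec_map B P g) \<in> open_maps P (spec_poset A)"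
      unfolding spec_poset_map_natural[OF A B h P' P(2)]
      by (rule spec_map_open[OF A P' ha_hom_compose[OF A h P(2)]])
    then show ?thesis using spec_map_open[OF B P' P(2)] P(3,4) by blast
  qed
  show ?thesis
  proof (rule open_maps_glue)
    show "spec_poset_map B A h \<in> carrier (spec_poset B) \<rightarrow>\<^sub>E carrier (spec_poset A)"
    proof (rule PiE_I)
      fix x assume "x \<in> carrier (spec_poset B)"
      from pt[OF this] obtain Q :: "nat gorder" and f q where q: "q \<in> carrier Q" "f q = x"
        "compose (carrier Q) (spec_poset_map B A h) f \<in> open_maps Q (spec_poset A)" by blast
      then show "spec_poset_map B A h x \<in> carrier (spec_poset A)"
        using open_maps_closed[OF q(3,1)] by (simp add: compose_eq)
    qed (simp add: spec_poset_map_def)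
  qed (fact pt)
qed

lemma canonical_factorization:
  "IKp_factorization \<lparr>fobj = spec_poset, fmap = spec_poset_map\<rparr>
     (\<lambda>A. \<lambda>P\<in>Obj Kp_cat. \<lambda>g\<in>ha_hom A (UU P). spec_map A P g)" (is "IKp_factorization ?S ?\<alpha>")
  unfolding IKp_factorization_def is_functor_def
proof (intro conjI ballI)
  fix A :: "'a gorder" assume "A \<in> Obj (op_cat HA_cat)"
  then have A: "heyting_algebra A" by (simp add: HA_Obj)
  show "fobj ?S A \<in> Obj IKp_cat"
    by (simp add: IKp_Obj spec_poset_partial_order spec_poset_image_finite[OF A])
  have "{a \<in> carrier A. (\<lambda>a\<in>carrier A. a) a \<in> x} = x" if "x \<in> carrier (spec_poset A)" for x
    using spec_point_subset[OF that] by auto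
  then show "fmap ?S A A (Ident (op_cat HA_cat) A) =
      Ident IKp_cat (fobj ?S A)"
    by (simp add: spec_poset_map_def fun_eq_iff)
next
  fix B A :: "'a gorder" and h
  assume "B \<in> Obj (op_cat HA_cat)" "A \<in> Obj (op_cat HA_cat)" "h \<in> Arr (op_cat HA_cat) B A"
  then have A: "heyting_algebra A" and B: "heyting_algebra B" and h: "h \<in> ha_hom A B" by (simp_all add: HA_Obj)
  show "fmap ?S B A h \<in> Arr IKp_cat
      (fobj ?S B) (fobj ?S A)"
    using spec_poset_map_open[OF A B h] by simp
  fix C k assume "C \<in> Obj (op_cat HA_cat)" "k \<in> Arr (op_cat HA_cat) A C"
  then have k: "k \<in> ha_hom C A" by simp
  show "fmap ?S B C (Cmp (op_cat HA_cat) B A C k h) =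
     Cmp IKp_cat (fobj ?S B)
      (fobj ?S A) (fobj ?S C)
      (fmap ?S A C k)
      (fmap ?S B A h)"
    using ha_hom_closed[OF k] open_maps_closed[OF spec_poset_map_open[OF A B h]]
    by (auto simp: fun_eq_iff compose_def spec_poset_map_def)
next
  fix A :: "'a gorder" assume "A \<in> Obj HA_cat"
  then have A: "heyting_algebra A" by (simp add: HA_Obj)
  show "psh_iso (fobj Spec_bar A) (fobj IKp_embedding (fobj ?S A))
      (?\<alpha> A)"
    unfolding psh_iso_def psh_hom_def
  proof (intro conjI ballI CollectI)
    note bij = spec_map_bij(1)[OF A Kp_partial_order Kp_image_finite]
    show "?\<alpha> A \<in> (\<Pi>\<^sub>E P\<in>Obj Kp_cat.
        fobj (fobj Spec_bar A) P \<rightarrow>\<^sub>E fobj (fobj IKp_embedding (fobj ?S A)) P)"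
      using bij[THEN bij_betwE] by auto
    show "bij_betw (?\<alpha> A P) (fobj (fobj Spec_bar A) P)
        (fobj (fobj IKp_embedding (fobj ?S A)) P)"
      if "P \<in> Obj Kp_cat" for P
      using bij[OF that that] that by (simp add: bij_betw_cong[of "ha_hom A (UU P)" "restrict (spec_map A P) _" "spec_map A P"])
    fix P Q f g assume PQ: "P \<in> Obj Kp_cat" "Q \<in> Obj Kp_cat" and "f \<in> Arr Kp_cat Q P" "g \<in> fobj (fobj Spec_bar A) P"
    then have f: "f \<in> open_maps Q P" and g: "g \<in> ha_hom A (UU P)" by simp_all
    note r = hom_UU_restrict[OF A Kp_partial_order[OF PQ(2)] Kp_partial_order[OF PQ(1)] f g]
    show "?\<alpha> A Q (fmap (fobj Spec_bar A) P Q f g) =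
        fmap (fobj IKp_embedding (fobj ?S A)) P Q f
          (?\<alpha> A P g)"
      using PQ g r spec_map_open[OF A Kp_partial_order[OF PQ(1)] Kp_image_finite[OF PQ(1)] g] by simp
  qed
next
  fix A B :: "'a gorder" and h P g
  assume "A \<in> Obj HA_cat" "B \<in> Obj HA_cat" and h: "h \<in> ha_hom A B" and P: "P \<in> Obj Kp_cat"
    and "g \<in> fobj (fobj Spec_bar B) P"
  then have A: "heyting_algebra A" and B: "heyting_algebra B" and g: "g \<in> ha_hom B (UU P)"
    by (simp_all add: HA_Obj)
  note P' = Kp_partial_order[OF P] Kp_image_finite[OF P]
  show "?\<alpha> A P (fmap Spec_bar B A h P g) =
      fmap IKp_embedding (fobj ?S B)
        (fobj ?S A)
        (fmap ?S B A h) P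
        (?\<alpha> B P g)"
    using P g ha_hom_compose[OF A h g] spec_map_open[OF B P' g] spec_poset_map_natural[OF A B h P' g]
    by simp
qed

text \<open>
  Any two factorizations agree pointwise: each point of \<open>S A\<close> has the form \<open>\<alpha> A P g p\<close>, and
  \<open>factor_iso\<close> sends it to the point of the canonical spectrum that \<open>g\<close> and \<open>p\<close> determine.
\<close>

definition factor_iso ::
  "('a gorder, 'a \<Rightarrow> 'a, 's gorder, 's \<Rightarrow> 's) functr \<Rightarrow>
   ('a gorder \<Rightarrow> nat gorder \<Rightarrow> ('a \<Rightarrow> nat set) \<Rightarrow> nat \<Rightarrow> 's) \<Rightarrow> 'a gorder \<Rightarrow> 's \<Rightarrow> 'a set" where
  "factor_iso S \<alpha> A = (\<lambda>x\<in>carrier (fobj S A). SOME y. \<exists>P g p. P \<in> Obj Kp_cat \<and> g \<in> ha_hom A (UU P) \<and>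
     p \<in> carrier P \<and> \<alpha> A P g p = x \<and> y = spec_map A P g p)"

context
  fixes S :: "('a gorder, 'a \<Rightarrow> 'a, 's gorder, 's \<Rightarrow> 's) functr" and \<alpha>
  assumes fac: "IKp_factorization S \<alpha>"
begin

lemma factor_functor: "is_functor (op_cat HA_cat) IKp_cat S"
  using fac by (simp add: IKp_factorization_def)

lemma factor_obj:
  assumes "heyting_algebra A"
  shows "partial_order (fobj S A)" "image_finite (fobj S A)"
  using factor_functor assms by (auto simp: is_functor_def HA_Obj IKp_Obj)

lemma factor_map:
  assumes "heyting_algebra A" "heyting_algebra B" "h \<in> ha_hom A B"
  shows "fmap S B A h \<in> open_maps (fobj S B) (fobj S A)"
  using factor_functor assms by (auto simp: is_functor_def HA_Obj)

lemma factor_alpha_bij: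
  assumes "heyting_algebra A" "P \<in> Obj Kp_cat"
  shows "bij_betw (\<alpha> A P) (ha_hom A (UU P)) (open_maps P (fobj S A))"
  using fac assms by (simp add: IKp_factorization_def psh_iso_def HA_Obj)

lemma factor_alpha_open:
  assumes "heyting_algebra A" "P \<in> Obj Kp_cat" "g \<in> ha_hom A (UU P)"
  shows "\<alpha> A P g \<in> open_maps P (fobj S A)"
  using bij_betwE[OF factor_alpha_bij[OF assms(1,2)]] assms(3) by blast

lemma factor_alpha_restrict:
  assumes "heyting_algebra A" "P \<in> Obj Kp_cat" "Q \<in> Obj Kp_cat" "f \<in> open_maps Q P" "g \<in> ha_hom A (UU P)"
  shows "\<alpha> A Q (compose (carrier A) (UU_map Q P f) g) = compose (carrier Q) (\<alpha> A P g) f"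
proof -
  have "\<alpha> A \<in> psh_hom (fobj Spec_bar A) (fobj IKp_embedding (fobj S A))"
    using fac assms by (simp add: IKp_factorization_def psh_iso_def HA_Obj)
  then have "\<alpha> A Q (fmap (fobj Spec_bar A) P Q f g) = fmap (fobj IKp_embedding (fobj S A)) P Q f (\<alpha> A P g)"
    using assms unfolding psh_hom_def by simp
  then show ?thesis using assms factor_alpha_open[OF assms(1,2,5)] by simp
qed

lemma factor_alpha_natural:
  assumes "heyting_algebra A" "heyting_algebra B" "h \<in> ha_hom A B" "P \<in> Obj Kp_cat" "g \<in> ha_hom B (UU P)"
  shows "\<alpha> A P (compose (carrier A) g h) = compose (carrier P) (fmap S B A h) (\<alpha> B P g)"
proof -
  have "\<alpha> A P (fmap Spec_bar B A h P g) =
      fmap IKp_embedding (fobj S B) (fobj S A) (fmap S B A h) P (\<alpha> B P g)"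
    using fac assms by (simp add: IKp_factorization_def HA_Obj)
  then show ?thesis using assms factor_alpha_open[OF assms(2,4,5)] by simp
qed

text \<open>Each side of the equivalence says that g and h have equal restrictions on some finite W
  with a point over both p and q. The pullback over \<open>fobj S A\<close>, or over the spectrum,
  supplies W; there an equality of open maps is turned into an equality of homomorphisms because
  \<open>\<alpha> A W\<close>, or \<open>spec_map\<close>, is injective. Restrictions are respected
  by both correspondences, so the argument runs in either direction.\<close>

lemma factor_point_iff:
  assumes A: "heyting_algebra A" and P: "P \<in> Obj Kp_cat" "g \<in> ha_hom A (UU P)" "p \<in> carrier P"
    and Q: "Q \<in> Obj Kp_cat" "h \<in> ha_hom A (UU Q)" "q \<in> carrier Q"
  shows "\<alpha> A P g p = \<alpha> A Q h q \<longleftrightarrow> spec_map A P g p = spec_map A Q h q"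
proof -
  note po = Kp_partial_order[OF P(1)] Kp_partial_order[OF Q(1)]
  note op = factor_alpha_open[OF A P(1,2)] factor_alpha_open[OF A Q(1,2)]
  note sop = spec_map_open[OF A po(1) Kp_image_finite[OF P(1)] P(2)]
    spec_map_open[OF A po(2) Kp_image_finite[OF Q(1)] Q(2)]
  show ?thesis
  proof
    assume eq: "\<alpha> A P g p = \<alpha> A Q h q"
    obtain W u v w where W: "W \<in> Obj Kp_cat" "u \<in> open_maps W P" "v \<in> open_maps W Q" "w \<in> carrier W"
      "u w = p" "v w = q" "\<And>w. w \<in> carrier W \<Longrightarrow> \<alpha> A P g (u w) = \<alpha> A Q h (v w)"
      using open_maps_pullback[OF P(1) Q(1) op P(3) Q(3) eq] by metis
    note r = hom_UU_restrict[OF A Kp_partial_order[OF W(1)] po(1) W(2) P(2)]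
      hom_UU_restrict[OF A Kp_partial_order[OF W(1)] po(2) W(3) Q(2)]
    have "compose (carrier W) (\<alpha> A P g) u = compose (carrier W) (\<alpha> A Q h) v"
      using W(7) by (simp add: compose_def fun_eq_iff)
    then have "\<alpha> A W (compose (carrier A) (UU_map W P u) g) = \<alpha> A W (compose (carrier A) (UU_map W Q v) h)"
      using factor_alpha_restrict[OF A P(1) W(1,2) P(2)] factor_alpha_restrict[OF A Q(1) W(1,3) Q(2)] by simp
    then have "compose (carrier A) (UU_map W P u) g = compose (carrier A) (UU_map W Q v) h"
      using bij_betw_imp_inj_on[OF factor_alpha_bij[OF A W(1)]] r(1,3) by (meson inj_onD)
    then have "compose (carrier W) (spec_map A P g) u w = compose (carrier W) (spec_map A Q h) v w"
      using r(2,4) by metis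
    then show "spec_map A P g p = spec_map A Q h q" using W(4-6) by (simp add: compose_eq)
  next
    assume eq: "spec_map A P g p = spec_map A Q h q"
    obtain W u v w where W: "W \<in> Obj Kp_cat" "u \<in> open_maps W P" "v \<in> open_maps W Q" "w \<in> carrier W"
      "u w = p" "v w = q" "\<And>w. w \<in> carrier W \<Longrightarrow> spec_map A P g (u w) = spec_map A Q h (v w)"
      using open_maps_pullback[OF P(1) Q(1) sop P(3) Q(3) eq] by metis
    note r = hom_UU_restrict[OF A Kp_partial_order[OF W(1)] po(1) W(2) P(2)]
      hom_UU_restrict[OF A Kp_partial_order[OF W(1)] po(2) W(3) Q(2)]
    have "compose (carrier W) (spec_map A P g) u = compose (carrier W) (spec_map A Q h) v"
      using W(7) by (simp add: compose_def fun_eq_iff)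
    then have "compose (carrier A) (UU_map W P u) g = compose (carrier A) (UU_map W Q v) h"
      using spec_map_inj r by metis
    then have "compose (carrier W) (\<alpha> A P g) u w = compose (carrier W) (\<alpha> A Q h) v w"
      using factor_alpha_restrict[OF A P(1) W(1,2) P(2)] factor_alpha_restrict[OF A Q(1) W(1,3) Q(2)] by simp
    then show "\<alpha> A P g p = \<alpha> A Q h q" using W(4-6) by (simp add: compose_eq)
  qed
qed

text \<open>Image finiteness of \<open>fobj S A\<close> makes the principal up-set of x a copy of an
  object of the site. The open map from that copy lies in the range of \<alpha> by
  surjectivity.\<close>

lemma factor_pointE:
  assumes A: "heyting_algebra A" and x: "x \<in> carrier (fobj S A)"
  obtains P g p where "P \<in> Obj Kp_cat" "g \<in> ha_hom A (UU P)" "p \<in> carrier P" "\<alpha> A P g p = x"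
proof -
  note po = factor_obj[OF A]
  have "{y \<in> carrier (fobj S A). x \<sqsubseteq>\<^bsub>fobj S A\<^esub> y} \<in> fin_upsets (fobj S A)"
    using principal_upset[OF po(1) x] po(2) x by (simp add: fin_upsets_def image_finite_def)
  from finite_upset_Kp_copy[OF po(1) this] obtain P d where P: "P \<in> Obj Kp_cat" "d \<in> open_maps P (fobj S A)"
    "d ` carrier P = {y \<in> carrier (fobj S A). x \<sqsubseteq>\<^bsub>fobj S A\<^esub> y}" by blast
  have "x \<in> d ` carrier P" unfolding P(3) by (rule principal_upset(2)[OF po(1) x])
  then obtain p where "p \<in> carrier P" "x = d p" by (rule imageE)
  moreover have "d \<in> \<alpha> A P ` ha_hom A (UU P)"
    using bij_betw_imp_surj_on[OF factor_alpha_bij[OF A P(1)]] P(2) by simp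
  then obtain g where "g \<in> ha_hom A (UU P)" "d = \<alpha> A P g" by (rule imageE)
  ultimately show thesis using that P(1) by simp
qed

lemma factor_iso_point:
  assumes A: "heyting_algebra A" and P: "P \<in> Obj Kp_cat" "g \<in> ha_hom A (UU P)" "p \<in> carrier P"
  shows "factor_iso S \<alpha> A (\<alpha> A P g p) = spec_map A P g p"
proof -
  have "(SOME y. \<exists>Q h q. Q \<in> Obj Kp_cat \<and> h \<in> ha_hom A (UU Q) \<and> q \<in> carrier Q \<and>
      \<alpha> A Q h q = \<alpha> A P g p \<and> y = spec_map A Q h q) = spec_map A P g p"
  proof (rule some_equality)
    show "\<exists>Q h q. Q \<in> Obj Kp_cat \<and> h \<in> ha_hom A (UU Q) \<and> q \<in> carrier Q \<and>
      \<alpha> A Q h q = \<alpha> A P g p \<and> spec_map A P g p = spec_map A Q h q" using P by blast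
    fix y assume "\<exists>Q h q. Q \<in> Obj Kp_cat \<and> h \<in> ha_hom A (UU Q) \<and> q \<in> carrier Q \<and>
      \<alpha> A Q h q = \<alpha> A P g p \<and> y = spec_map A Q h q"
    then obtain Q h q where Q: "Q \<in> Obj Kp_cat" "h \<in> ha_hom A (UU Q)" "q \<in> carrier Q"
      and eq: "\<alpha> A Q h q = \<alpha> A P g p" and y: "y = spec_map A Q h q" by blast
    show "y = spec_map A P g p"
      unfolding y using factor_point_iff[OF A Q P] eq by simp
  qed
  then show ?thesis
    using open_maps_closed[OF factor_alpha_open[OF A P(1,2)] P(3)] by (simp add: factor_iso_def)
qed

lemma factor_iso_compose:
  assumes A: "heyting_algebra A" and P: "P \<in> Obj Kp_cat" "g \<in> ha_hom A (UU P)"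
  shows "compose (carrier P) (factor_iso S \<alpha> A) (\<alpha> A P g) = spec_map A P g"
  using factor_iso_point[OF A P] by (simp add: fun_eq_iff compose_def spec_map_def)

text \<open>The maps \<open>\<alpha> A P g\<close> cover \<open>fobj S A\<close>, and along each of
  them the comparison is the open map \<open>spec_map A P g\<close>.\<close>

lemma factor_iso_open:
  assumes A: "heyting_algebra A"
  shows "factor_iso S \<alpha> A \<in> open_maps (fobj S A) (spec_poset A)"
proof (rule open_maps_glue)
  show "factor_iso S \<alpha> A \<in> carrier (fobj S A) \<rightarrow>\<^sub>E carrier (spec_poset A)"
  proof (rule PiE_I)
    fix x assume "x \<in> carrier (fobj S A)"
    then obtain P g p where P: "P \<in> Obj Kp_cat" "g \<in> ha_hom A (UU P)" "p \<in> carrier P" "\<alpha> A P g p = x"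
      by (rule factor_pointE[OF A])
    show "factor_iso S \<alpha> A x \<in> carrier (spec_poset A)"
      unfolding P(4)[symmetric] factor_iso_point[OF A P(1-3)]
      by (rule spec_map_in_spec[OF A Kp_partial_order[OF P(1)] Kp_image_finite[OF P(1)] P(2,3)])
  qed (simp add: factor_iso_def)
  fix x assume "x \<in> carrier (fobj S A)"
  then obtain P g p where P: "P \<in> Obj Kp_cat" "g \<in> ha_hom A (UU P)" "p \<in> carrier P" "\<alpha> A P g p = x"
    by (rule factor_pointE[OF A])
  then show "\<exists>(Q :: nat gorder) f q. f \<in> open_maps Q (fobj S A) \<and> q \<in> carrier Q \<and> f q = x \<and>
        compose (carrier Q) (factor_iso S \<alpha> A) f \<in> open_maps Q (spec_poset A)"
    using factor_alpha_open[OF A P(1,2)] factor_iso_compose[OF A P(1,2)]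
      spec_map_open[OF A Kp_partial_order[OF P(1)] Kp_image_finite[OF P(1)] P(2)] by metis
qed

lemma factor_iso_bij:
  assumes A: "heyting_algebra A"
  shows "bij_betw (factor_iso S \<alpha> A) (carrier (fobj S A)) (carrier (spec_poset A))"
  unfolding bij_betw_def
proof
  show "inj_on (factor_iso S \<alpha> A) (carrier (fobj S A))"
  proof (rule inj_onI)
    fix x y assume x: "x \<in> carrier (fobj S A)" and y: "y \<in> carrier (fobj S A)"
      and eq: "factor_iso S \<alpha> A x = factor_iso S \<alpha> A y"
    obtain P g p where P: "P \<in> Obj Kp_cat" "g \<in> ha_hom A (UU P)" "p \<in> carrier P" "\<alpha> A P g p = x"
      using x by (rule factor_pointE[OF A])
    obtain Q h q where Q: "Q \<in> Obj Kp_cat" "h \<in> ha_hom A (UU Q)" "q \<in> carrier Q" "\<alpha> A Q h q = y"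
      using y by (rule factor_pointE[OF A])
    show "x = y"
      using eq factor_point_iff[OF A P(1-3) Q(1-3)] factor_iso_point[OF A P(1-3)] factor_iso_point[OF A Q(1-3)]
      unfolding P(4) Q(4) by simp
  qed
  show "factor_iso S \<alpha> A ` carrier (fobj S A) = carrier (spec_poset A)"
  proof
    show "factor_iso S \<alpha> A ` carrier (fobj S A) \<subseteq> carrier (spec_poset A)"
      using open_maps_closed[OF factor_iso_open[OF A]] by blast
    show "carrier (spec_poset A) \<subseteq> factor_iso S \<alpha> A ` carrier (fobj S A)"
    proof
      fix y assume "y \<in> carrier (spec_poset A)"
      then obtain P g p where P: "P \<in> Obj Kp_cat" "g \<in> ha_hom A (UU P)" "p \<in> carrier P" "y = spec_map A P g p"
        by (rule spec_pointE)
      show "y \<in> factor_iso S \<alpha> A ` carrier (fobj S A)"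
        unfolding P(4) factor_iso_point[OF A P(1-3), symmetric]
        by (rule imageI) (rule open_maps_closed[OF factor_alpha_open[OF A P(1,2)] P(3)])
    qed
  qed
qed

lemma factor_iso_natural:
  assumes A: "heyting_algebra A" and B: "heyting_algebra B" and h: "h \<in> ha_hom A B"
    and x: "x \<in> carrier (fobj S B)"
  shows "factor_iso S \<alpha> A (fmap S B A h x) = {a \<in> carrier A. h a \<in> factor_iso S \<alpha> B x}"
proof -
  obtain P g p where P: "P \<in> Obj Kp_cat" "g \<in> ha_hom B (UU P)" "p \<in> carrier P" "\<alpha> B P g p = x"
    using x by (rule factor_pointE[OF B])
  have "fmap S B A h x = \<alpha> A P (compose (carrier A) g h) p"
    unfolding factor_alpha_natural[OF A B h P(1,2)] using P(3,4) by (simp add: compose_eq)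
  then have "factor_iso S \<alpha> A (fmap S B A h x) = spec_map A P (compose (carrier A) g h) p"
    using factor_iso_point[OF A P(1) ha_hom_compose[OF A h P(2)] P(3)] by simp
  also have "\<dots> = {a \<in> carrier A. h a \<in> spec_map B P g p}"
    using P(3) ha_hom_closed[OF h] by (auto simp: spec_map_apply compose_eq)
  also have "spec_map B P g p = factor_iso S \<alpha> B x"
    using factor_iso_point[OF B P(1-3)] P(4) by simp
  finally show ?thesis .
qed

end


section \<open>Finite quotients\<close>

lemma partial_order_D:
  fixes L :: "'a gorder" (structure)
  assumes "partial_order L"
  shows "x \<in> carrier L \<Longrightarrow> x \<sqsubseteq> x"
    and "x \<sqsubseteq> y \<Longrightarrow> y \<sqsubseteq> x \<Longrightarrow> x \<in> carrier L \<Longrightarrow> y \<in> carrier L \<Longrightarrow> x = y"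
    and "x \<sqsubseteq> y \<Longrightarrow> y \<sqsubseteq> z \<Longrightarrow> x \<in> carrier L \<Longrightarrow> y \<in> carrier L \<Longrightarrow> z \<in> carrier L \<Longrightarrow> x \<sqsubseteq> z"
proof -
  interpret partial_order L by fact
  show "x \<in> carrier L \<Longrightarrow> x \<sqsubseteq> x" by (rule le_refl)
  show "x \<sqsubseteq> y \<Longrightarrow> y \<sqsubseteq> x \<Longrightarrow> x \<in> carrier L \<Longrightarrow> y \<in> carrier L \<Longrightarrow> x = y" by (rule le_antisym)
  show "x \<sqsubseteq> y \<Longrightarrow> y \<sqsubseteq> z \<Longrightarrow> x \<in> carrier L \<Longrightarrow> y \<in> carrier L \<Longrightarrow> z \<in> carrier L \<Longrightarrow> x \<sqsubseteq> z"
    by (rule le_trans)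
qed

text \<open>In a finite distributive lattice these are the join irreducible elements, hence the
  points of its dual. Primeness is the form that makes the forcing clause for joins
  immediate.\<close>

definition join_primes :: "'a gorder \<Rightarrow> 'a set" where
  "join_primes B = {p \<in> carrier B. p \<noteq> \<bottom>\<^bsub>B\<^esub> \<and>
     (\<forall>a\<in>carrier B. \<forall>b\<in>carrier B. p \<sqsubseteq>\<^bsub>B\<^esub> a \<squnion>\<^bsub>B\<^esub> b \<longrightarrow> p \<sqsubseteq>\<^bsub>B\<^esub> a \<or> p \<sqsubseteq>\<^bsub>B\<^esub> b)}"

text \<open>A minimal q below b and not below c is join prime. By minimality
  \<open>q \<sqinter> u\<close> is below c whenever q is not below u. If q were below a join of two
  such elements, residuation would put that join below the implication from q to c, and q below
  c.\<close>

lemma join_prime_separation: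
  fixes B :: "'a gorder" (structure)
  assumes B: "heyting_algebra B" "finite (carrier B)" and b: "b \<in> carrier B" and c: "c \<in> carrier B"
    and nle: "\<not> b \<sqsubseteq> c"
  shows "\<exists>q\<in>join_primes B. q \<sqsubseteq> b \<and> \<not> q \<sqsubseteq> c"
proof -
  note ord = partial_order_D[OF heyting_partial_order[OF B(1)]]
  let ?M = "\<lambda>x. x \<in> carrier B \<and> x \<sqsubseteq> b \<and> \<not> x \<sqsubseteq> c"
  \<comment> \<open>The size of the principal down-set. It drops strictly from q to
    \<open>q \<sqinter> u\<close> when q is not below u, so a minimizer behaves as a minimal
    element.\<close>
  let ?n = "\<lambda>x. card {y \<in> carrier B. y \<sqsubseteq> x}"
  have "?M b" using b nle ord(1) by blast
  from ex_has_least_nat[of ?M, OF this, of ?n] obtain q where q: "?M q" and min: "\<And>x. ?M x \<Longrightarrow> ?n q \<le> ?n x"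
    by blast
  have small: "q \<sqinter> u \<sqsubseteq> c" if u: "u \<in> carrier B" and nu: "\<not> q \<sqsubseteq> u" for u
  proof (rule ccontr)
    assume nc: "\<not> q \<sqinter> u \<sqsubseteq> c"
    have qB: "q \<in> carrier B" using q by blast
    note me = heyting_meet(2)[OF B(1) qB u]
    have qu: "q \<sqinter> u \<in> carrier B" using heyting_meet(1)[OF B(1) qB u] .
    have le: "q \<sqinter> u \<sqsubseteq> q" "q \<sqinter> u \<sqsubseteq> u"
      using me[OF qu] ord(1)[OF qu] by blast+
    have "q \<sqinter> u \<sqsubseteq> b" using ord(3)[OF le(1)] q qu b by blast
    then have "?n q \<le> ?n (q \<sqinter> u)" using min qu nc by blast
    moreover have "{y \<in> carrier B. y \<sqsubseteq> q \<sqinter> u} \<subset> {y \<in> carrier B. y \<sqsubseteq> q}"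
    proof
      show "{y \<in> carrier B. y \<sqsubseteq> q \<sqinter> u} \<subseteq> {y \<in> carrier B. y \<sqsubseteq> q}"
        by (auto simp: me)
      show "{y \<in> carrier B. y \<sqsubseteq> q \<sqinter> u} \<noteq> {y \<in> carrier B. y \<sqsubseteq> q}"
      proof
        assume eq: "{y \<in> carrier B. y \<sqsubseteq> q \<sqinter> u} = {y \<in> carrier B. y \<sqsubseteq> q}"
        have "q \<in> {y \<in> carrier B. y \<sqsubseteq> q \<sqinter> u}"
          unfolding eq using qB ord(1)[OF qB] by simp
        then show False using nu by (simp add: me qB)
      qed
    qed
    moreover from this have "?n (q \<sqinter> u) < ?n q" by (intro psubset_card_mono) (use B(2) in simp_all)
    ultimately show False by linarith
  qed
  have "q \<in> join_primes B"
    unfolding join_primes_def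
  proof (intro CollectI conjI ballI impI)
    show "q \<in> carrier B" using q by blast
    show "q \<noteq> \<bottom>" using q heyting_bottom(2)[OF B(1) c] by blast
    fix u v assume uv: "u \<in> carrier B" "v \<in> carrier B" and le: "q \<sqsubseteq> u \<squnion> v"
    show "q \<sqsubseteq> u \<or> q \<sqsubseteq> v"
    proof (rule ccontr)
      assume "\<not> (q \<sqsubseteq> u \<or> q \<sqsubseteq> v)"
      then have *: "q \<sqinter> u \<sqsubseteq> c" "q \<sqinter> v \<sqsubseteq> c" using small uv by blast+
      have qB: "q \<in> carrier B" using q by blast
      note im = heyting_himp[OF B(1) qB c]
      \<comment> \<open>Implication takes the place of distributivity: two bounds on meets with q
        become one bound on the join.\<close>
      have "u \<squnion> v \<sqsubseteq> himp B q c"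
        using * heyting_join(2)[OF B(1) uv im(1)] im(2) uv by blast
      then have "q \<sqsubseteq> himp B q c"
        using ord(3)[OF le] heyting_join(1)[OF B(1) uv] qB im(1) by blast
      then have "q \<sqinter> q \<sqsubseteq> c" using im(2)[OF qB] by blast
      moreover have "q \<sqsubseteq> q \<sqinter> q" using heyting_meet(2)[OF B(1) qB qB qB] ord(1)[OF qB] by blast
      ultimately show False using ord(3) heyting_meet(1)[OF B(1) qB qB] qB c q by blast
    qed
  qed
  then show ?thesis using q by blast
qed

text \<open>The injective half of Birkhoff duality. The order on join primes is reversed so that the
  primes below b form an up-set; separation by join primes gives injectivity and the clause for
  implication.\<close>

lemma finite_heyting_embedding:
  fixes B :: "'b gorder" (structure)
  assumes B: "heyting_algebra B" "finite (carrier B)"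
  obtains P :: "'b gorder" and j where "partial_order P" "finite (carrier P)"
    "j \<in> ha_hom B (UU P)" "inj_on j (carrier B)"
proof -
  note ord = partial_order_D[OF heyting_partial_order[OF B(1)]]
  define P :: "'b gorder" where "P = \<lparr>carrier = join_primes B, eq = (=), le = (\<lambda>p q. q \<sqsubseteq> p)\<rparr>"
  define j where "j = (\<lambda>b\<in>carrier B. {p \<in> join_primes B. p \<sqsubseteq> b})"
  have JP: "p \<in> carrier B" if "p \<in> join_primes B" for p using that by (simp add: join_primes_def)
  have P: "partial_order P"
  proof (rule partial_order_eqI)
    show "x = y" if "x \<in> carrier P" "y \<in> carrier P" "x \<sqsubseteq>\<^bsub>P\<^esub> y" "y \<sqsubseteq>\<^bsub>P\<^esub> x" for x y
      using ord(2)[of x y] that JP by (simp add: P_def)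
    show "x \<sqsubseteq>\<^bsub>P\<^esub> z" if "x \<in> carrier P" "y \<in> carrier P" "z \<in> carrier P" "x \<sqsubseteq>\<^bsub>P\<^esub> y" "y \<sqsubseteq>\<^bsub>P\<^esub> z" for x y z
      using ord(3)[of z y x] that JP by (simp add: P_def)
  qed (simp_all add: P_def ord(1) JP)
  have fin: "finite (carrier P)"
    by (rule finite_subset[OF _ B(2)]) (use JP in \<open>auto simp: P_def\<close>)
  have mem: "p \<in> j b \<longleftrightarrow> p \<sqsubseteq> b" if "p \<in> carrier P" "b \<in> carrier B" for p b
    using that by (simp add: j_def P_def)
  have j: "j \<in> ha_hom B (UU P)"
    unfolding hom_UU_iff[OF B(1) P]
  proof (intro conjI ballI)
    show "j \<in> carrier B \<rightarrow>\<^sub>E upsets P"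
    proof (rule PiE_I)
      fix b assume b: "b \<in> carrier B"
      show "j b \<in> upsets P"
        unfolding upsets_def
      proof (intro CollectI conjI ballI impI)
        show "j b \<subseteq> carrier P" using b by (auto simp: j_def P_def)
        fix x y assume "x \<in> j b" "y \<in> carrier P" "x \<sqsubseteq>\<^bsub>P\<^esub> y"
        then show "y \<in> j b" using b ord(3)[of y x b] JP by (simp add: j_def P_def)
      qed
    qed (simp add: j_def)
    fix p assume p: "p \<in> carrier P"
    then have pJ: "p \<in> join_primes B" by (simp add: P_def)
    note cl = heyting_closed[OF B(1)]
    note pB = JP[OF pJ]
    show "p \<in> j \<top>" using heyting_top(2)[OF B(1) pB] by (simp add: mem p cl)
    have "p \<noteq> \<bottom>" using pJ by (simp add: join_primes_def)
    then show "p \<notin> j \<bottom>"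
      using ord(2)[OF _ heyting_bottom(2)[OF B(1) pB] pB cl(2)] by (auto simp: mem[OF p cl(2)])
    fix a b assume ab: "a \<in> carrier B" "b \<in> carrier B"
    show "p \<in> j (a \<sqinter> b) \<longleftrightarrow> p \<in> j a \<and> p \<in> j b"
      using heyting_meet(2)[OF B(1) ab pB] by (simp add: mem p cl ab)
    have "p \<sqsubseteq> a \<squnion> b" if "p \<sqsubseteq> a \<or> p \<sqsubseteq> b"
      using that heyting_join(2)[OF B(1) ab cl(4)[OF ab]] ord(1)[OF cl(4)[OF ab]]
        ord(3)[OF _ _ pB ab(1) cl(4)[OF ab]] ord(3)[OF _ _ pB ab(2) cl(4)[OF ab]] by blast
    then show "p \<in> j (a \<squnion> b) \<longleftrightarrow> p \<in> j a \<or> p \<in> j b"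
      using pJ ab by (auto simp: mem p cl join_primes_def)
    \<comment> \<open>An inequality can be tested on the join primes below its left side. With the
      order reversed this is Kripke's clause at p.\<close>
    have "a \<sqinter> p \<sqsubseteq> b \<longleftrightarrow> (\<forall>q\<in>join_primes B. q \<sqsubseteq> p \<longrightarrow> q \<sqsubseteq> a \<longrightarrow> q \<sqsubseteq> b)"
    proof (intro iffI ballI impI)
      fix q assume "a \<sqinter> p \<sqsubseteq> b" "q \<in> join_primes B" "q \<sqsubseteq> p" "q \<sqsubseteq> a"
      then show "q \<sqsubseteq> b"
        using heyting_meet(2)[OF B(1) ab(1) pB JP, of q] ord(3)[of q "a \<sqinter> p" b] JP[of q]
          cl(3)[OF ab(1) pB] ab by blast
    next
      assume *: "\<forall>q\<in>join_primes B. q \<sqsubseteq> p \<longrightarrow> q \<sqsubseteq> a \<longrightarrow> q \<sqsubseteq> b"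
      show "a \<sqinter> p \<sqsubseteq> b"
      proof (rule ccontr)
        assume "\<not> a \<sqinter> p \<sqsubseteq> b"
        then obtain q where "q \<in> join_primes B" "q \<sqsubseteq> a \<sqinter> p" "\<not> q \<sqsubseteq> b"
          using join_prime_separation[OF B cl(3)[OF ab(1) pB] ab(2)] by blast
        then show False using * heyting_meet(2)[OF B(1) ab(1) pB JP, of q] by blast
      qed
    qed
    then show "p \<in> j (himp B a b) \<longleftrightarrow> (\<forall>y\<in>carrier P. p \<sqsubseteq>\<^bsub>P\<^esub> y \<longrightarrow> y \<in> j a \<longrightarrow> y \<in> j b)"
      using heyting_himp(2)[OF B(1) ab pB] by (simp add: mem p cl ab cong: ball_cong) (simp add: P_def)
  qed
  have "inj_on j (carrier B)"
  proof (rule inj_onI)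
    fix a b assume ab: "a \<in> carrier B" "b \<in> carrier B" and eq: "j a = j b"
    have *: "q \<sqsubseteq> a \<longleftrightarrow> q \<sqsubseteq> b" if "q \<in> join_primes B" for q
      using eq mem[of q a] mem[of q b] ab that by (simp add: P_def)
    have "a \<sqsubseteq> b" "b \<sqsubseteq> a"
      using join_prime_separation[OF B ab] join_prime_separation[OF B ab(2,1)] * by blast+
    then show "a = b" using ord(2) ab by blast
  qed
  then show thesis using that P fin j by blast
qed

section \<open>Abstract spectra\<close>

lemma open_inj_reflects:
  assumes k: "k \<in> open_maps X Y" "inj_on k (carrier X)" and x: "x \<in> carrier X" "y \<in> carrier X" "k x \<sqsubseteq>\<^bsub>Y\<^esub> k y"
  shows "x \<sqsubseteq>\<^bsub>X\<^esub> y"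
proof -
  \<comment> \<open>The lifting condition reaches \<open>k y\<close> from x; injectivity identifies
    the lift with y.\<close>
  obtain z where "z \<in> carrier X" "x \<sqsubseteq>\<^bsub>X\<^esub> z" "k z = k y"
    using open_mapsD(3)[OF k(1) x(1) open_maps_closed[OF k(1) x(2)] x(3)] by blast
  then show ?thesis using inj_onD[OF k(2)] x(2) by metis
qed

text \<open>A bijective open map reflects the order, so it is an isomorphism of posets and g can be
  followed by its inverse.\<close>

lemma open_maps_lift:
  assumes k: "k \<in> open_maps X Y" "bij_betw k (carrier X) (carrier Y)" and g: "g \<in> open_maps Z Y"
  shows "\<exists>f\<in>open_maps Z X. compose (carrier Z) k f = g"
proof -
  define f where "f = (\<lambda>z\<in>carrier Z. inv_into (carrier X) k (g z))"
  have inj: "inj_on k (carrier X)" and im: "k ` carrier X = carrier Y" using k(2) by (auto simp: bij_betw_def)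
  have fX: "f z \<in> carrier X" and kf: "k (f z) = g z" if "z \<in> carrier Z" for z
    using that open_maps_closed[OF g that] im by (auto simp: f_def inv_into_into f_inv_into_f)
  have "f \<in> open_maps Z X"
  proof (rule open_mapsI)
    show "f \<in> carrier Z \<rightarrow>\<^sub>E carrier X" using fX by (auto simp: f_def)
    show "f p \<sqsubseteq>\<^bsub>X\<^esub> f p'" if p: "p \<in> carrier Z" "p' \<in> carrier Z" "p \<sqsubseteq>\<^bsub>Z\<^esub> p'" for p p'
      by (rule open_inj_reflects[OF k(1) inj]) (use p fX kf open_mapsD(2)[OF g p] in simp_all)
    show "\<exists>p'\<in>carrier Z. p \<sqsubseteq>\<^bsub>Z\<^esub> p' \<and> f p' = q"
      if p: "p \<in> carrier Z" and q: "q \<in> carrier X" and le: "f p \<sqsubseteq>\<^bsub>X\<^esub> q" for p q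
    proof -
      have "g p \<sqsubseteq>\<^bsub>Y\<^esub> k q" using open_mapsD(2)[OF k(1) fX[OF p] q le] kf[OF p] by simp
      then obtain p' where p': "p' \<in> carrier Z" "p \<sqsubseteq>\<^bsub>Z\<^esub> p'" "g p' = k q"
        using open_mapsD(3)[OF g p open_maps_closed[OF k(1) q]] by blast
      have "f p' = q" by (rule inj_onD[OF inj]) (use p' fX kf q in simp_all)
      then show ?thesis using p' by blast
    qed
  qed
  moreover have "compose (carrier Z) k f = g"
    by (rule extensionalityI[of _ "carrier Z"]) (use kf open_mapsD(1)[OF g] in \<open>auto simp: compose_eq PiE_def\<close>)
  ultimately show ?thesis by blast
qed

text \<open>The point map of \<epsilon> is open by the other conditions, so the bijection makes it
  an isomorphism onto the canonical spectrum. The points of X may have any type, which covers every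
  factorization at once.\<close>

definition is_spectrum :: "'a gorder \<Rightarrow> 'x gorder \<Rightarrow> ('a \<Rightarrow> 'x set) \<Rightarrow> bool" where
  "is_spectrum A X \<epsilon> \<longleftrightarrow> heyting_algebra A \<and> partial_order X \<and> image_finite X \<and> \<epsilon> \<in> ha_hom A (UU X) \<and>
     bij_betw (spec_map A X \<epsilon>) (carrier X) (carrier (spec_poset A))"

context
  fixes A :: "'a gorder" and X :: "'x gorder" and \<epsilon>
  assumes sp: "is_spectrum A X \<epsilon>"
begin

lemma spectrumD: "heyting_algebra A" "partial_order X" "image_finite X" "\<epsilon> \<in> ha_hom A (UU X)"
    "bij_betw (spec_map A X \<epsilon>) (carrier X) (carrier (spec_poset A))"
    "spec_map A X \<epsilon> \<in> open_maps X (spec_poset A)"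
  using sp spec_map_open[of A X \<epsilon>] by (auto simp: is_spectrum_def)

text \<open>When homomorphisms are replaced by their point maps, the assignment becomes composition
  with the isomorphism \<open>spec_map A X \<epsilon>\<close>.\<close>

lemma spectrum_universal:
  assumes Z: "partial_order Z" "image_finite Z"
  shows "bij_betw (\<lambda>f. compose (carrier A) (UU_map Z X f) \<epsilon>) (open_maps Z X) (ha_hom A (UU Z))"
  unfolding bij_betw_def
proof
  note r = hom_UU_restrict[OF spectrumD(1) Z(1) spectrumD(2) _ spectrumD(4)]
  show "inj_on (\<lambda>f. compose (carrier A) (UU_map Z X f) \<epsilon>) (open_maps Z X)"
  proof (rule inj_onI)
    fix f g assume f: "f \<in> open_maps Z X" and g: "g \<in> open_maps Z X"
      and eq: "compose (carrier A) (UU_map Z X f) \<epsilon> = compose (carrier A) (UU_map Z X g) \<epsilon>"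
    have "compose (carrier Z) (spec_map A X \<epsilon>) f = compose (carrier Z) (spec_map A X \<epsilon>) g"
      using r(2)[OF f] r(2)[OF g] eq by simp
    then have "spec_map A X \<epsilon> (f z) = spec_map A X \<epsilon> (g z)" if "z \<in> carrier Z" for z
      using that by (metis compose_eq)
    then show "f = g"
      by (intro open_maps_eqI[OF f g])
        (use bij_betw_imp_inj_on[OF spectrumD(5)] open_maps_closed[OF f] open_maps_closed[OF g] in \<open>metis inj_onD\<close>)
  qed
  show "(\<lambda>f. compose (carrier A) (UU_map Z X f) \<epsilon>) ` open_maps Z X = ha_hom A (UU Z)"
  proof
    show "(\<lambda>f. compose (carrier A) (UU_map Z X f) \<epsilon>) ` open_maps Z X \<subseteq> ha_hom A (UU Z)"
      using r(1) by blast
    show "ha_hom A (UU Z) \<subseteq> (\<lambda>f. compose (carrier A) (UU_map Z X f) \<epsilon>) ` open_maps Z X"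
    proof
      fix g assume g: "g \<in> ha_hom A (UU Z)"
      obtain f where f: "f \<in> open_maps Z X" "compose (carrier Z) (spec_map A X \<epsilon>) f = spec_map A Z g"
        using open_maps_lift[OF spectrumD(6,5) spec_map_open[OF spectrumD(1) Z g]] by blast
      have "compose (carrier A) (UU_map Z X f) \<epsilon> = g"
        by (rule spec_map_inj[OF _ r(1)[OF f(1)] g]) (use r(2)[OF f(1)] f(2) in simp)
      then show "g \<in> (\<lambda>f. compose (carrier A) (UU_map Z X f) \<epsilon>) ` open_maps Z X" using f(1) by blast
    qed
  qed
qed

text \<open>The order of X is inclusion of filters, so for each y in F not above x some element
  holds at x and fails at y. There are finitely many such y, and a meet of these elements handles
  all of them.\<close>

lemma spectrum_principal:
  assumes F: "F \<in> fin_upsets X" and x: "x \<in> F"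
  shows "\<exists>a\<in>carrier A. \<forall>y\<in>F. y \<in> \<epsilon> a \<longleftrightarrow> x \<sqsubseteq>\<^bsub>X\<^esub> y"
proof -
  have FX: "F \<subseteq> carrier X" "finite F" using F by (auto simp: fin_upsets_def upsets_def)
  have xX: "x \<in> carrier X" using x FX by blast
  have "\<exists>a\<in>carrier A. x \<in> \<epsilon> a \<and> (\<forall>t\<in>{y \<in> F. \<not> x \<sqsubseteq>\<^bsub>X\<^esub> y}. t \<notin> \<epsilon> a)"
  proof (rule finite_meet_separation[OF spectrumD(1,2,2,4,4) xX])
    show "\<forall>t\<in>{y \<in> F. \<not> x \<sqsubseteq>\<^bsub>X\<^esub> y}. \<exists>b\<in>carrier A. x \<in> \<epsilon> b \<and> t \<notin> \<epsilon> b"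
    proof (rule ballI, rule ccontr)
      fix t assume t: "t \<in> {y \<in> F. \<not> x \<sqsubseteq>\<^bsub>X\<^esub> y}" and no: "\<not> (\<exists>b\<in>carrier A. x \<in> \<epsilon> b \<and> t \<notin> \<epsilon> b)"
      have tX: "t \<in> carrier X" using t FX by blast
      have "spec_map A X \<epsilon> x \<sqsubseteq>\<^bsub>spec_poset A\<^esub> spec_map A X \<epsilon> t"
        using no xX tX by (auto simp: spec_map_apply)
      then have "x \<sqsubseteq>\<^bsub>X\<^esub> t"
        by (rule open_inj_reflects[OF spectrumD(6) bij_betw_imp_inj_on[OF spectrumD(5)] xX tX])
      then show False using t by blast
    qed
  qed (use FX in auto)
  then obtain a where a: "a \<in> carrier A" "x \<in> \<epsilon> a" "\<And>t. t \<in> F \<Longrightarrow> \<not> x \<sqsubseteq>\<^bsub>X\<^esub> t \<Longrightarrow> t \<notin> \<epsilon> a" by blast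
  show ?thesis
  proof (intro bexI[OF _ a(1)] ballI iffI)
    fix y assume y: "y \<in> F"
    show "x \<sqsubseteq>\<^bsub>X\<^esub> y" if "y \<in> \<epsilon> a" using a(3)[OF y] that by blast
    show "y \<in> \<epsilon> a" if "x \<sqsubseteq>\<^bsub>X\<^esub> y"
      using upsets_upward[OF hom_UU_upsets[OF spectrumD(4) a(1)] a(2) _ that] y FX(1) by blast
  qed
qed

text \<open>An up-set of the finite poset F is a finite union of principal up-sets; the join of the
  elements that cut these out cuts out the union.\<close>

lemma spectrum_restriction_surj:
  assumes F: "F \<in> fin_upsets X" and V: "V \<in> upsets (X\<lparr>carrier := F\<rparr>)"
  shows "\<exists>a\<in>carrier A. \<epsilon> a \<inter> F = V"
proof -
  have FX: "F \<subseteq> carrier X" "finite F" using F by (auto simp: fin_upsets_def upsets_def)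
  have VF: "V \<subseteq> F" using upsets_subset[OF V] by simp
  \<comment> \<open>Stated for arbitrary finite sets W of generators, since the sets met in the
    induction need not be upward closed.\<close>
  have "\<exists>a\<in>carrier A. \<forall>y\<in>F. y \<in> \<epsilon> a \<longleftrightarrow> (\<exists>x\<in>W. x \<sqsubseteq>\<^bsub>X\<^esub> y)" if "finite W" "W \<subseteq> F" for W
    using that
  proof (induction W)
    case empty
    show ?case
      using heyting_bottom(1)[OF spectrumD(1)] hom_UU_D(2)[OF spectrumD(1,2,4)] FX(1) by blast
  next
    case (insert x W)
    then obtain a where a: "a \<in> carrier A" "\<forall>y\<in>F. y \<in> \<epsilon> a \<longleftrightarrow> (\<exists>x\<in>W. x \<sqsubseteq>\<^bsub>X\<^esub> y)" by auto
    obtain b where b: "b \<in> carrier A" "\<forall>y\<in>F. y \<in> \<epsilon> b \<longleftrightarrow> x \<sqsubseteq>\<^bsub>X\<^esub> y"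
      using spectrum_principal[OF F] insert.prems by blast
    show ?case
    proof (intro bexI[of _ "a \<squnion>\<^bsub>A\<^esub> b"] ballI)
      show "a \<squnion>\<^bsub>A\<^esub> b \<in> carrier A" using heyting_join(1)[OF spectrumD(1)] a b by blast
      fix y assume y: "y \<in> F"
      then have "y \<in> carrier X" using FX by blast
      then show "y \<in> \<epsilon> (a \<squnion>\<^bsub>A\<^esub> b) \<longleftrightarrow> (\<exists>x\<in>insert x W. x \<sqsubseteq>\<^bsub>X\<^esub> y)"
        using hom_UU_D(4)[OF spectrumD(1,2,4) _ a(1) b(1), of y] a(2) b(2) y by blast
    qed
  qed
  from this[OF finite_subset[OF VF FX(2)] VF] obtain a where
    a: "a \<in> carrier A" "\<forall>y\<in>F. y \<in> \<epsilon> a \<longleftrightarrow> (\<exists>x\<in>V. x \<sqsubseteq>\<^bsub>X\<^esub> y)" by blast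
  have "\<epsilon> a \<inter> F = V"
  proof (intro equalityI subsetI)
    fix y assume "y \<in> \<epsilon> a \<inter> F"
    then obtain x where "x \<in> V" "x \<sqsubseteq>\<^bsub>X\<^esub> y" "y \<in> F" using a(2) by blast
    then show "y \<in> V" using upsets_upward[OF V, of x y] by simp
  next
    fix y assume y: "y \<in> V"
    then have "y \<sqsubseteq>\<^bsub>X\<^esub> y" using partial_order_D(1)[OF spectrumD(2)] VF FX(1) by blast
    then show "y \<in> \<epsilon> a \<inter> F" using a(2) y VF by blast
  qed
  then show ?thesis using a(1) by blast
qed

end


section \<open>Pro-objects and their limits\<close>

lemma compose_cong_on:
  "(\<And>x. x \<in> S \<Longrightarrow> g (f x) = g' (f' x)) \<Longrightarrow> compose S g f = compose S g' f'"
  by (simp add: compose_def fun_eq_iff)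

context
  fixes X :: "('i, 'm, 'h) pro"
  assumes X: "pro_object X"
begin

lemma pro_index_category: "category (idx X)"
  using X by (simp add: pro_object_def cofiltered_def)

lemma pro_index_directed:
  assumes "i \<in> Obj (idx X)" "j \<in> Obj (idx X)"
  obtains k u v where "k \<in> Obj (idx X)" "u \<in> Arr (idx X) k i" "v \<in> Arr (idx X) k j"
  using X assms unfolding pro_object_def cofiltered_def by blast

lemma pro_index_equalize:
  assumes "i \<in> Obj (idx X)" "j \<in> Obj (idx X)" "u \<in> Arr (idx X) i j" "v \<in> Arr (idx X) i j"
  obtains k w where "k \<in> Obj (idx X)" "w \<in> Arr (idx X) k i" "Cmp (idx X) k i j u w = Cmp (idx X) k i j v w"
  using X assms unfolding pro_object_def cofiltered_def by blast

lemma pro_index_id: "i \<in> Obj (idx X) \<Longrightarrow> Ident (idx X) i \<in> Arr (idx X) i i"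
  using pro_index_category by (simp add: category_def)

lemma pro_index_comp:
  "i \<in> Obj (idx X) \<Longrightarrow> j \<in> Obj (idx X) \<Longrightarrow> k \<in> Obj (idx X) \<Longrightarrow> u \<in> Arr (idx X) i j \<Longrightarrow> v \<in> Arr (idx X) j k \<Longrightarrow>
    Cmp (idx X) i j k v u \<in> Arr (idx X) i k"
  using pro_index_category by (simp add: category_def)

lemma pro_obj:
  assumes "i \<in> Obj (idx X)"
  shows "heyting_algebra (pob X i)" "finite (carrier (pob X i))"
  using X assms by (auto simp: pro_object_def is_functor_def HAf_cat_def)

lemma pro_map:
  assumes "i \<in> Obj (idx X)" "j \<in> Obj (idx X)" "u \<in> Arr (idx X) i j"
  shows "fmap (dia X) i j u \<in> ha_hom (pob X i) (pob X j)"
  using X assms by (simp add: pro_object_def is_functor_def HAf_cat_def)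

lemma pro_map_id:
  assumes "i \<in> Obj (idx X)"
  shows "fmap (dia X) i i (Ident (idx X) i) = (\<lambda>a\<in>carrier (pob X i). a)"
  using X assms by (simp add: pro_object_def is_functor_def HAf_cat_def)

lemma pro_map_comp:
  assumes "i \<in> Obj (idx X)" "j \<in> Obj (idx X)" "k \<in> Obj (idx X)" "u \<in> Arr (idx X) i j" "v \<in> Arr (idx X) j k"
    and "a \<in> carrier (pob X i)"
  shows "fmap (dia X) i k (Cmp (idx X) i j k v u) a = fmap (dia X) j k v (fmap (dia X) i j u a)"
  using X assms by (simp add: pro_object_def is_functor_def HAf_cat_def compose_eq)

section \<open>Limits of diagrams of finite algebras\<close>

lemma pro_lim_carrier:
  "x \<in> carrier (pro_lim X) \<longleftrightarrow> x \<in> (\<Pi>\<^sub>E i\<in>Obj (idx X). carrier (pob X i)) \<and>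
     (\<forall>i\<in>Obj (idx X). \<forall>j\<in>Obj (idx X). \<forall>u\<in>Arr (idx X) i j. fmap (dia X) i j u (x i) = x j)"
  by (simp add: pro_lim_def)

lemma pro_lim_nth: "x \<in> carrier (pro_lim X) \<Longrightarrow> i \<in> Obj (idx X) \<Longrightarrow> x i \<in> carrier (pob X i)"
  by (auto simp: pro_lim_carrier)

lemma pro_lim_compat:
  "x \<in> carrier (pro_lim X) \<Longrightarrow> i \<in> Obj (idx X) \<Longrightarrow> j \<in> Obj (idx X) \<Longrightarrow> u \<in> Arr (idx X) i j \<Longrightarrow>
    fmap (dia X) i j u (x i) = x j"
  by (auto simp: pro_lim_carrier)

lemma pro_lim_restrictI:
  assumes "\<And>i. i \<in> Obj (idx X) \<Longrightarrow> f i \<in> carrier (pob X i)"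
    and "\<And>i j u. i \<in> Obj (idx X) \<Longrightarrow> j \<in> Obj (idx X) \<Longrightarrow> u \<in> Arr (idx X) i j \<Longrightarrow> fmap (dia X) i j u (f i) = f j"
  shows "(\<lambda>i\<in>Obj (idx X). f i) \<in> carrier (pro_lim X)"
  using assms by (simp add: pro_lim_carrier)

lemma pro_lim_eqI:
  assumes "x \<in> carrier (pro_lim X)" "y \<in> carrier (pro_lim X)" "\<And>i. i \<in> Obj (idx X) \<Longrightarrow> x i = y i"
  shows "x = y"
  using assms by (auto simp: pro_lim_carrier intro: PiE_ext)

lemma pro_lim_le: "le (pro_lim X) x y \<longleftrightarrow> (\<forall>i\<in>Obj (idx X). x i \<sqsubseteq>\<^bsub>pob X i\<^esub> y i)"
  by (simp add: pro_lim_def)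

lemma pro_lim_partial_order: "partial_order (pro_lim X)"
proof (rule partial_order_eqI)
  note ord = partial_order_D[OF heyting_partial_order[OF pro_obj(1)]]
  show "x \<sqsubseteq>\<^bsub>pro_lim X\<^esub> x" if "x \<in> carrier (pro_lim X)" for x
    using ord(1) pro_lim_nth[OF that] by (simp add: pro_lim_le)
  show "x = y" if "x \<in> carrier (pro_lim X)" "y \<in> carrier (pro_lim X)"
    "x \<sqsubseteq>\<^bsub>pro_lim X\<^esub> y" "y \<sqsubseteq>\<^bsub>pro_lim X\<^esub> x" for x y
  proof (rule pro_lim_eqI[OF that(1,2)])
    fix i assume i: "i \<in> Obj (idx X)"
    show "x i = y i"
      by (rule ord(2)[OF i])
        (use i that(3,4) pro_lim_nth[OF that(1) i] pro_lim_nth[OF that(2) i] in \<open>simp_all add: pro_lim_le\<close>)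
  qed
  show "x \<sqsubseteq>\<^bsub>pro_lim X\<^esub> z" if "x \<in> carrier (pro_lim X)" "y \<in> carrier (pro_lim X)" "z \<in> carrier (pro_lim X)"
    "x \<sqsubseteq>\<^bsub>pro_lim X\<^esub> y" "y \<sqsubseteq>\<^bsub>pro_lim X\<^esub> z" for x y z
    unfolding pro_lim_le
  proof
    fix i assume i: "i \<in> Obj (idx X)"
    show "x i \<sqsubseteq>\<^bsub>pob X i\<^esub> z i"
      by (rule ord(3)[OF i, of _ "y i"])
        (use i that(4,5) pro_lim_nth[OF that(1)] pro_lim_nth[OF that(2)] pro_lim_nth[OF that(3)]
          in \<open>simp_all add: pro_lim_le\<close>)
  qed
qed (simp add: pro_lim_def)

text \<open>The transition maps are homomorphisms, implication included, so compatible families are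
  closed under the componentwise operations. The order is componentwise too, and uniqueness
  identifies these with the operations of the limit.\<close>

lemma pro_lim_heyting: "heyting_algebra (pro_lim X)"
  and pro_lim_top: "\<top>\<^bsub>pro_lim X\<^esub> = (\<lambda>i\<in>Obj (idx X). \<top>\<^bsub>pob X i\<^esub>)"
  and pro_lim_bottom: "\<bottom>\<^bsub>pro_lim X\<^esub> = (\<lambda>i\<in>Obj (idx X). \<bottom>\<^bsub>pob X i\<^esub>)"
  and pro_lim_meet: "x \<in> carrier (pro_lim X) \<Longrightarrow> y \<in> carrier (pro_lim X) \<Longrightarrow>
    x \<sqinter>\<^bsub>pro_lim X\<^esub> y = (\<lambda>i\<in>Obj (idx X). x i \<sqinter>\<^bsub>pob X i\<^esub> y i)"
  and pro_lim_join: "x \<in> carrier (pro_lim X) \<Longrightarrow> y \<in> carrier (pro_lim X) \<Longrightarrow>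
    x \<squnion>\<^bsub>pro_lim X\<^esub> y = (\<lambda>i\<in>Obj (idx X). x i \<squnion>\<^bsub>pob X i\<^esub> y i)"
  and pro_lim_himp: "x \<in> carrier (pro_lim X) \<Longrightarrow> y \<in> carrier (pro_lim X) \<Longrightarrow>
    himp (pro_lim X) x y = (\<lambda>i\<in>Obj (idx X). himp (pob X i) (x i) (y i))"
proof -
  let ?L = "pro_lim X"
  let ?t = "\<lambda>i\<in>Obj (idx X). \<top>\<^bsub>pob X i\<^esub>"
  let ?b = "\<lambda>i\<in>Obj (idx X). \<bottom>\<^bsub>pob X i\<^esub>"
  let ?m = "\<lambda>x y. \<lambda>i\<in>Obj (idx X). x i \<sqinter>\<^bsub>pob X i\<^esub> y i"
  let ?j = "\<lambda>x y. \<lambda>i\<in>Obj (idx X). x i \<squnion>\<^bsub>pob X i\<^esub> y i"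
  let ?i = "\<lambda>x y. \<lambda>i\<in>Obj (idx X). himp (pob X i) (x i) (y i)"
  note cl = heyting_closed[OF pro_obj(1)]
  note nth = pro_lim_nth
  note hom = ha_homD(2-)[OF pro_map]
  have t: "?t \<in> carrier ?L" "\<And>x. x \<in> carrier ?L \<Longrightarrow> x \<sqsubseteq>\<^bsub>?L\<^esub> ?t"
  proof -
    show "?t \<in> carrier ?L" by (rule pro_lim_restrictI) (simp_all add: cl hom)
    show "x \<sqsubseteq>\<^bsub>?L\<^esub> ?t" if "x \<in> carrier ?L" for x
      using that by (simp add: pro_lim_le heyting_top(2)[OF pro_obj(1)] nth)
  qed
  have b: "?b \<in> carrier ?L" "\<And>x. x \<in> carrier ?L \<Longrightarrow> ?b \<sqsubseteq>\<^bsub>?L\<^esub> x"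
  proof -
    show "?b \<in> carrier ?L" by (rule pro_lim_restrictI) (simp_all add: cl hom)
    show "?b \<sqsubseteq>\<^bsub>?L\<^esub> x" if "x \<in> carrier ?L" for x
      using that by (simp add: pro_lim_le heyting_bottom(2)[OF pro_obj(1)] nth)
  qed
  have m: "\<And>x y. x \<in> carrier ?L \<Longrightarrow> y \<in> carrier ?L \<Longrightarrow> ?m x y \<in> carrier ?L"
    "\<And>x y z. x \<in> carrier ?L \<Longrightarrow> y \<in> carrier ?L \<Longrightarrow> z \<in> carrier ?L \<Longrightarrow>
      z \<sqsubseteq>\<^bsub>?L\<^esub> ?m x y \<longleftrightarrow> z \<sqsubseteq>\<^bsub>?L\<^esub> x \<and> z \<sqsubseteq>\<^bsub>?L\<^esub> y"
  proof -
    show "?m x y \<in> carrier ?L" if xy: "x \<in> carrier ?L" "y \<in> carrier ?L" for x y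
      by (rule pro_lim_restrictI) (simp_all add: cl nth xy hom pro_lim_compat[OF xy(1)] pro_lim_compat[OF xy(2)])
    show "z \<sqsubseteq>\<^bsub>?L\<^esub> ?m x y \<longleftrightarrow> z \<sqsubseteq>\<^bsub>?L\<^esub> x \<and> z \<sqsubseteq>\<^bsub>?L\<^esub> y"
      if "x \<in> carrier ?L" "y \<in> carrier ?L" "z \<in> carrier ?L" for x y z
      using that by (simp add: pro_lim_le heyting_meet(2)[OF pro_obj(1)] nth) blast
  qed
  have j: "\<And>x y. x \<in> carrier ?L \<Longrightarrow> y \<in> carrier ?L \<Longrightarrow> ?j x y \<in> carrier ?L"
    "\<And>x y z. x \<in> carrier ?L \<Longrightarrow> y \<in> carrier ?L \<Longrightarrow> z \<in> carrier ?L \<Longrightarrow>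
      ?j x y \<sqsubseteq>\<^bsub>?L\<^esub> z \<longleftrightarrow> x \<sqsubseteq>\<^bsub>?L\<^esub> z \<and> y \<sqsubseteq>\<^bsub>?L\<^esub> z"
  proof -
    show "?j x y \<in> carrier ?L" if xy: "x \<in> carrier ?L" "y \<in> carrier ?L" for x y
      by (rule pro_lim_restrictI) (simp_all add: cl nth xy hom pro_lim_compat[OF xy(1)] pro_lim_compat[OF xy(2)])
    show "?j x y \<sqsubseteq>\<^bsub>?L\<^esub> z \<longleftrightarrow> x \<sqsubseteq>\<^bsub>?L\<^esub> z \<and> y \<sqsubseteq>\<^bsub>?L\<^esub> z"
      if "x \<in> carrier ?L" "y \<in> carrier ?L" "z \<in> carrier ?L" for x y z
      using that by (simp add: pro_lim_le heyting_join(2)[OF pro_obj(1)] nth) blast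
  qed
  have i: "\<And>x y. x \<in> carrier ?L \<Longrightarrow> y \<in> carrier ?L \<Longrightarrow> ?i x y \<in> carrier ?L"
    "\<And>x y z. x \<in> carrier ?L \<Longrightarrow> y \<in> carrier ?L \<Longrightarrow> z \<in> carrier ?L \<Longrightarrow>
      z \<sqsubseteq>\<^bsub>?L\<^esub> ?i x y \<longleftrightarrow> ?m x z \<sqsubseteq>\<^bsub>?L\<^esub> y"
  proof -
    show "?i x y \<in> carrier ?L" if xy: "x \<in> carrier ?L" "y \<in> carrier ?L" for x y
      by (rule pro_lim_restrictI) (simp_all add: cl nth xy hom pro_lim_compat[OF xy(1)] pro_lim_compat[OF xy(2)])
    show "z \<sqsubseteq>\<^bsub>?L\<^esub> ?i x y \<longleftrightarrow> ?m x z \<sqsubseteq>\<^bsub>?L\<^esub> y"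
      if "x \<in> carrier ?L" "y \<in> carrier ?L" "z \<in> carrier ?L" for x y z
      using that by (simp add: pro_lim_le heyting_himp(2)[OF pro_obj(1)] nth)
  qed
  note ops = pro_lim_partial_order t b m j i
  show "heyting_algebra ?L" by (rule heyting_algebraI[OF ops])
  show "\<top>\<^bsub>?L\<^esub> = ?t" "\<bottom>\<^bsub>?L\<^esub> = ?b" by (rule bounds_unique[OF ops]; assumption)+
  show "x \<in> carrier ?L \<Longrightarrow> y \<in> carrier ?L \<Longrightarrow> x \<sqinter>\<^bsub>?L\<^esub> y = ?m x y" by (rule meet_unique[OF ops])
  show "x \<in> carrier ?L \<Longrightarrow> y \<in> carrier ?L \<Longrightarrow> x \<squnion>\<^bsub>?L\<^esub> y = ?j x y" by (rule join_unique[OF ops])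
  show "x \<in> carrier ?L \<Longrightarrow> y \<in> carrier ?L \<Longrightarrow> himp ?L x y = ?i x y" by (rule himp_unique[OF ops])
qed

lemma pro_lim_homI:
  assumes A: "heyting_algebra A" and h: "h \<in> carrier A \<rightarrow>\<^sub>E carrier (pro_lim X)"
    and comp: "\<And>i. i \<in> Obj (idx X) \<Longrightarrow> (\<lambda>a\<in>carrier A. h a i) \<in> ha_hom A (pob X i)"
  shows "h \<in> ha_hom A (pro_lim X)"
proof (rule ha_homI[OF h])
  note cl = heyting_closed[OF A]
  have hc: "h a \<in> carrier (pro_lim X)" if "a \<in> carrier A" for a using h that by blast
  note ops = heyting_closed[OF pro_lim_heyting]
  show "h \<top>\<^bsub>A\<^esub> = \<top>\<^bsub>pro_lim X\<^esub>"
    by (rule pro_lim_eqI[OF hc[OF cl(1)] ops(1)]) (use ha_homD(2)[OF comp] in \<open>simp_all add: hc cl ops pro_lim_top\<close>)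
  show "h \<bottom>\<^bsub>A\<^esub> = \<bottom>\<^bsub>pro_lim X\<^esub>"
    by (rule pro_lim_eqI[OF hc[OF cl(2)] ops(2)]) (use ha_homD(3)[OF comp] in \<open>simp_all add: hc cl ops pro_lim_bottom\<close>)
  fix a b assume ab: "a \<in> carrier A" "b \<in> carrier A"
  show "h (a \<sqinter>\<^bsub>A\<^esub> b) = h a \<sqinter>\<^bsub>pro_lim X\<^esub> h b"
    by (rule pro_lim_eqI[OF hc[OF cl(3)[OF ab]] ops(3)[OF hc[OF ab(1)] hc[OF ab(2)]]]) (use ha_homD(4)[OF comp ab] in \<open>simp_all add: hc cl ops ab pro_lim_meet\<close>)
  show "h (a \<squnion>\<^bsub>A\<^esub> b) = h a \<squnion>\<^bsub>pro_lim X\<^esub> h b"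
    by (rule pro_lim_eqI[OF hc[OF cl(4)[OF ab]] ops(4)[OF hc[OF ab(1)] hc[OF ab(2)]]]) (use ha_homD(5)[OF comp ab] in \<open>simp_all add: hc cl ops ab pro_lim_join\<close>)
  show "h (himp A a b) = himp (pro_lim X) (h a) (h b)"
    by (rule pro_lim_eqI[OF hc[OF cl(5)[OF ab]] ops(5)[OF hc[OF ab(1)] hc[OF ab(2)]]]) (use ha_homD(6)[OF comp ab] in \<open>simp_all add: hc cl ops ab pro_lim_himp\<close>)
qed

lemma pro_lim_proj_hom:
  assumes i: "i \<in> Obj (idx X)"
  shows "(\<lambda>x\<in>carrier (pro_lim X). x i) \<in> ha_hom (pro_lim X) (pob X i)"
  by (rule ha_homI, auto simp: i pro_lim_nth heyting_closed[OF pro_lim_heyting])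
    (simp_all add: i pro_lim_top pro_lim_bottom pro_lim_meet pro_lim_join pro_lim_himp)

section \<open>Filtered colimits of hom-sets\<close>

lemma pro_rel_iff:
  "((i, f), (i', f')) \<in> pro_rel X B \<longleftrightarrow>
     i \<in> Obj (idx X) \<and> f \<in> ha_hom (pob X i) B \<and> i' \<in> Obj (idx X) \<and> f' \<in> ha_hom (pob X i') B \<and>
     (\<exists>k\<in>Obj (idx X). \<exists>u\<in>Arr (idx X) k i. \<exists>u'\<in>Arr (idx X) k i'.
        \<forall>a\<in>carrier (pob X k). f (fmap (dia X) k i u a) = f' (fmap (dia X) k i' u' a))"
  by (simp add: pro_rel_def compose_def fun_eq_iff Ball_def)


text \<open>Transitivity is the point where both cofilteredness conditions are needed; reflexivity
  and symmetry are formal.\<close>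

lemma pro_rel_equiv: "equiv (SIGMA i : Obj (idx X). ha_hom (pob X i) B) (pro_rel X B)"
proof (rule equivI)
  show "pro_rel X B \<subseteq> (SIGMA i : Obj (idx X). ha_hom (pob X i) B) \<times> (SIGMA i : Obj (idx X). ha_hom (pob X i) B)"
    by (auto simp: pro_rel_def)
  show "refl_on (SIGMA i : Obj (idx X). ha_hom (pob X i) B) (pro_rel X B)"
  proof (rule refl_onI)
    fix z assume "z \<in> (SIGMA i : Obj (idx X). ha_hom (pob X i) B)"
    then obtain i f where z: "z = (i, f)" "i \<in> Obj (idx X)" "f \<in> ha_hom (pob X i) B" by blast
    show "(z, z) \<in> pro_rel X B"
      unfolding z(1) pro_rel_iff using z(2,3) pro_index_id[OF z(2)] by blast
  qed
  show "sym (pro_rel X B)"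
  proof (rule symI)
    fix y z assume yz: "(y, z) \<in> pro_rel X B"
    obtain i f i' f' where e: "y = (i, f)" "z = (i', f')" by (cases y, cases z)
    show "(z, y) \<in> pro_rel X B"
      using yz unfolding e pro_rel_iff by metis
  qed
  show "trans (pro_rel X B)"
  proof (rule transI)
    fix x y z assume xy: "(x, y) \<in> pro_rel X B" and yz: "(y, z) \<in> pro_rel X B"
    obtain i f i' f' i'' f'' where e: "x = (i, f)" "y = (i', f')" "z = (i'', f'')" by (cases x, cases y, cases z)
    obtain k u u' where k: "k \<in> Obj (idx X)" "u \<in> Arr (idx X) k i" "u' \<in> Arr (idx X) k i'"
      and ku: "\<And>a. a \<in> carrier (pob X k) \<Longrightarrow> f (fmap (dia X) k i u a) = f' (fmap (dia X) k i' u' a)"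
      and i: "i \<in> Obj (idx X)" "i' \<in> Obj (idx X)" "f \<in> ha_hom (pob X i) B"
      using xy unfolding e pro_rel_iff by blast
    obtain l v v' where l: "l \<in> Obj (idx X)" "v \<in> Arr (idx X) l i'" "v' \<in> Arr (idx X) l i''"
      and lv: "\<And>a. a \<in> carrier (pob X l) \<Longrightarrow> f' (fmap (dia X) l i' v a) = f'' (fmap (dia X) l i'' v' a)"
      and i'': "i'' \<in> Obj (idx X)" "f'' \<in> ha_hom (pob X i'') B"
      using yz unfolding e pro_rel_iff by blast
    \<comment> \<open>The two composites from m to \<open>i'\<close>, through k and through l, need
      not agree. A further arrow w into m equalizes them, and over n the two given equations can be
      chained.\<close>
    obtain m p q where m: "m \<in> Obj (idx X)" "p \<in> Arr (idx X) m k" "q \<in> Arr (idx X) m l"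
      using pro_index_directed[OF k(1) l(1)] .
    obtain n w where n: "n \<in> Obj (idx X)" "w \<in> Arr (idx X) n m"
      and eq: "Cmp (idx X) n m i' (Cmp (idx X) m k i' u' p) w = Cmp (idx X) n m i' (Cmp (idx X) m l i' v q) w"
      using pro_index_equalize[OF m(1) i(2) pro_index_comp[OF m(1) k(1) i(2) m(2) k(3)]
          pro_index_comp[OF m(1) l(1) i(2) m(3) l(2)]] .
    define s where "s = Cmp (idx X) n k i u (Cmp (idx X) n m k p w)"
    define t where "t = Cmp (idx X) n l i'' v' (Cmp (idx X) n m l q w)"
    have pw: "Cmp (idx X) n m k p w \<in> Arr (idx X) n k" and qw: "Cmp (idx X) n m l q w \<in> Arr (idx X) n l"
      using pro_index_comp n m k(1) l(1) by blast+
    have st: "s \<in> Arr (idx X) n i" "t \<in> Arr (idx X) n i''"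
      unfolding s_def t_def using pro_index_comp pw qw n(1) k l i i'' by blast+
    have "f (fmap (dia X) n i s a) = f'' (fmap (dia X) n i'' t a)" if a: "a \<in> carrier (pob X n)" for a
    proof -
      note wa = ha_hom_closed[OF pro_map[OF n(1) m(1) n(2)] a]
      define b where "b = fmap (dia X) n m w a"
      have b: "b \<in> carrier (pob X m)" unfolding b_def by (rule wa)
      have pb: "fmap (dia X) m k p b \<in> carrier (pob X k)" and qb: "fmap (dia X) m l q b \<in> carrier (pob X l)"
        using ha_hom_closed[OF pro_map[OF m(1) k(1) m(2)] b] ha_hom_closed[OF pro_map[OF m(1) l(1) m(3)] b] .
      have s: "fmap (dia X) n i s a = fmap (dia X) k i u (fmap (dia X) m k p b)"
        unfolding s_def b_def pro_map_comp[OF n(1) k(1) i(1) pw k(2) a] pro_map_comp[OF n(1) m(1) k(1) n(2) m(2) a] ..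
      have t: "fmap (dia X) n i'' t a = fmap (dia X) l i'' v' (fmap (dia X) m l q b)"
        unfolding t_def b_def pro_map_comp[OF n(1) l(1) i''(1) qw l(3) a] pro_map_comp[OF n(1) m(1) l(1) n(2) m(3) a] ..
      have "fmap (dia X) k i' u' (fmap (dia X) m k p b) = fmap (dia X) l i' v (fmap (dia X) m l q b)"
        using arg_cong[OF eq, of "\<lambda>u. fmap (dia X) n i' u a"]
        unfolding pro_map_comp[OF n(1) m(1) i(2) n(2) pro_index_comp[OF m(1) k(1) i(2) m(2) k(3)] a]
          pro_map_comp[OF n(1) m(1) i(2) n(2) pro_index_comp[OF m(1) l(1) i(2) m(3) l(2)] a]
          b_def[symmetric] pro_map_comp[OF m(1) k(1) i(2) m(2) k(3) b] pro_map_comp[OF m(1) l(1) i(2) m(3) l(2) b] .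
      then show ?thesis unfolding s t using ku[OF pb] lv[OF qb] by simp
    qed
    then show "(x, z) \<in> pro_rel X B"
      unfolding e pro_rel_iff using i i'' st n(1) by blast
  qed
qed

lemma pro_rel_sym: "(y, z) \<in> pro_rel X B \<Longrightarrow> (z, y) \<in> pro_rel X B"
  using pro_rel_equiv[of B] unfolding equiv_def by (blast dest: symD)

lemma pro_rel_trans: "(x, y) \<in> pro_rel X B \<Longrightarrow> (y, z) \<in> pro_rel X B \<Longrightarrow> (x, z) \<in> pro_rel X B"
  using pro_rel_equiv[of B] unfolding equiv_def by (blast dest: transD)

lemma pro_colim_memD:
  assumes c: "c \<in> pro_colim X B"
  shows "c \<noteq> {}"
    and "(i, f) \<in> c \<Longrightarrow> i \<in> Obj (idx X)" "(i, f) \<in> c \<Longrightarrow> f \<in> ha_hom (pob X i) B"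
    and "z \<in> c \<Longrightarrow> c = pro_rel X B `` {z}"
    and "z \<in> c \<Longrightarrow> z' \<in> c \<longleftrightarrow> (z, z') \<in> pro_rel X B"
proof -
  note Q = c[unfolded pro_colim_def]
  show "c \<noteq> {}" by (rule in_quotient_imp_non_empty[OF pro_rel_equiv Q])
  note sub = in_quotient_imp_subset[OF pro_rel_equiv Q]
  show "(i, f) \<in> c \<Longrightarrow> i \<in> Obj (idx X)" "(i, f) \<in> c \<Longrightarrow> f \<in> ha_hom (pob X i) B"
    using sub by blast+
  have *: "c = pro_rel X B `` {z}" if "z \<in> c" for z
  proof -
    obtain y where y: "c = pro_rel X B `` {y}" using Q by (rule quotientE)
    then have "(y, z) \<in> pro_rel X B" using that by blast
    then show ?thesis unfolding y by (rule equiv_class_eq[OF pro_rel_equiv])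
  qed
  show "z \<in> c \<Longrightarrow> c = pro_rel X B `` {z}" by (rule *)
  show "z \<in> c \<Longrightarrow> z' \<in> c \<longleftrightarrow> (z, z') \<in> pro_rel X B" using * by blast
qed

lemma pro_classI:
  assumes "i \<in> Obj (idx X)" "f \<in> ha_hom (pob X i) B"
  shows "pro_rel X B `` {(i, f)} \<in> pro_colim X B" "(i, f) \<in> pro_rel X B `` {(i, f)}"
proof -
  have *: "(i, f) \<in> (SIGMA i : Obj (idx X). ha_hom (pob X i) B)" using assms by blast
  show "pro_rel X B `` {(i, f)} \<in> pro_colim X B" unfolding pro_colim_def by (rule quotientI[OF *])
  show "(i, f) \<in> pro_rel X B `` {(i, f)}" by (rule equiv_class_self[OF pro_rel_equiv *])
qed

text \<open>At the common index k both values are computed from the same component of x, because x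
  is compatible with the transition maps. Hence a colimit class acts on points of the limit.\<close>

lemma pro_rel_eval:
  assumes "((i, f), (i', f')) \<in> pro_rel X B" "x \<in> carrier (pro_lim X)"
  shows "f (x i) = f' (x i')"
proof -
  obtain k u u' where k: "k \<in> Obj (idx X)" "u \<in> Arr (idx X) k i" "u' \<in> Arr (idx X) k i'"
    and ku: "\<And>a. a \<in> carrier (pob X k) \<Longrightarrow> f (fmap (dia X) k i u a) = f' (fmap (dia X) k i' u' a)"
    and i: "i \<in> Obj (idx X)" "i' \<in> Obj (idx X)"
    using assms(1) unfolding pro_rel_iff by blast
  show ?thesis
    using ku[OF pro_lim_nth[OF assms(2) k(1)]] pro_lim_compat[OF assms(2) k(1) i(1) k(2)]
      pro_lim_compat[OF assms(2) k(1) i(2) k(3)] by simp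
qed

lemma pro_rel_compose:
  assumes "((i, f), (i', f')) \<in> pro_rel X B" "g \<in> ha_hom B C"
  shows "((i, compose (carrier (pob X i)) g f), (i', compose (carrier (pob X i')) g f')) \<in> pro_rel X C"
proof -
  obtain k u u' where k: "k \<in> Obj (idx X)" "u \<in> Arr (idx X) k i" "u' \<in> Arr (idx X) k i'"
    and ku: "\<And>a. a \<in> carrier (pob X k) \<Longrightarrow> f (fmap (dia X) k i u a) = f' (fmap (dia X) k i' u' a)"
    and i: "i \<in> Obj (idx X)" "i' \<in> Obj (idx X)" and f: "f \<in> ha_hom (pob X i) B" "f' \<in> ha_hom (pob X i') B"
    using assms(1) unfolding pro_rel_iff by blast
  have "compose (carrier (pob X i)) g f (fmap (dia X) k i u a) =
      compose (carrier (pob X i')) g f' (fmap (dia X) k i' u' a)" if "a \<in> carrier (pob X k)" for a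
    using ku[OF that] ha_hom_closed[OF pro_map[OF k(1) i(1) k(2)] that]
      ha_hom_closed[OF pro_map[OF k(1) i(2) k(3)] that] by (simp add: compose_eq)
  then show ?thesis
    unfolding pro_rel_iff
    using k i ha_hom_compose[OF pro_obj(1)[OF i(1)] f(1) assms(2)] ha_hom_compose[OF pro_obj(1)[OF i(2)] f(2) assms(2)]
    by blast
qed

text \<open>The relation is witnessed at index k itself, by the identity of k and the arrow
  u.\<close>

lemma pro_rel_transition:
  assumes "i \<in> Obj (idx X)" "k \<in> Obj (idx X)" "u \<in> Arr (idx X) k i" "f \<in> ha_hom (pob X i) B"
  shows "((k, compose (carrier (pob X k)) f (fmap (dia X) k i u)), (i, f)) \<in> pro_rel X B"
  unfolding pro_rel_iff
proof (intro conjI bexI ballI)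
  show "compose (carrier (pob X k)) f (fmap (dia X) k i u) \<in> ha_hom (pob X k) B"
    by (rule ha_hom_compose[OF pro_obj(1)[OF assms(2)] pro_map[OF assms(2,1,3)] assms(4)])
  fix a assume "a \<in> carrier (pob X k)"
  then show "compose (carrier (pob X k)) f (fmap (dia X) k i u) (fmap (dia X) k k (Ident (idx X) k) a) =
      f (fmap (dia X) k i u a)"
    by (simp add: pro_map_id[OF assms(2)] compose_eq)
qed (use assms pro_index_id in auto)

end

section \<open>Morphisms of pro-objects and their action on limits\<close>

context
  fixes X :: "('i, 'm, 'h) pro" and Y :: "('j, 'n, 'k) pro"
  assumes X: "pro_object X" and Y: "pro_object Y"
begin

lemma pro_homD:
  assumes \<phi>: "\<phi> \<in> pro_hom X Y"
  shows "j \<in> Obj (idx Y) \<Longrightarrow> \<phi> j \<in> pro_colim X (pob Y j)"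
    and "j \<in> Obj (idx Y) \<Longrightarrow> j' \<in> Obj (idx Y) \<Longrightarrow> v \<in> Arr (idx Y) j j' \<Longrightarrow> (i, f) \<in> \<phi> j \<Longrightarrow>
      (i, compose (carrier (pob X i)) (fmap (dia Y) j j' v) f) \<in> \<phi> j'"
    and "\<phi> \<in> extensional (Obj (idx Y))"
proof -
  show "\<phi> j \<in> pro_colim X (pob Y j)" if "j \<in> Obj (idx Y)" using \<phi> that by (auto simp: pro_hom_def)
  show "\<phi> \<in> extensional (Obj (idx Y))" using \<phi> by (simp add: pro_hom_def PiE_iff)
  show "(i, compose (carrier (pob X i)) (fmap (dia Y) j j' v) f) \<in> \<phi> j'"
    if "j \<in> Obj (idx Y)" "j' \<in> Obj (idx Y)" "v \<in> Arr (idx Y) j j'" and f: "(i, f) \<in> \<phi> j"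
  proof -
    have "\<forall>(i, f)\<in>\<phi> j. (i, compose (carrier (pob X i)) (fmap (dia Y) j j' v) f) \<in> \<phi> j'"
      using \<phi> that(1-3) by (simp add: pro_hom_def)
    from bspec[OF this f] show ?thesis by simp
  qed
qed

lemma pro_hom_repr:
  assumes "\<phi> \<in> pro_hom X Y" "j \<in> Obj (idx Y)"
  obtains i f where "(i, f) \<in> \<phi> j" "i \<in> Obj (idx X)" "f \<in> ha_hom (pob X i) (pob Y j)"
proof -
  note c = pro_homD(1)[OF assms]
  obtain z where "z \<in> \<phi> j" using pro_colim_memD(1)[OF X c] by blast
  then show thesis using that[of "fst z" "snd z"] pro_colim_memD(2,3)[OF X c, of "fst z" "snd z"] by simp
qed

text \<open>Components are equivalence classes, so a common member in each component is
  enough.\<close>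

lemma pro_hom_eqI:
  assumes "\<phi> \<in> pro_hom X Y" "\<psi> \<in> pro_hom X Y" "\<And>j. j \<in> Obj (idx Y) \<Longrightarrow> \<exists>z. z \<in> \<phi> j \<and> z \<in> \<psi> j"
  shows "\<phi> = \<psi>"
proof (rule extensionalityI[OF pro_homD(3)[OF assms(1)] pro_homD(3)[OF assms(2)]])
  fix j assume j: "j \<in> Obj (idx Y)"
  then obtain z where z: "z \<in> \<phi> j" "z \<in> \<psi> j" using assms(3) by blast
  show "\<phi> j = \<psi> j"
    using pro_colim_memD(4)[OF X pro_homD(1)[OF assms(1) j] z(1)]
      pro_colim_memD(4)[OF X pro_homD(1)[OF assms(2) j] z(2)] by simp
qed

lemma pro_lim_map_eval:
  assumes "\<phi> \<in> pro_hom X Y" "x \<in> carrier (pro_lim X)" "j \<in> Obj (idx Y)" "(i, f) \<in> \<phi> j"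
  shows "pro_lim_map X Y \<phi> x j = f (x i)"
proof -
  have "(THE y. \<exists>(i, f)\<in>\<phi> j. y = f (x i)) = f (x i)"
  proof (rule the_equality)
    show "\<exists>(i', f')\<in>\<phi> j. f (x i) = f' (x i')" using assms(4) by blast
  next
    fix y assume "\<exists>(i, f)\<in>\<phi> j. y = f (x i)"
    then obtain i' f' where i': "(i', f') \<in> \<phi> j" and y: "y = f' (x i')" by blast
    have "((i', f'), (i, f)) \<in> pro_rel X (pob Y j)"
      using pro_colim_memD(5)[OF X pro_homD(1)[OF assms(1,3)] i'] assms(4) by blast
    then show "y = f (x i)" unfolding y using pro_rel_eval[OF X _ assms(2)] by blast
  qed
  then show ?thesis using assms(2,3) by (simp add: pro_lim_map_def)
qed

lemma pro_lim_map_closed: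
  assumes \<phi>: "\<phi> \<in> pro_hom X Y" and x: "x \<in> carrier (pro_lim X)"
  shows "pro_lim_map X Y \<phi> x \<in> carrier (pro_lim Y)"
  unfolding pro_lim_carrier[OF Y]
proof (intro conjI ballI)
  show "pro_lim_map X Y \<phi> x \<in> (\<Pi>\<^sub>E j\<in>Obj (idx Y). carrier (pob Y j))"
  proof (rule PiE_I)
    fix j assume j: "j \<in> Obj (idx Y)"
    obtain i f where f: "(i, f) \<in> \<phi> j" "i \<in> Obj (idx X)" "f \<in> ha_hom (pob X i) (pob Y j)"
      using pro_hom_repr[OF \<phi> j] .
    show "pro_lim_map X Y \<phi> x j \<in> carrier (pob Y j)"
      unfolding pro_lim_map_eval[OF \<phi> x j f(1)] by (rule ha_hom_closed[OF f(3) pro_lim_nth[OF X x f(2)]])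
  qed (use x in \<open>simp add: pro_lim_map_def\<close>)
  fix j j' v assume j: "j \<in> Obj (idx Y)" "j' \<in> Obj (idx Y)" and v: "v \<in> Arr (idx Y) j j'"
  obtain i f where f: "(i, f) \<in> \<phi> j" "i \<in> Obj (idx X)" "f \<in> ha_hom (pob X i) (pob Y j)"
    using pro_hom_repr[OF \<phi> j(1)] .
  show "fmap (dia Y) j j' v (pro_lim_map X Y \<phi> x j) = pro_lim_map X Y \<phi> x j'"
    unfolding pro_lim_map_eval[OF \<phi> x j(1) f(1)] pro_lim_map_eval[OF \<phi> x j(2) pro_homD(2)[OF \<phi> j v f(1)]]
    using pro_lim_nth[OF X x f(2)] by (simp add: compose_eq)
qed

lemma pro_lim_map_hom:
  assumes \<phi>: "\<phi> \<in> pro_hom X Y"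
  shows "pro_lim_map X Y \<phi> \<in> ha_hom (pro_lim X) (pro_lim Y)"
proof (rule pro_lim_homI[OF Y pro_lim_heyting[OF X]])
  show "pro_lim_map X Y \<phi> \<in> carrier (pro_lim X) \<rightarrow>\<^sub>E carrier (pro_lim Y)"
    by (rule PiE_I[OF pro_lim_map_closed[OF \<phi>]]) (simp_all add: pro_lim_map_def)
  fix j assume j: "j \<in> Obj (idx Y)"
  obtain i f where f: "(i, f) \<in> \<phi> j" "i \<in> Obj (idx X)" "f \<in> ha_hom (pob X i) (pob Y j)"
    using pro_hom_repr[OF \<phi> j] .
  have "(\<lambda>x\<in>carrier (pro_lim X). pro_lim_map X Y \<phi> x j) = compose (carrier (pro_lim X)) f (\<lambda>x\<in>carrier (pro_lim X). x i)"
    using pro_lim_map_eval[OF \<phi> _ j f(1)] by (simp add: compose_def fun_eq_iff)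
  then show "(\<lambda>x\<in>carrier (pro_lim X). pro_lim_map X Y \<phi> x j) \<in> ha_hom (pro_lim X) (pob Y j)"
    using ha_hom_compose[OF pro_lim_heyting[OF X] pro_lim_proj_hom[OF X f(2)] f(3)] by simp
qed

end

lemma pro_id_mem:
  assumes X: "pro_object X" and i: "i \<in> Obj (idx X)"
  shows "(i, \<lambda>a\<in>carrier (pob X i). a) \<in> pro_id X i"
  using pro_classI(2)[OF X i ha_hom_id[OF pro_obj(1)[OF X i]]] i by (simp add: pro_id_def)

lemma pro_id_hom:
  assumes X: "pro_object X"
  shows "pro_id X \<in> pro_hom X X"
  unfolding pro_hom_def
proof (intro CollectI conjI ballI)
  note idh = ha_hom_id[OF pro_obj(1)[OF X]]
  show "pro_id X \<in> (\<Pi>\<^sub>E i\<in>Obj (idx X). pro_colim X (pob X i))"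
    using pro_classI(1)[OF X _ idh] by (auto simp: pro_id_def)
  fix j j' v z assume j: "j \<in> Obj (idx X)" "j' \<in> Obj (idx X)" and v: "v \<in> Arr (idx X) j j'" and "z \<in> pro_id X j"
  then obtain i f where z: "z = (i, f)" and rel: "((j, \<lambda>a\<in>carrier (pob X j). a), (i, f)) \<in> pro_rel X (pob X j)"
    by (cases z) (auto simp: pro_id_def)
  let ?v = "fmap (dia X) j j' v"
  have v': "?v \<in> ha_hom (pob X j) (pob X j')" by (rule pro_map[OF X j v])
  have e: "compose (carrier (pob X j)) ?v (\<lambda>a\<in>carrier (pob X j). a) =
      compose (carrier (pob X j)) (\<lambda>a\<in>carrier (pob X j'). a) ?v"
    using ha_hom_closed[OF v'] by (auto simp: compose_def fun_eq_iff)
  have "((j, compose (carrier (pob X j)) (\<lambda>a\<in>carrier (pob X j'). a) ?v), (i, compose (carrier (pob X i)) ?v f)) \<in> pro_rel X (pob X j')"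
    using pro_rel_compose[OF X rel v'] unfolding e .
  moreover have "((j, compose (carrier (pob X j)) (\<lambda>a\<in>carrier (pob X j'). a) ?v), (j', \<lambda>a\<in>carrier (pob X j'). a)) \<in> pro_rel X (pob X j')"
    by (rule pro_rel_transition[OF X j(2,1) v idh[OF j(2)]])
  ultimately have "((j', \<lambda>a\<in>carrier (pob X j'). a), (i, compose (carrier (pob X i)) ?v f)) \<in> pro_rel X (pob X j')"
    by (blast intro: pro_rel_trans[OF X] pro_rel_sym[OF X])
  then show "case z of (i, f) \<Rightarrow> (i, compose (carrier (pob X i)) ?v f) \<in> pro_id X j'"
    unfolding z using j by (simp add: pro_id_def)
qed

lemma pro_lim_map_id:
  assumes X: "pro_object X"
  shows "pro_lim_map X X (pro_id X) = (\<lambda>x\<in>carrier (pro_lim X). x)"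
proof (rule extensionalityI[of _ "carrier (pro_lim X)"])
  fix x assume x: "x \<in> carrier (pro_lim X)"
  have "pro_lim_map X X (pro_id X) x = x"
    by (rule pro_lim_eqI[OF X pro_lim_map_closed[OF X X pro_id_hom[OF X] x] x])
      (use pro_lim_nth[OF X x] in \<open>simp add: pro_lim_map_eval[OF X X pro_id_hom[OF X] x _ pro_id_mem[OF X]]\<close>)
  then show "pro_lim_map X X (pro_id X) x = (\<lambda>x\<in>carrier (pro_lim X). x) x" using x by simp
qed (simp_all add: pro_lim_map_def)

context
  fixes X :: "('i, 'm, 'h) pro" and Y :: "('j, 'n, 'k) pro" and Z :: "('q, 'l, 'r) pro" and \<phi> \<psi>
  assumes X: "pro_object X" and Y: "pro_object Y" and Z: "pro_object Z"
    and \<phi>: "\<phi> \<in> pro_hom X Y" and \<psi>: "\<psi> \<in> pro_hom Y Z"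
begin

text \<open>Bring g and \<open>g'\<close> to a common index k of Y and represent \<phi> at k by one
  map e. Compatibility of \<phi> makes f and \<open>f'\<close> equivalent to e followed by the two
  transition maps, and after g and \<open>g'\<close> these composites coincide.\<close>

lemma pro_comp_independent:
  assumes q: "q \<in> Obj (idx Z)" and g: "(j, g) \<in> \<psi> q" "(j', g') \<in> \<psi> q" and f: "(i, f) \<in> \<phi> j" "(i', f') \<in> \<phi> j'"
  shows "((i, compose (carrier (pob X i)) g f), (i', compose (carrier (pob X i')) g' f')) \<in> pro_rel X (pob Z q)"
proof -
  note cq = pro_homD(1)[OF Y Z \<psi> q]
  note gh = pro_colim_memD(2,3)[OF Y cq g(1)] pro_colim_memD(2,3)[OF Y cq g(2)]
  have "((j, g), (j', g')) \<in> pro_rel Y (pob Z q)" using pro_colim_memD(5)[OF Y cq g(1)] g(2) by blast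
  then obtain k v v' where k: "k \<in> Obj (idx Y)" "v \<in> Arr (idx Y) k j" "v' \<in> Arr (idx Y) k j'"
    and kv: "\<And>a. a \<in> carrier (pob Y k) \<Longrightarrow> g (fmap (dia Y) k j v a) = g' (fmap (dia Y) k j' v' a)"
    unfolding pro_rel_iff[OF Y] by blast
  obtain l e where e: "(l, e) \<in> \<phi> k" "l \<in> Obj (idx X)" "e \<in> ha_hom (pob X l) (pob Y k)"
    using pro_hom_repr[OF X Y \<phi> k(1)] .
  note ve = pro_homD(2)[OF X Y \<phi> k(1) gh(1) k(2) e(1)] pro_homD(2)[OF X Y \<phi> k(1) gh(3) k(3) e(1)]
  have "((i, f), (l, compose (carrier (pob X l)) (fmap (dia Y) k j v) e)) \<in> pro_rel X (pob Y j)"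
    "((l, compose (carrier (pob X l)) (fmap (dia Y) k j' v') e), (i', f')) \<in> pro_rel X (pob Y j')"
    using pro_colim_memD(5)[OF X pro_homD(1)[OF X Y \<phi> gh(1)] f(1)] ve(1)
      pro_colim_memD(5)[OF X pro_homD(1)[OF X Y \<phi> gh(3)] ve(2)] f(2) by blast+
  note r = pro_rel_compose[OF X this(1) gh(2)] pro_rel_compose[OF X this(2) gh(4)]
  have eq: "compose (carrier (pob X l)) g (compose (carrier (pob X l)) (fmap (dia Y) k j v) e) =
      compose (carrier (pob X l)) g' (compose (carrier (pob X l)) (fmap (dia Y) k j' v') e)"
    using kv ha_hom_closed[OF e(3)] by (simp add: compose_def fun_eq_iff)
  show ?thesis by (rule pro_rel_trans[OF X r(1)[unfolded eq] r(2)])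
qed

text \<open>By independence all the classes in the double union are equal, so the union is a single
  class and any pair of representatives computes it.\<close>

lemma pro_comp_class:
  assumes q: "q \<in> Obj (idx Z)" and g: "(j, g) \<in> \<psi> q" and f: "(i, f) \<in> \<phi> j"
  shows "pro_comp X Y Z \<psi> \<phi> q = pro_rel X (pob Z q) `` {(i, compose (carrier (pob X i)) g f)}"
proof -
  let ?c = "\<lambda>g i f. pro_rel X (pob Z q) `` {(i, compose (carrier (pob X i)) g f)}"
  have eq: "?c g' i' f' = ?c g i f" if "(j', g') \<in> \<psi> q" "(i', f') \<in> \<phi> j'" for j' g' i' f'
    by (rule equiv_class_eq[OF pro_rel_equiv[OF X] pro_comp_independent[OF q that(1) g that(2) f]])
  have "(\<Union>(j, g)\<in>\<psi> q. \<Union>(i, f)\<in>\<phi> j. ?c g i f) = ?c g i f"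
  proof (intro equalityI subsetI)
    fix z assume "z \<in> (\<Union>(j, g)\<in>\<psi> q. \<Union>(i, f)\<in>\<phi> j. ?c g i f)"
    then obtain y where y: "y \<in> \<psi> q" "z \<in> (case y of (j, g) \<Rightarrow> \<Union>(i, f)\<in>\<phi> j. ?c g i f)" by (rule UN_E)
    obtain j' g' where jg: "y = (j', g')" by (cases y)
    obtain x where x: "x \<in> \<phi> j'" "z \<in> (case x of (i, f) \<Rightarrow> ?c g' i f)" using y(2) unfolding jg prod.case by (rule UN_E)
    obtain i' f' where "x = (i', f')" by (cases x)
    with x y(1) jg eq[of j' g' i' f'] show "z \<in> ?c g i f" by (simp del: Image_singleton_iff)
  next
    fix z assume "z \<in> ?c g i f"
    then show "z \<in> (\<Union>(j, g)\<in>\<psi> q. \<Union>(i, f)\<in>\<phi> j. ?c g i f)"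
      using g f by (intro UN_I[of "(j, g)"]) (simp_all only: prod.case, intro UN_I[of "(i, f)"], simp_all)
  qed
  then show ?thesis using q by (simp add: pro_comp_def)
qed

lemma pro_comp_mem:
  assumes q: "q \<in> Obj (idx Z)" and g: "(j, g) \<in> \<psi> q" and f: "(i, f) \<in> \<phi> j"
  shows "i \<in> Obj (idx X)" "compose (carrier (pob X i)) g f \<in> ha_hom (pob X i) (pob Z q)"
    "(i, compose (carrier (pob X i)) g f) \<in> pro_comp X Y Z \<psi> \<phi> q"
proof -
  note cq = pro_homD(1)[OF Y Z \<psi> q]
  note gh = pro_colim_memD(2,3)[OF Y cq g]
  note fh = pro_colim_memD(2,3)[OF X pro_homD(1)[OF X Y \<phi> gh(1)] f]
  show "i \<in> Obj (idx X)" by (rule fh(1))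
  show c: "compose (carrier (pob X i)) g f \<in> ha_hom (pob X i) (pob Z q)"
    by (rule ha_hom_compose[OF pro_obj(1)[OF X fh(1)] fh(2) gh(2)])
  show "(i, compose (carrier (pob X i)) g f) \<in> pro_comp X Y Z \<psi> \<phi> q"
    unfolding pro_comp_class[OF q g f] by (rule pro_classI(2)[OF X fh(1) c])
qed

lemma pro_comp_repr:
  assumes q: "q \<in> Obj (idx Z)"
  obtains j g i f where "(j, g) \<in> \<psi> q" "(i, f) \<in> \<phi> j" "j \<in> Obj (idx Y)" "g \<in> ha_hom (pob Y j) (pob Z q)"
    "i \<in> Obj (idx X)" "f \<in> ha_hom (pob X i) (pob Y j)"
proof -
  obtain j g where g: "(j, g) \<in> \<psi> q" "j \<in> Obj (idx Y)" "g \<in> ha_hom (pob Y j) (pob Z q)"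
    using pro_hom_repr[OF Y Z \<psi> q] .
  obtain i f where f: "(i, f) \<in> \<phi> j" "i \<in> Obj (idx X)" "f \<in> ha_hom (pob X i) (pob Y j)"
    using pro_hom_repr[OF X Y \<phi> g(2)] .
  show thesis by (rule that[OF g(1) f(1) g(2,3) f(2,3)])
qed

lemma pro_comp_hom: "pro_comp X Y Z \<psi> \<phi> \<in> pro_hom X Z"
  unfolding pro_hom_def
proof (intro CollectI conjI ballI)
  show "pro_comp X Y Z \<psi> \<phi> \<in> (\<Pi>\<^sub>E q\<in>Obj (idx Z). pro_colim X (pob Z q))"
  proof (rule PiE_I)
    fix q assume q: "q \<in> Obj (idx Z)"
    obtain j g i f where r: "(j, g) \<in> \<psi> q" "(i, f) \<in> \<phi> j" using pro_comp_repr[OF q] by metis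
    show "pro_comp X Y Z \<psi> \<phi> q \<in> pro_colim X (pob Z q)"
      unfolding pro_comp_class[OF q r] by (rule pro_classI(1)[OF X pro_comp_mem(1,2)[OF q r]])
  qed (simp add: pro_comp_def)
  fix q q' w z assume q: "q \<in> Obj (idx Z)" "q' \<in> Obj (idx Z)" and w: "w \<in> Arr (idx Z) q q'"
    and z: "z \<in> pro_comp X Y Z \<psi> \<phi> q"
  let ?w = "fmap (dia Z) q q' w"
  obtain j g i f where r: "(j, g) \<in> \<psi> q" "(i, f) \<in> \<phi> j" and h: "f \<in> ha_hom (pob X i) (pob Y j)"
    using pro_comp_repr[OF q(1)] by metis
  obtain i' h' where z': "z = (i', h')" by (cases z)
  have "((i, compose (carrier (pob X i)) g f), (i', h')) \<in> pro_rel X (pob Z q)"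
    using z unfolding pro_comp_class[OF q(1) r] z' by simp
  from pro_rel_compose[OF X this pro_map[OF Z q w]]
  have "((i, compose (carrier (pob X i)) ?w (compose (carrier (pob X i)) g f)),
      (i', compose (carrier (pob X i')) ?w h')) \<in> pro_rel X (pob Z q')" .
  moreover have "compose (carrier (pob X i)) ?w (compose (carrier (pob X i)) g f) =
      compose (carrier (pob X i)) (compose (carrier (pob Y j)) ?w g) f"
    using ha_hom_closed[OF h] by (simp add: compose_def fun_eq_iff)
  ultimately show "case z of (i, f) \<Rightarrow> (i, compose (carrier (pob X i)) ?w f) \<in> pro_comp X Y Z \<psi> \<phi> q'"
    unfolding z' pro_comp_class[OF q(2) pro_homD(2)[OF Y Z \<psi> q w r(1)] r(2)] by simp
qed

lemma pro_lim_map_comp: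
  "pro_lim_map X Z (pro_comp X Y Z \<psi> \<phi>) = compose (carrier (pro_lim X)) (pro_lim_map Y Z \<psi>) (pro_lim_map X Y \<phi>)"
proof (rule extensionalityI[of _ "carrier (pro_lim X)"])
  fix x assume x: "x \<in> carrier (pro_lim X)"
  note y = pro_lim_map_closed[OF X Y \<phi> x]
  have "pro_lim_map X Z (pro_comp X Y Z \<psi> \<phi>) x = pro_lim_map Y Z \<psi> (pro_lim_map X Y \<phi> x)"
  proof (rule pro_lim_eqI[OF Z pro_lim_map_closed[OF X Z pro_comp_hom x] pro_lim_map_closed[OF Y Z \<psi> y]])
    fix q assume q: "q \<in> Obj (idx Z)"
    obtain j g i f where r: "(j, g) \<in> \<psi> q" "(i, f) \<in> \<phi> j" and j: "j \<in> Obj (idx Y)" "i \<in> Obj (idx X)"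
      using pro_comp_repr[OF q] by metis
    show "pro_lim_map X Z (pro_comp X Y Z \<psi> \<phi>) x q = pro_lim_map Y Z \<psi> (pro_lim_map X Y \<phi> x) q"
      unfolding pro_lim_map_eval[OF X Z pro_comp_hom x q pro_comp_mem(3)[OF q r]]
        pro_lim_map_eval[OF Y Z \<psi> y q r(1)] pro_lim_map_eval[OF X Y \<phi> x j(1) r(2)]
      using pro_lim_nth[OF X x j(2)] by (simp add: compose_eq)
  qed
  then show "pro_lim_map X Z (pro_comp X Y Z \<psi> \<phi>) x =
      compose (carrier (pro_lim X)) (pro_lim_map Y Z \<psi>) (pro_lim_map X Y \<phi>) x" using x by (simp add: compose_eq)
qed (simp_all add: pro_lim_map_def compose_def)

end

lemma Pro_cat_simps [simp]:
  "Obj Pro_cat = {X. pro_object X}" "Arr Pro_cat = pro_hom" "Ident Pro_cat = pro_id" "Cmp Pro_cat = pro_comp"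
  by (simp_all add: Pro_cat_def)

lemma forget_is_functor: "is_functor Pro_cat HA_cat forget_functor"
  unfolding is_functor_def
  by (simp add: forget_functor_def HA_Obj pro_lim_heyting pro_lim_map_hom pro_lim_map_id pro_lim_map_comp)


section \<open>Profinite algebras of up-sets\<close>

text \<open>A criterion for r to exhibit X as the completion of A: for finite B, composition with r
  identifies the colimit of the homomorphisms from the diagram to B with the homomorphisms from A to
  B. Assumption \<open>inj\<close> says that no further classes are separated, \<open>surj\<close>
  that every homomorphism factors. Applied to each term of the diagram Y, this passes to the
  limit.\<close>

lemma pro_universal:
  fixes X :: "('i, 'm, 'h) pro" and Y :: "('j, 'n, 'k) pro" and A :: "'a gorder"
  assumes X: "pro_object X" and Y: "pro_object Y" and A: "heyting_algebra A" and r: "r \<in> ha_hom A (pro_lim X)"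
    and inj: "\<And>(B :: 'k gorder) i f i' f'. i \<in> Obj (idx X) \<Longrightarrow> f \<in> ha_hom (pob X i) B \<Longrightarrow>
      i' \<in> Obj (idx X) \<Longrightarrow> f' \<in> ha_hom (pob X i') B \<Longrightarrow> (\<And>a. a \<in> carrier A \<Longrightarrow> f (r a i) = f' (r a i')) \<Longrightarrow>
      ((i, f), (i', f')) \<in> pro_rel X B"
    and surj: "\<And>(B :: 'k gorder) g. heyting_algebra B \<Longrightarrow> finite (carrier B) \<Longrightarrow> g \<in> ha_hom A B \<Longrightarrow>
      \<exists>i\<in>Obj (idx X). \<exists>f\<in>ha_hom (pob X i) B. \<forall>a\<in>carrier A. f (r a i) = g a"
  shows "bij_betw (\<lambda>\<phi>. compose (carrier A) (pro_lim_map X Y \<phi>) r) (pro_hom X Y) (ha_hom A (pro_lim Y))"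
  unfolding bij_betw_def
proof
  have rc: "r a \<in> carrier (pro_lim X)" if "a \<in> carrier A" for a using ha_hom_closed[OF r that] .
  have ev: "compose (carrier A) (pro_lim_map X Y \<phi>) r a j = f (r a i)"
    if "\<phi> \<in> pro_hom X Y" "a \<in> carrier A" "j \<in> Obj (idx Y)" "(i, f) \<in> \<phi> j" for \<phi> a j i f
    using pro_lim_map_eval[OF X Y that(1) rc[OF that(2)] that(3,4)] that(2) by (simp add: compose_eq)
  show "inj_on (\<lambda>\<phi>. compose (carrier A) (pro_lim_map X Y \<phi>) r) (pro_hom X Y)"
  proof (rule inj_onI)
    fix \<phi> \<psi> assume \<phi>: "\<phi> \<in> pro_hom X Y" and \<psi>: "\<psi> \<in> pro_hom X Y"
      and eq: "compose (carrier A) (pro_lim_map X Y \<phi>) r = compose (carrier A) (pro_lim_map X Y \<psi>) r"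
    show "\<phi> = \<psi>"
    proof (rule pro_hom_eqI[OF X Y \<phi> \<psi>])
      fix j assume j: "j \<in> Obj (idx Y)"
      obtain i f where f: "(i, f) \<in> \<phi> j" "i \<in> Obj (idx X)" "f \<in> ha_hom (pob X i) (pob Y j)"
        using pro_hom_repr[OF X Y \<phi> j] .
      obtain i' f' where f': "(i', f') \<in> \<psi> j" "i' \<in> Obj (idx X)" "f' \<in> ha_hom (pob X i') (pob Y j)"
        using pro_hom_repr[OF X Y \<psi> j] .
      have "((i', f'), (i, f)) \<in> pro_rel X (pob Y j)"
      proof (rule inj[OF f'(2,3) f(2,3)])
        fix a assume a: "a \<in> carrier A"
        show "f' (r a i') = f (r a i)" using ev[OF \<phi> a j f(1)] ev[OF \<psi> a j f'(1)] eq by simp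
      qed
      then have "(i, f) \<in> \<psi> j" using pro_colim_memD(5)[OF X pro_homD(1)[OF X Y \<psi> j] f'(1)] by blast
      then show "\<exists>z. z \<in> \<phi> j \<and> z \<in> \<psi> j" using f(1) by blast
    qed
  qed
  show "(\<lambda>\<phi>. compose (carrier A) (pro_lim_map X Y \<phi>) r) ` pro_hom X Y = ha_hom A (pro_lim Y)"
  proof (intro equalityI subsetI)
    fix g assume "g \<in> (\<lambda>\<phi>. compose (carrier A) (pro_lim_map X Y \<phi>) r) ` pro_hom X Y"
    then show "g \<in> ha_hom A (pro_lim Y)" using ha_hom_compose[OF A r pro_lim_map_hom[OF X Y]] by blast
  next
    fix g assume g: "g \<in> ha_hom A (pro_lim Y)"
    \<comment> \<open>Each component collects all factorizations of the corresponding component of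
      g, so nothing is chosen; \<open>inj\<close> shows that it is a single class and
      \<open>surj\<close> that it is inhabited.\<close>
    define \<phi> where "\<phi> = (\<lambda>j\<in>Obj (idx Y). {(i, f). i \<in> Obj (idx X) \<and> f \<in> ha_hom (pob X i) (pob Y j) \<and>
      (\<forall>a\<in>carrier A. f (r a i) = g a j)})"
    have mem: "(i, f) \<in> \<phi> j \<longleftrightarrow> i \<in> Obj (idx X) \<and> f \<in> ha_hom (pob X i) (pob Y j) \<and> (\<forall>a\<in>carrier A. f (r a i) = g a j)"
      if "j \<in> Obj (idx Y)" for i f j using that by (simp add: \<phi>_def)
    have ex: "\<exists>i f. (i, f) \<in> \<phi> j" if j: "j \<in> Obj (idx Y)" for j
    proof -
      have "compose (carrier A) (\<lambda>y\<in>carrier (pro_lim Y). y j) g \<in> ha_hom A (pob Y j)"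
        by (rule ha_hom_compose[OF A g pro_lim_proj_hom[OF Y j]])
      from surj[OF pro_obj[OF Y j] this] show ?thesis
        unfolding mem[OF j] using ha_hom_closed[OF g] by (auto simp: compose_eq)
    qed
    have \<phi>: "\<phi> \<in> pro_hom X Y"
      unfolding pro_hom_def
    proof (intro CollectI conjI ballI)
      show "\<phi> \<in> (\<Pi>\<^sub>E j\<in>Obj (idx Y). pro_colim X (pob Y j))"
      proof (rule PiE_I)
        fix j assume j: "j \<in> Obj (idx Y)"
        obtain i f where f: "(i, f) \<in> \<phi> j" using ex[OF j] by blast
        note f' = f[unfolded mem[OF j]]
        have "\<phi> j = pro_rel X (pob Y j) `` {(i, f)}"
        proof (intro equalityI subsetI)
          fix z assume z: "z \<in> \<phi> j"
          obtain i' h where z': "z = (i', h)" by (cases z)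
          note h = z[unfolded z' mem[OF j]]
          have "((i, f), (i', h)) \<in> pro_rel X (pob Y j)" using inj[of i f "pob Y j" i' h] h f' by simp
          then show "z \<in> pro_rel X (pob Y j) `` {(i, f)}" unfolding z' by blast
        next
          fix z assume z: "z \<in> pro_rel X (pob Y j) `` {(i, f)}"
          obtain i' h where z': "z = (i', h)" by (cases z)
          have rel: "((i, f), (i', h)) \<in> pro_rel X (pob Y j)" using z unfolding z' by blast
          then have "i' \<in> Obj (idx X)" "h \<in> ha_hom (pob X i') (pob Y j)" unfolding pro_rel_iff[OF X] by blast+
          moreover have "h (r a i') = g a j" if "a \<in> carrier A" for a
            using pro_rel_eval[OF X rel rc[OF that]] f' that by simp
          ultimately show "z \<in> \<phi> j" unfolding z' mem[OF j] by blast
        qed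
        then show "\<phi> j \<in> pro_colim X (pob Y j)" using pro_classI(1)[OF X, of i f] f' by metis
      qed (simp add: \<phi>_def)
      fix j j' v z assume j: "j \<in> Obj (idx Y)" "j' \<in> Obj (idx Y)" and v: "v \<in> Arr (idx Y) j j'" and z: "z \<in> \<phi> j"
      obtain i f where z': "z = (i, f)" by (cases z)
      note f = z[unfolded z' mem[OF j(1)]]
      have "compose (carrier (pob X i)) (fmap (dia Y) j j' v) f (r a i) = g a j'" if "a \<in> carrier A" for a
        using f that pro_lim_nth[OF X rc[OF that]] pro_lim_compat[OF Y ha_hom_closed[OF g that] j v]
        by (simp add: compose_eq)
      moreover have "compose (carrier (pob X i)) (fmap (dia Y) j j' v) f \<in> ha_hom (pob X i) (pob Y j')"
        using ha_hom_compose[OF pro_obj(1)[OF X] _ pro_map[OF Y j v]] f by blast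
      ultimately show "case z of (i, f) \<Rightarrow> (i, compose (carrier (pob X i)) (fmap (dia Y) j j' v) f) \<in> \<phi> j'"
        unfolding z' prod.case mem[OF j(2)] using f by blast
    qed
    have "compose (carrier A) (pro_lim_map X Y \<phi>) r = g"
    proof (rule ha_hom_eqI[OF ha_hom_compose[OF A r pro_lim_map_hom[OF X Y \<phi>]] g])
      fix a assume a: "a \<in> carrier A"
      show "compose (carrier A) (pro_lim_map X Y \<phi>) r a = g a"
      proof (rule pro_lim_eqI[OF Y])
        show "compose (carrier A) (pro_lim_map X Y \<phi>) r a \<in> carrier (pro_lim Y)"
          by (rule ha_hom_closed[OF ha_hom_compose[OF A r pro_lim_map_hom[OF X Y \<phi>]] a])
        show "g a \<in> carrier (pro_lim Y)" by (rule ha_hom_closed[OF g a])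
        fix j assume j: "j \<in> Obj (idx Y)"
        obtain i f where f: "(i, f) \<in> \<phi> j" using ex[OF j] by blast
        show "compose (carrier A) (pro_lim_map X Y \<phi>) r a j = g a j"
          using ev[OF \<phi> a j f] f a unfolding mem[OF j] by simp
      qed
    qed
    then show "g \<in> (\<lambda>\<phi>. compose (carrier A) (pro_lim_map X Y \<phi>) r) ` pro_hom X Y" using \<phi> by blast
  qed
qed

section \<open>The diagram of finite up-sets\<close>

lemma inclusion_open:
  assumes "G \<in> upsets Y"
  shows "(\<lambda>x\<in>G. x) \<in> open_maps (Y\<lparr>carrier := G\<rparr>) Y"
proof (rule open_mapsI)
  show "\<exists>p'\<in>carrier (Y\<lparr>carrier := G\<rparr>). p \<sqsubseteq>\<^bsub>Y\<lparr>carrier := G\<rparr>\<^esub> p' \<and> (\<lambda>x\<in>G. x) p' = q"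
    if "p \<in> carrier (Y\<lparr>carrier := G\<rparr>)" "q \<in> carrier Y" "(\<lambda>x\<in>G. x) p \<sqsubseteq>\<^bsub>Y\<^esub> q" for p q
    using that upsets_upward[OF assms, of p q] by simp
qed (use upsets_subset[OF assms] in auto)

lemma restriction_hom:
  assumes Y: "partial_order Y" and G: "G \<in> upsets Y"
  shows "(\<lambda>V\<in>upsets Y. V \<inter> G) \<in> ha_hom (UU Y) (UU (Y\<lparr>carrier := G\<rparr>))"
proof -
  have "UU_map (Y\<lparr>carrier := G\<rparr>) Y (\<lambda>x\<in>G. x) = (\<lambda>V\<in>upsets Y. V \<inter> G)"
    by (auto simp: UU_map_def fun_eq_iff)
  then show ?thesis
    using UU_map_hom[OF partial_order_restrict[OF Y upsets_subset[OF G]] Y inclusion_open[OF G]] by simp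
qed

lemma U_pro_obj_simps [simp]:
  "Obj (idx (U_pro_obj X)) = fin_upsets X"
  "Arr (idx (U_pro_obj X)) F G = (if G \<subseteq> F then {()} else {})"
  "Cmp (idx (U_pro_obj X)) = (\<lambda>_ _ _ _ _. ())"
  "Ident (idx (U_pro_obj X)) = (\<lambda>_. ())"
  "pob (U_pro_obj X) F = UU (X\<lparr>carrier := F\<rparr>)"
  "fmap (dia (U_pro_obj X)) F G u = (\<lambda>V\<in>upsets (X\<lparr>carrier := F\<rparr>). V \<inter> G)"
  by (simp_all add: U_pro_obj_def)

lemma fin_upsetsD: "F \<in> fin_upsets X \<Longrightarrow> F \<in> upsets X" "F \<in> fin_upsets X \<Longrightarrow> finite F"
    "F \<in> fin_upsets X \<Longrightarrow> F \<subseteq> carrier X"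
  by (auto simp: fin_upsets_def upsets_def)

lemma fin_upsets_Un: "F \<in> fin_upsets X \<Longrightarrow> G \<in> fin_upsets X \<Longrightarrow> F \<union> G \<in> fin_upsets X"
  by (auto simp: fin_upsets_def upsets_def)

lemma fin_upsets_partial_order:
  "partial_order X \<Longrightarrow> F \<in> fin_upsets X \<Longrightarrow> partial_order (X\<lparr>carrier := F\<rparr>)"
  by (rule partial_order_restrict[OF _ fin_upsetsD(3)])

lemma upsets_restrict:
  assumes "V \<in> upsets X" "F \<subseteq> carrier X"
  shows "V \<inter> F \<in> upsets (X\<lparr>carrier := F\<rparr>)"
  using assms by (auto simp: upsets_def)

lemma upsets_restrict_restrict:
  assumes "V \<in> upsets (X\<lparr>carrier := F\<rparr>)" "G \<subseteq> F"
  shows "V \<inter> G \<in> upsets (X\<lparr>carrier := G\<rparr>)"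
  using assms by (auto simp: upsets_def)

text \<open>Indices are ordered by reverse inclusion: the empty up-set is an index, a union of two
  indices maps to both, and parallel arrows coincide.\<close>

lemma U_pro_obj_pro_object:
  assumes X: "partial_order X"
  shows "pro_object (U_pro_obj X)"
  unfolding pro_object_def
proof
  show "cofiltered (idx (U_pro_obj X))"
    unfolding cofiltered_def category_def
  proof (intro conjI)
    show "Obj (idx (U_pro_obj X)) \<noteq> {}"
      by (auto simp: fin_upsets_def upsets_def)
    show "\<forall>i\<in>Obj (idx (U_pro_obj X)). \<forall>j\<in>Obj (idx (U_pro_obj X)).
        \<exists>k\<in>Obj (idx (U_pro_obj X)). Arr (idx (U_pro_obj X)) k i \<noteq> {} \<and> Arr (idx (U_pro_obj X)) k j \<noteq> {}"
    proof (intro ballI)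
      fix F G assume "F \<in> Obj (idx (U_pro_obj X))" "G \<in> Obj (idx (U_pro_obj X))"
      then show "\<exists>k\<in>Obj (idx (U_pro_obj X)). Arr (idx (U_pro_obj X)) k F \<noteq> {} \<and> Arr (idx (U_pro_obj X)) k G \<noteq> {}"
        using fin_upsets_Un[of F X G] by (intro bexI[of _ "F \<union> G"]) simp_all
    qed
  qed (auto split: if_splits)
  show "is_functor (idx (U_pro_obj X)) HAf_cat (dia (U_pro_obj X))"
    unfolding is_functor_def
  proof (intro conjI ballI)
    fix F assume F: "F \<in> Obj (idx (U_pro_obj X))"
    then have F': "F \<in> fin_upsets X" by simp
    note po = fin_upsets_partial_order[OF X F']
    have "finite (upsets (X\<lparr>carrier := F\<rparr>))"
      by (rule finite_subset[of _ "Pow F"]) (use fin_upsetsD(2)[OF F'] in \<open>auto simp: upsets_def\<close>)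
    then show "pob (U_pro_obj X) F \<in> Obj HAf_cat"
      using UU_heyting[OF po] by (simp add: HAf_cat_def)
    have "V \<inter> F = V" if "V \<in> upsets (X\<lparr>carrier := F\<rparr>)" for V using upsets_subset[OF that] by auto
    then show "fmap (dia (U_pro_obj X)) F F (Ident (idx (U_pro_obj X)) F) = Ident HAf_cat (pob (U_pro_obj X) F)"
      by (simp add: HAf_cat_def fun_eq_iff)
    fix G u assume "G \<in> Obj (idx (U_pro_obj X))" "u \<in> Arr (idx (U_pro_obj X)) F G"
    then have G: "G \<in> fin_upsets X" "G \<subseteq> F" by (auto split: if_splits)
    have "G \<in> upsets (X\<lparr>carrier := F\<rparr>)" using fin_upsetsD[OF G(1)] fin_upsetsD(3)[OF F'] G(2) by (auto simp: upsets_def)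
    from restriction_hom[OF po this]
    show "fmap (dia (U_pro_obj X)) F G u \<in> Arr HAf_cat (pob (U_pro_obj X) F) (pob (U_pro_obj X) G)"
      by (simp add: HAf_cat_def)
    fix H v assume "H \<in> Obj (idx (U_pro_obj X))" "v \<in> Arr (idx (U_pro_obj X)) G H"
    then have H: "H \<subseteq> G" by (auto split: if_splits)
    have "V \<inter> H = V \<inter> G \<inter> H" for V using H by auto
    then show "fmap (dia (U_pro_obj X)) F H (Cmp (idx (U_pro_obj X)) F G H v u) =
        Cmp HAf_cat (pob (U_pro_obj X) F) (pob (U_pro_obj X) G) (pob (U_pro_obj X) H)
          (fmap (dia (U_pro_obj X)) G H v) (fmap (dia (U_pro_obj X)) F G u)"
      using upsets_restrict_restrict[OF _ G(2)] by (simp add: HAf_cat_def compose_def fun_eq_iff)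
  qed
qed

context
  fixes X :: "'x gorder" and Y :: "'y gorder" and f
  assumes X: "partial_order X" and Y: "partial_order Y" and f: "f \<in> open_maps X Y"
begin

lemma fin_upsets_image: "F \<in> fin_upsets X \<Longrightarrow> f ` F \<in> fin_upsets Y"
  using open_image_upset[OF f] by (simp add: fin_upsets_def)

lemma U_pro_map_repr:
  assumes F: "F \<in> fin_upsets X"
  shows "UU_map (X\<lparr>carrier := F\<rparr>) (Y\<lparr>carrier := f ` F\<rparr>) f \<in> ha_hom (UU (Y\<lparr>carrier := f ` F\<rparr>)) (UU (X\<lparr>carrier := F\<rparr>))"
proof -
  note FX = fin_upsetsD[OF F]
  have "restrict f F \<in> open_maps (X\<lparr>carrier := F\<rparr>) (Y\<lparr>carrier := f ` F\<rparr>)"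
  proof (rule open_mapsI)
    show "restrict f F p \<sqsubseteq>\<^bsub>Y\<lparr>carrier := f ` F\<rparr>\<^esub> restrict f F p'"
      if "p \<in> carrier (X\<lparr>carrier := F\<rparr>)" "p' \<in> carrier (X\<lparr>carrier := F\<rparr>)" "p \<sqsubseteq>\<^bsub>X\<lparr>carrier := F\<rparr>\<^esub> p'" for p p'
      using that open_mapsD(2)[OF f, of p p'] FX(3) by auto
    show "\<exists>p'\<in>carrier (X\<lparr>carrier := F\<rparr>). p \<sqsubseteq>\<^bsub>X\<lparr>carrier := F\<rparr>\<^esub> p' \<and> restrict f F p' = q"
      if p: "p \<in> carrier (X\<lparr>carrier := F\<rparr>)" and q: "q \<in> carrier (Y\<lparr>carrier := f ` F\<rparr>)"
        and le: "restrict f F p \<sqsubseteq>\<^bsub>Y\<lparr>carrier := f ` F\<rparr>\<^esub> q" for p q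
    proof -
      have pF: "p \<in> F" and pX: "p \<in> carrier X" using p FX(3) by auto
      have qY: "q \<in> carrier Y" using q FX(3) open_maps_closed[OF f] by auto
      have "f p \<sqsubseteq>\<^bsub>Y\<^esub> q" using le pF by simp
      then obtain p' where p': "p' \<in> carrier X" "p \<sqsubseteq>\<^bsub>X\<^esub> p'" "f p' = q"
        using open_mapsD(3)[OF f pX qY] by blast
      then have "p' \<in> F" using upsets_upward[OF FX(1) pF] by blast
      then show ?thesis using p' by (intro bexI[of _ p']) simp_all
    qed
  qed auto
  \<comment> \<open>Inverse images depend only on the values of f on F, so
    \<open>restrict f F\<close> can be replaced by f afterwards.\<close>
  from UU_map_hom[OF fin_upsets_partial_order[OF X F] fin_upsets_partial_order[OF Y fin_upsets_image[OF F]] this]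
  show ?thesis by (simp add: UU_map_def cong: conj_cong)
qed

lemma U_pro_map_mem:
  assumes F: "F \<in> fin_upsets X"
  shows "(f ` F, UU_map (X\<lparr>carrier := F\<rparr>) (Y\<lparr>carrier := f ` F\<rparr>) f) \<in> U_pro_map X Y f F"
  using pro_classI(2)[OF U_pro_obj_pro_object[OF Y], of "f ` F"] fin_upsets_image[OF F] U_pro_map_repr[OF F] F
  by (simp add: U_pro_map_def)

lemma U_pro_map_hom: "U_pro_map X Y f \<in> pro_hom (U_pro_obj Y) (U_pro_obj X)"
  unfolding pro_hom_def
proof (intro CollectI conjI ballI)
  note pY = U_pro_obj_pro_object[OF Y] and pX = U_pro_obj_pro_object[OF X]
  show "U_pro_map X Y f \<in> (\<Pi>\<^sub>E F\<in>Obj (idx (U_pro_obj X)). pro_colim (U_pro_obj Y) (pob (U_pro_obj X) F))"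
  proof (rule PiE_I)
    fix F assume "F \<in> Obj (idx (U_pro_obj X))"
    then have F: "F \<in> fin_upsets X" by simp
    show "U_pro_map X Y f F \<in> pro_colim (U_pro_obj Y) (pob (U_pro_obj X) F)"
      using pro_classI(1)[OF pY, of "f ` F"] fin_upsets_image[OF F] U_pro_map_repr[OF F] F
      by (simp add: U_pro_map_def)
  qed (simp add: U_pro_map_def)
  fix F G v z assume "F \<in> Obj (idx (U_pro_obj X))" "G \<in> Obj (idx (U_pro_obj X))"
    "v \<in> Arr (idx (U_pro_obj X)) F G" and z: "z \<in> U_pro_map X Y f F"
  then have F: "F \<in> fin_upsets X" and G: "G \<in> fin_upsets X" "G \<subseteq> F" and v: "v \<in> Arr (idx (U_pro_obj X)) F G"
    by (auto split: if_splits)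
  obtain H e where z': "z = (H, e)" by (cases z)
  let ?f = "\<lambda>F. UU_map (X\<lparr>carrier := F\<rparr>) (Y\<lparr>carrier := f ` F\<rparr>) f"
  let ?r = "fmap (dia (U_pro_obj X)) F G v"
  have "((f ` F, ?f F), (H, e)) \<in> pro_rel (U_pro_obj Y) (pob (U_pro_obj X) F)"
    using z F unfolding z' by (simp add: U_pro_map_def)
  from pro_rel_compose[OF pY this pro_map[OF pX _ _ v]] F G
  have 1: "((f ` F, compose (carrier (pob (U_pro_obj Y) (f ` F))) ?r (?f F)),
      (H, compose (carrier (pob (U_pro_obj Y) H)) ?r e)) \<in> pro_rel (U_pro_obj Y) (pob (U_pro_obj X) G)" by simp
  \<comment> \<open>Taking the inverse image on F and then cutting down to G agrees with first
    cutting down to the image of G and then taking the inverse image on G.\<close>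
  have e: "compose (carrier (pob (U_pro_obj Y) (f ` F))) ?r (?f F) =
      compose (carrier (pob (U_pro_obj Y) (f ` F))) (?f G) (fmap (dia (U_pro_obj Y)) (f ` F) (f ` G) ())"
  proof (rule compose_cong_on)
    fix V assume "V \<in> carrier (pob (U_pro_obj Y) (f ` F))"
    then have V: "V \<in> upsets (Y\<lparr>carrier := f ` F\<rparr>)" by simp
    have 1: "?f F V \<in> upsets (X\<lparr>carrier := F\<rparr>)" using hom_UU_upsets[OF U_pro_map_repr[OF F]] V by simp
    have 2: "V \<inter> f ` G \<in> upsets (Y\<lparr>carrier := f ` G\<rparr>)"
      by (rule upsets_restrict_restrict[OF V image_mono[OF G(2)]])
    show "?r (?f F V) = ?f G (fmap (dia (U_pro_obj Y)) (f ` F) (f ` G) () V)"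
      using V 1 2 G(2) by (auto simp: UU_map_apply)
  qed
  have 2: "((f ` F, compose (carrier (pob (U_pro_obj Y) (f ` F))) ?r (?f F)), (f ` G, ?f G)) \<in>
      pro_rel (U_pro_obj Y) (pob (U_pro_obj X) G)"
    unfolding e by (rule pro_rel_transition[OF pY])
      (use fin_upsets_image[OF F] fin_upsets_image[OF G(1)] U_pro_map_repr[OF G(1)] image_mono[OF G(2)] in simp_all)
  have "((f ` G, ?f G), (H, compose (carrier (pob (U_pro_obj Y) H)) ?r e)) \<in> pro_rel (U_pro_obj Y) (pob (U_pro_obj X) G)"
    by (rule pro_rel_trans[OF pY pro_rel_sym[OF pY 2] 1])
  then show "case z of (i, fa) \<Rightarrow> (i, compose (carrier (pob (U_pro_obj Y) i)) ?r fa) \<in> U_pro_map X Y f G"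
    unfolding z' using G(1) by (simp add: U_pro_map_def)
qed

end

lemma U_pro_map_id:
  assumes X: "partial_order X"
  shows "U_pro_map X X (\<lambda>x\<in>carrier X. x) = pro_id (U_pro_obj X)"
proof (rule pro_hom_eqI[OF _ _ U_pro_map_hom[OF X X open_maps_id[OF X]] pro_id_hom])
  fix F assume "F \<in> Obj (idx (U_pro_obj X))"
  then have F: "F \<in> fin_upsets X" by simp
  note FX = fin_upsetsD(3)[OF F]
  have im: "(\<lambda>x\<in>carrier X. x) ` F = F" using FX by force
  have e: "UU_map (X\<lparr>carrier := F\<rparr>) (X\<lparr>carrier := F\<rparr>) (\<lambda>x\<in>carrier X. x) = (\<lambda>V\<in>upsets (X\<lparr>carrier := F\<rparr>). V)"
    using FX by (auto simp: UU_map_def fun_eq_iff upsets_def)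
  show "\<exists>z. z \<in> U_pro_map X X (\<lambda>x\<in>carrier X. x) F \<and> z \<in> pro_id (U_pro_obj X) F"
    using U_pro_map_mem[OF X X open_maps_id[OF X] F] pro_id_mem[OF U_pro_obj_pro_object[OF X], of F] F
    unfolding im e by auto
qed (use U_pro_obj_pro_object[OF X] in simp_all)

lemma U_pro_map_compose:
  assumes X: "partial_order X" and Y: "partial_order Y" and Z: "partial_order Z"
    and f: "f \<in> open_maps X Y" and g: "g \<in> open_maps Y Z"
  shows "U_pro_map X Z (compose (carrier X) g f) =
    pro_comp (U_pro_obj Z) (U_pro_obj Y) (U_pro_obj X) (U_pro_map X Y f) (U_pro_map Y Z g)"
proof -
  note p = X[THEN U_pro_obj_pro_object] Y[THEN U_pro_obj_pro_object] Z[THEN U_pro_obj_pro_object]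
  note h = U_pro_map_hom[OF X Y f] U_pro_map_hom[OF Y Z g]
  note gf = open_maps_compose[OF f g]
  show ?thesis
  proof (rule pro_hom_eqI[OF p(3,1) U_pro_map_hom[OF X Z gf] pro_comp_hom[OF p(3,2,1) h(2,1)]])
    fix F assume "F \<in> Obj (idx (U_pro_obj X))"
    then have F: "F \<in> fin_upsets X" by simp
    note fF = fin_upsets_image[OF X Y f F]
    note FX = fin_upsetsD(3)[OF F]
    have im: "compose (carrier X) g f ` F = g ` f ` F" using FX by (force simp: compose_def)
    have e: "compose (carrier (pob (U_pro_obj Z) (g ` f ` F))) (UU_map (X\<lparr>carrier := F\<rparr>) (Y\<lparr>carrier := f ` F\<rparr>) f)
        (UU_map (Y\<lparr>carrier := f ` F\<rparr>) (Z\<lparr>carrier := g ` f ` F\<rparr>) g) =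
      UU_map (X\<lparr>carrier := F\<rparr>) (Z\<lparr>carrier := g ` f ` F\<rparr>) (compose (carrier X) g f)" (is "?l = ?r")
    proof (rule extensionalityI[of _ "upsets (Z\<lparr>carrier := g ` f ` F\<rparr>)"])
      fix V assume V: "V \<in> upsets (Z\<lparr>carrier := g ` f ` F\<rparr>)"
      have "UU_map (Y\<lparr>carrier := f ` F\<rparr>) (Z\<lparr>carrier := g ` f ` F\<rparr>) g V \<in> upsets (Y\<lparr>carrier := f ` F\<rparr>)"
        using hom_UU_upsets[OF U_pro_map_repr[OF Y Z g fF]] V by simp
      then show "?l V = ?r V"
        using V FX by (auto simp: compose_def UU_map_apply)
    qed (simp_all add: compose_def UU_map_def)
    have "(g ` f ` F, ?l) \<in> pro_comp (U_pro_obj Z) (U_pro_obj Y) (U_pro_obj X) (U_pro_map X Y f) (U_pro_map Y Z g) F"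
      by (rule pro_comp_mem(3)[OF p(3,2,1) h(2,1) _ U_pro_map_mem[OF X Y f F] U_pro_map_mem[OF Y Z g fF]])
        (use F in simp)
    moreover have "(g ` f ` F, ?r) \<in> U_pro_map X Z (compose (carrier X) g f) F"
      using U_pro_map_mem[OF X Z gf F] unfolding im .
    ultimately show "\<exists>z. z \<in> U_pro_map X Z (compose (carrier X) g f) F \<and>
        z \<in> pro_comp (U_pro_obj Z) (U_pro_obj Y) (U_pro_obj X) (U_pro_map X Y f) (U_pro_map Y Z g) F"
      unfolding e by blast
  qed
qed


section \<open>Profinite completion\<close>

context
  fixes A :: "'a gorder" and X :: "'x gorder" and \<epsilon>
  assumes sp: "is_spectrum A X \<epsilon>"
begin

abbreviation (input) completion_map :: "'a \<Rightarrow> 'x set \<Rightarrow> 'x set" where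
  "completion_map \<equiv> compose (carrier A) (U_pro_lim_iso X) \<epsilon>"

lemma completion_map_apply:
  "a \<in> carrier A \<Longrightarrow> completion_map a = (\<lambda>F\<in>fin_upsets X. \<epsilon> a \<inter> F)"
  using hom_UU_upsets[OF spectrumD(4)[OF sp]] by (simp add: compose_eq U_pro_lim_iso_def)

lemma spectrum_restriction_hom:
  assumes F: "F \<in> fin_upsets X"
  shows "(\<lambda>a\<in>carrier A. \<epsilon> a \<inter> F) \<in> ha_hom A (UU (X\<lparr>carrier := F\<rparr>))"
proof -
  have "compose (carrier A) (\<lambda>V\<in>upsets X. V \<inter> F) \<epsilon> = (\<lambda>a\<in>carrier A. \<epsilon> a \<inter> F)"
    using hom_UU_upsets[OF spectrumD(4)[OF sp]] by (simp add: compose_def fun_eq_iff)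
  then show ?thesis
    using ha_hom_compose[OF spectrumD(1,4)[OF sp] restriction_hom[OF spectrumD(2)[OF sp] fin_upsetsD(1)[OF F]]]
    by simp
qed

lemma completion_map_hom: "completion_map \<in> ha_hom A (pro_lim (U_pro_obj X))"
proof (rule pro_lim_homI[OF U_pro_obj_pro_object[OF spectrumD(2)[OF sp]] spectrumD(1)[OF sp]])
  note pX = U_pro_obj_pro_object[OF spectrumD(2)[OF sp]]
  show "completion_map \<in> carrier A \<rightarrow>\<^sub>E carrier (pro_lim (U_pro_obj X))"
  proof (rule PiE_I)
    fix a assume a: "a \<in> carrier A"
    note up = hom_UU_upsets[OF spectrumD(4)[OF sp] a]
    have "(\<lambda>F\<in>Obj (idx (U_pro_obj X)). \<epsilon> a \<inter> F) \<in> carrier (pro_lim (U_pro_obj X))"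
    proof (rule pro_lim_restrictI[OF pX])
      fix F assume "F \<in> Obj (idx (U_pro_obj X))"
      then have FX: "F \<subseteq> carrier X" using fin_upsetsD(3) by simp
      show "\<epsilon> a \<inter> F \<in> carrier (pob (U_pro_obj X) F)" using upsets_restrict[OF up FX] by simp
      fix G u assume "u \<in> Arr (idx (U_pro_obj X)) F G"
      then have "G \<subseteq> F" by (auto split: if_splits)
      then show "fmap (dia (U_pro_obj X)) F G u (\<epsilon> a \<inter> F) = \<epsilon> a \<inter> G"
        using upsets_restrict[OF up FX] by auto
    qed
    then show "completion_map a \<in> carrier (pro_lim (U_pro_obj X))" using completion_map_apply[OF a] by simp
  qed (simp add: compose_def)
  fix F assume "F \<in> Obj (idx (U_pro_obj X))"
  then have F: "F \<in> fin_upsets X" by simp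
  have "(\<lambda>a\<in>carrier A. completion_map a F) = (\<lambda>a\<in>carrier A. \<epsilon> a \<inter> F)"
    using F completion_map_apply by (simp add: fun_eq_iff)
  then show "(\<lambda>a\<in>carrier A. completion_map a F) \<in> ha_hom A (pob (U_pro_obj X) F)"
    using spectrum_restriction_hom[OF F] by simp
qed

text \<open>The common index is the union of F and G. Every up-set of that union is the trace of
  some \<open>\<epsilon> a\<close>, so agreement on A is agreement there.\<close>

lemma completion_separates:
  assumes F: "F \<in> fin_upsets X" and f: "f \<in> ha_hom (UU (X\<lparr>carrier := F\<rparr>)) B"
    and G: "G \<in> fin_upsets X" and g: "g \<in> ha_hom (UU (X\<lparr>carrier := G\<rparr>)) B"
    and eq: "\<And>a. a \<in> carrier A \<Longrightarrow> f (\<epsilon> a \<inter> F) = g (\<epsilon> a \<inter> G)"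
  shows "((F, f), (G, g)) \<in> pro_rel (U_pro_obj X) B"
  unfolding pro_rel_iff[OF U_pro_obj_pro_object[OF spectrumD(2)[OF sp]]]
proof (intro conjI bexI ballI)
  fix V assume "V \<in> carrier (pob (U_pro_obj X) (F \<union> G))"
  then have V: "V \<in> upsets (X\<lparr>carrier := F \<union> G\<rparr>)" by simp
  obtain a where a: "a \<in> carrier A" "\<epsilon> a \<inter> (F \<union> G) = V"
    using spectrum_restriction_surj[OF sp fin_upsets_Un[OF F G] V] by blast
  have "V \<inter> F = \<epsilon> a \<inter> F" "V \<inter> G = \<epsilon> a \<inter> G" using a(2) by blast+
  then show "f (fmap (dia (U_pro_obj X)) (F \<union> G) F () V) = g (fmap (dia (U_pro_obj X)) (F \<union> G) G () V)"
    using V eq[OF a(1)] by simp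
qed (use F G f g fin_upsets_Un[OF F G] in simp_all)

text \<open>After B is embedded into the up-sets of a finite P, the homomorphism corresponds to an
  open map from P to X. Its image is the required F; g then descends along the surjection from A
  onto the up-sets of F.\<close>

lemma completion_factors:
  fixes B :: "'k gorder"
  assumes B: "heyting_algebra B" "finite (carrier B)" and g: "g \<in> ha_hom A B"
  shows "\<exists>F\<in>fin_upsets X. \<exists>f\<in>ha_hom (UU (X\<lparr>carrier := F\<rparr>)) B. \<forall>a\<in>carrier A. f (\<epsilon> a \<inter> F) = g a"
proof -
  note S = spectrumD[OF sp]
  obtain P :: "'k gorder" and j where P: "partial_order P" "finite (carrier P)"
    and j: "j \<in> ha_hom B (UU P)" "inj_on j (carrier B)"
    using finite_heyting_embedding[OF B] .
  have "image_finite P" using P(2) by (simp add: image_finite_def)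
  from bij_betw_imp_surj_on[OF spectrum_universal[OF sp P(1) this]] ha_hom_compose[OF S(1) g j(1)]
  have "compose (carrier A) j g \<in> (\<lambda>f. compose (carrier A) (UU_map P X f) \<epsilon>) ` open_maps P X" by simp
  then obtain k where k: "k \<in> open_maps P X" and jg: "compose (carrier A) j g = compose (carrier A) (UU_map P X k) \<epsilon>"
    by (rule imageE)
  define F where "F = k ` carrier P"
  have F: "F \<in> fin_upsets X"
    using open_image_upset[OF k carrier_upset] P(2) by (simp add: F_def fin_upsets_def)
  have j_g: "j (g a) = {p \<in> carrier P. k p \<in> \<epsilon> a \<inter> F}" if a: "a \<in> carrier A" for a
  proof -
    have "j (g a) = UU_map P X k (\<epsilon> a)" using fun_cong[OF jg, of a] a by (simp add: compose_eq)
    then show ?thesis by (auto simp: UU_map_apply[OF hom_UU_upsets[OF S(4) a]] F_def)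
  qed
  \<comment> \<open>By \<open>j_g\<close>, the trace on F determines \<open>j (g a)\<close>, and j
    is injective.\<close>
  have wd: "g a = g b" if "a \<in> carrier A" "b \<in> carrier A" "\<epsilon> a \<inter> F = \<epsilon> b \<inter> F" for a b
    by (rule inj_onD[OF j(2)]) (use that j_g[OF that(1)] j_g[OF that(2)] ha_hom_closed[OF g] in simp_all)
  \<comment> \<open>Any element with the prescribed trace may be chosen, by \<open>wd\<close>;
    surjectivity of the restriction provides one.\<close>
  define f where "f = (\<lambda>V\<in>upsets (X\<lparr>carrier := F\<rparr>). g (SOME a. a \<in> carrier A \<and> \<epsilon> a \<inter> F = V))"
  have fg: "f (\<epsilon> a \<inter> F) = g a" if a: "a \<in> carrier A" for a
  proof -
    have "(SOME b. b \<in> carrier A \<and> \<epsilon> b \<inter> F = \<epsilon> a \<inter> F) \<in> carrier A \<and>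
        \<epsilon> (SOME b. b \<in> carrier A \<and> \<epsilon> b \<inter> F = \<epsilon> a \<inter> F) \<inter> F = \<epsilon> a \<inter> F"
      by (rule someI[of _ a]) (use a in simp)
    then have "g (SOME b. b \<in> carrier A \<and> \<epsilon> b \<inter> F = \<epsilon> a \<inter> F) = g a" using wd a by blast
    then show ?thesis
      using upsets_restrict[OF hom_UU_upsets[OF S(4) a] fin_upsetsD(3)[OF F]] by (simp add: f_def)
  qed
  have "f \<in> ha_hom (UU (X\<lparr>carrier := F\<rparr>)) B"
  proof (rule ha_hom_cancel_surj[OF S(1) spectrum_restriction_hom[OF F]])
    show "(\<lambda>a\<in>carrier A. \<epsilon> a \<inter> F) ` carrier A = carrier (UU (X\<lparr>carrier := F\<rparr>))"
      using spectrum_restriction_surj[OF sp F] ha_hom_closed[OF spectrum_restriction_hom[OF F]] by (auto simp: image_iff)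
    have "compose (carrier A) f (\<lambda>a\<in>carrier A. \<epsilon> a \<inter> F) = g"
      by (rule extensionalityI[of _ "carrier A"]) (use ha_homD(1)[OF g] fg in \<open>auto simp: compose_eq PiE_def\<close>)
    then show "compose (carrier A) f (\<lambda>a\<in>carrier A. \<epsilon> a \<inter> F) \<in> ha_hom A B" using g by simp
  qed (simp add: f_def)
  then show ?thesis using F fg by blast
qed

lemma completion_universal:
  fixes Y :: "('j, 'n, 'k) pro"
  assumes Y: "pro_object Y"
  shows "bij_betw (\<lambda>\<phi>. compose (carrier A) (pro_lim_map (U_pro_obj X) Y \<phi>) completion_map)
    (pro_hom (U_pro_obj X) Y) (ha_hom A (pro_lim Y))"
proof (rule pro_universal[OF U_pro_obj_pro_object[OF spectrumD(2)[OF sp]] Y spectrumD(1)[OF sp] completion_map_hom])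
  fix B :: "'k gorder" and F f G g
  assume "F \<in> Obj (idx (U_pro_obj X))" "f \<in> ha_hom (pob (U_pro_obj X) F) B"
    "G \<in> Obj (idx (U_pro_obj X))" "g \<in> ha_hom (pob (U_pro_obj X) G) B"
    and eq: "\<And>a. a \<in> carrier A \<Longrightarrow> f (completion_map a F) = g (completion_map a G)"
  then have *: "F \<in> fin_upsets X" "f \<in> ha_hom (UU (X\<lparr>carrier := F\<rparr>)) B"
    "G \<in> fin_upsets X" "g \<in> ha_hom (UU (X\<lparr>carrier := G\<rparr>)) B" by simp_all
  show "((F, f), (G, g)) \<in> pro_rel (U_pro_obj X) B"
    by (rule completion_separates[OF *]) (use eq completion_map_apply *(1,3) in simp)
next
  fix B :: "'k gorder" and g assume B: "heyting_algebra B" "finite (carrier B)" and g: "g \<in> ha_hom A B"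
  obtain F f where F: "F \<in> fin_upsets X" "f \<in> ha_hom (UU (X\<lparr>carrier := F\<rparr>)) B" "\<forall>a\<in>carrier A. f (\<epsilon> a \<inter> F) = g a"
    using completion_factors[OF B g] by blast
  show "\<exists>i\<in>Obj (idx (U_pro_obj X)). \<exists>f\<in>ha_hom (pob (U_pro_obj X) i) B. \<forall>a\<in>carrier A. f (completion_map a i) = g a"
    by (intro bexI[of _ F] bexI[of _ f] ballI) (use F completion_map_apply in simp_all)
qed

end

text \<open>The component at F is evaluated on the canonical representative, indexed by the image of
  F under f, where the claim is the hypothesis \<open>nat\<close> cut down to F.\<close>

lemma completion_natural:
  assumes A: "is_spectrum A X \<epsilon>" and B: "is_spectrum B Y \<delta>" and h: "h \<in> ha_hom A B" and f: "f \<in> open_maps Y X"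
    and nat: "compose (carrier A) \<delta> h = compose (carrier A) (UU_map Y X f) \<epsilon>"
  shows "compose (carrier A) (compose (carrier B) (U_pro_lim_iso Y) \<delta>) h =
    compose (carrier A) (pro_lim_map (U_pro_obj X) (U_pro_obj Y) (U_pro_map Y X f)) (compose (carrier A) (U_pro_lim_iso X) \<epsilon>)"
proof (rule compose_cong_on)
  fix a assume a: "a \<in> carrier A"
  note SA = spectrumD[OF A] and SB = spectrumD[OF B]
  note p = U_pro_obj_pro_object[OF SA(2)] U_pro_obj_pro_object[OF SB(2)]
  note \<phi> = U_pro_map_hom[OF SB(2) SA(2) f]
  have ha: "h a \<in> carrier B" by (rule ha_hom_closed[OF h a])
  note ca = ha_hom_closed[OF completion_map_hom[OF A] a] ha_hom_closed[OF completion_map_hom[OF B] ha]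
  show "compose (carrier B) (U_pro_lim_iso Y) \<delta> (h a) =
    pro_lim_map (U_pro_obj X) (U_pro_obj Y) (U_pro_map Y X f) (compose (carrier A) (U_pro_lim_iso X) \<epsilon> a)"
  proof (rule pro_lim_eqI[OF p(2) ca(2) pro_lim_map_closed[OF p \<phi> ca(1)]])
    fix F assume F': "F \<in> Obj (idx (U_pro_obj Y))"
    then have F: "F \<in> fin_upsets Y" by simp
    note fF = fin_upsets_image[OF SB(2) SA(2) f F]
    note up = hom_UU_upsets[OF SA(4) a]
    note FY = fin_upsetsD(3)[OF F]
    have "\<delta> (h a) = UU_map Y X f (\<epsilon> a)" using fun_cong[OF nat, of a] a by (simp add: compose_eq)
    then have "\<delta> (h a) \<inter> F = {x \<in> F. f x \<in> \<epsilon> a \<inter> f ` F}"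
      using FY by (auto simp: UU_map_apply[OF up])
    also have "\<dots> = UU_map (Y\<lparr>carrier := F\<rparr>) (X\<lparr>carrier := f ` F\<rparr>) f (\<epsilon> a \<inter> f ` F)"
      unfolding UU_map_apply[OF upsets_restrict[OF up fin_upsetsD(3)[OF fF]]] by simp
    finally show "compose (carrier B) (U_pro_lim_iso Y) \<delta> (h a) F =
        pro_lim_map (U_pro_obj X) (U_pro_obj Y) (U_pro_map Y X f) (compose (carrier A) (U_pro_lim_iso X) \<epsilon> a) F"
      unfolding pro_lim_map_eval[OF p \<phi> ca(1) F' U_pro_map_mem[OF SB(2) SA(2) f F]]
      unfolding completion_map_apply[OF A a] completion_map_apply[OF B ha] using F fF by simp
  qed
qed

section \<open>Uniqueness of the completion\<close>

lemma pro_lim_map_comp_hom: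
  assumes "pro_object X" "pro_object Y" "pro_object Z" "\<phi> \<in> pro_hom X Y" "\<psi> \<in> pro_hom Y Z"
    and r: "r \<in> ha_hom A (pro_lim X)"
  shows "compose (carrier A) (pro_lim_map X Z (pro_comp X Y Z \<psi> \<phi>)) r =
    compose (carrier A) (pro_lim_map Y Z \<psi>) (compose (carrier A) (pro_lim_map X Y \<phi>) r)"
  unfolding pro_lim_map_comp[OF assms(1-5)] using ha_hom_closed[OF r] by (simp add: compose_def fun_eq_iff)

lemma pro_lim_map_id_hom:
  assumes X: "pro_object X" and r: "r \<in> ha_hom A (pro_lim X)"
  shows "compose (carrier A) (pro_lim_map X X (pro_id X)) r = r"
  unfolding pro_lim_map_id[OF X]
  by (rule extensionalityI[of _ "carrier A"])
    (use ha_hom_closed[OF r] ha_homD(1)[OF r] in \<open>auto simp: compose_eq PiE_def\<close>)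

text \<open>Uniqueness of left adjoints, across two universes. Each functor is tested on objects of
  both types: the comparison tests L on values of M, its inverse tests M on values of L, and the
  identities for the two composites test each functor on its own values.\<close>

lemma pro_completion_unique:
  fixes L :: "('a gorder, 'a \<Rightarrow> 'a, ('i, 'm, 'h) pro, 'i \<Rightarrow> ('i \<times> ('h \<Rightarrow> 'h)) set) functr"
    and M :: "('a gorder, 'a \<Rightarrow> 'a, ('j, 'n, 'k) pro, 'j \<Rightarrow> ('j \<times> ('k \<Rightarrow> 'k)) set) functr"
  assumes L1: "profinite_completion L \<eta> TYPE(('i, 'm, 'h) pro)" and L2: "profinite_completion L \<eta> TYPE(('j, 'n, 'k) pro)"
    and M1: "profinite_completion M \<zeta> TYPE(('i, 'm, 'h) pro)" and M2: "profinite_completion M \<zeta> TYPE(('j, 'n, 'k) pro)"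
  obtains \<theta> where "pro_nat_iso L M \<theta>"
    "\<And>A. A \<in> Obj HA_cat \<Longrightarrow> compose (carrier A) (pro_lim_map (fobj L A) (fobj M A) (\<theta> A)) (\<eta> A) = \<zeta> A"
proof -
  have LO: "pro_object (fobj L A)" and MO: "pro_object (fobj M A)" if "A \<in> Obj HA_cat" for A
    using L1 M1 that by (simp_all add: profinite_completion_def is_functor_def)
  have LA: "fmap L A B h \<in> pro_hom (fobj L A) (fobj L B)" and MA: "fmap M A B h \<in> pro_hom (fobj M A) (fobj M B)"
    if "A \<in> Obj HA_cat" "B \<in> Obj HA_cat" "h \<in> ha_hom A B" for A B h
    using L1 M1 that by (simp_all add: profinite_completion_def is_functor_def)
  have \<eta>: "\<eta> A \<in> ha_hom A (pro_lim (fobj L A))" and \<zeta>: "\<zeta> A \<in> ha_hom A (pro_lim (fobj M A))"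
    if "A \<in> Obj HA_cat" for A
    using L1 M1 that by (simp_all add: profinite_completion_def)
  have \<eta>n: "compose (carrier A) (\<eta> B) h = compose (carrier A) (pro_lim_map (fobj L A) (fobj L B) (fmap L A B h)) (\<eta> A)"
    and \<zeta>n: "compose (carrier A) (\<zeta> B) h = compose (carrier A) (pro_lim_map (fobj M A) (fobj M B) (fmap M A B h)) (\<zeta> A)"
    if "A \<in> Obj HA_cat" "B \<in> Obj HA_cat" "h \<in> ha_hom A B" for A B h
    using L1 M1 that by (simp_all add: profinite_completion_def)
  have univ_L_L: "bij_betw (\<lambda>\<phi>. compose (carrier A) (pro_lim_map (fobj L A) Y \<phi>) (\<eta> A)) (pro_hom (fobj L A) Y) (ha_hom A (pro_lim Y))"
    and univ_M_L: "bij_betw (\<lambda>\<phi>. compose (carrier A) (pro_lim_map (fobj M A) Y \<phi>) (\<zeta> A)) (pro_hom (fobj M A) Y) (ha_hom A (pro_lim Y))"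
    if "A \<in> Obj HA_cat" "pro_object Y" for A and Y :: "('i, 'm, 'h) pro"
    using L1 M1 that by (simp_all add: profinite_completion_def)
  have univ_L_M: "bij_betw (\<lambda>\<phi>. compose (carrier A) (pro_lim_map (fobj L A) Y \<phi>) (\<eta> A)) (pro_hom (fobj L A) Y) (ha_hom A (pro_lim Y))"
    and univ_M_M: "bij_betw (\<lambda>\<phi>. compose (carrier A) (pro_lim_map (fobj M A) Y \<phi>) (\<zeta> A)) (pro_hom (fobj M A) Y) (ha_hom A (pro_lim Y))"
    if "A \<in> Obj HA_cat" "pro_object Y" for A and Y :: "('j, 'n, 'k) pro"
    using L2 M2 that by (simp_all add: profinite_completion_def)
  have "\<exists>\<theta>\<in>pro_hom (fobj L A) (fobj M A). compose (carrier A) (pro_lim_map (fobj L A) (fobj M A) \<theta>) (\<eta> A) = \<zeta> A"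
    if A: "A \<in> Obj HA_cat" for A
    using bij_betw_imp_surj_on[OF univ_L_M[OF A MO[OF A]]] \<zeta>[OF A] by (metis (no_types, lifting) imageE)
  then obtain \<theta> where \<theta>: "\<And>A. A \<in> Obj HA_cat \<Longrightarrow> \<theta> A \<in> pro_hom (fobj L A) (fobj M A)"
    and \<theta>\<eta>: "\<And>A. A \<in> Obj HA_cat \<Longrightarrow> compose (carrier A) (pro_lim_map (fobj L A) (fobj M A) (\<theta> A)) (\<eta> A) = \<zeta> A"
    by metis
  \<comment> \<open>Each composite agrees with the identity after the unit, hence equals it by the
    injective part of the universal property.\<close>
  have iso: "pro_iso (fobj L A) (fobj M A) (\<theta> A)" if A: "A \<in> Obj HA_cat" for A
  proof -
    note O = LO[OF A] MO[OF A]
    have "\<eta> A \<in> (\<lambda>\<phi>. compose (carrier A) (pro_lim_map (fobj M A) (fobj L A) \<phi>) (\<zeta> A)) ` pro_hom (fobj M A) (fobj L A)"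
      using bij_betw_imp_surj_on[OF univ_M_L[OF A O(1)]] \<eta>[OF A] by simp
    then obtain \<psi> where \<psi>: "\<psi> \<in> pro_hom (fobj M A) (fobj L A)"
      and \<psi>\<zeta>: "\<eta> A = compose (carrier A) (pro_lim_map (fobj M A) (fobj L A) \<psi>) (\<zeta> A)" by (rule imageE)
    have "pro_comp (fobj L A) (fobj M A) (fobj L A) \<psi> (\<theta> A) = pro_id (fobj L A)"
    proof (rule inj_onD[OF bij_betw_imp_inj_on[OF univ_L_L[OF A O(1)]]])
      show "compose (carrier A) (pro_lim_map (fobj L A) (fobj L A) (pro_comp (fobj L A) (fobj M A) (fobj L A) \<psi> (\<theta> A))) (\<eta> A) =
          compose (carrier A) (pro_lim_map (fobj L A) (fobj L A) (pro_id (fobj L A))) (\<eta> A)"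
        unfolding pro_lim_map_comp_hom[OF O(1,2,1) \<theta>[OF A] \<psi> \<eta>[OF A]] \<theta>\<eta>[OF A] pro_lim_map_id_hom[OF O(1) \<eta>[OF A]] by (rule \<psi>\<zeta>[symmetric])
    qed (use pro_comp_hom[OF O(1,2,1) \<theta>[OF A] \<psi>] pro_id_hom[OF O(1)] in simp_all)
    moreover have "pro_comp (fobj M A) (fobj L A) (fobj M A) (\<theta> A) \<psi> = pro_id (fobj M A)"
    proof (rule inj_onD[OF bij_betw_imp_inj_on[OF univ_M_M[OF A O(2)]]])
      show "compose (carrier A) (pro_lim_map (fobj M A) (fobj M A) (pro_comp (fobj M A) (fobj L A) (fobj M A) (\<theta> A) \<psi>)) (\<zeta> A) =
          compose (carrier A) (pro_lim_map (fobj M A) (fobj M A) (pro_id (fobj M A))) (\<zeta> A)"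
        unfolding pro_lim_map_comp_hom[OF O(2,1,2) \<psi> \<theta>[OF A] \<zeta>[OF A]] \<psi>\<zeta>[symmetric] \<theta>\<eta>[OF A] pro_lim_map_id_hom[OF O(2) \<zeta>[OF A]] ..
    qed (use pro_comp_hom[OF O(2,1,2) \<psi> \<theta>[OF A]] pro_id_hom[OF O(2)] in simp_all)
    ultimately show ?thesis unfolding pro_iso_def using \<theta>[OF A] \<psi> by blast
  qed
  \<comment> \<open>Both composites extend \<zeta> at B after h along \<eta> at A, so they coincide
    by the universal property of L.\<close>
  have nat: "pro_comp (fobj L A) (fobj L B) (fobj M B) (\<theta> B) (fmap L A B h) =
      pro_comp (fobj L A) (fobj M A) (fobj M B) (fmap M A B h) (\<theta> A)"
    if AB: "A \<in> Obj HA_cat" "B \<in> Obj HA_cat" "h \<in> ha_hom A B" for A B h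
  proof (rule inj_onD[OF bij_betw_imp_inj_on[OF univ_L_M[OF AB(1) MO[OF AB(2)]]]])
    note l = LA[OF AB] and m = MA[OF AB]
    note O = LO[OF AB(1)] LO[OF AB(2)] MO[OF AB(1)] MO[OF AB(2)]
    have "compose (carrier A) (pro_lim_map (fobj L B) (fobj M B) (\<theta> B)) (compose (carrier A) (\<eta> B) h) =
        compose (carrier A) (compose (carrier B) (pro_lim_map (fobj L B) (fobj M B) (\<theta> B)) (\<eta> B)) h"
      using ha_hom_closed[OF AB(3)] by (simp add: compose_def fun_eq_iff)
    then show "compose (carrier A) (pro_lim_map (fobj L A) (fobj M B)
          (pro_comp (fobj L A) (fobj L B) (fobj M B) (\<theta> B) (fmap L A B h))) (\<eta> A) =
        compose (carrier A) (pro_lim_map (fobj L A) (fobj M B)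
          (pro_comp (fobj L A) (fobj M A) (fobj M B) (fmap M A B h) (\<theta> A))) (\<eta> A)"
      unfolding pro_lim_map_comp_hom[OF O(1,2,4) l \<theta>[OF AB(2)] \<eta>[OF AB(1)]] pro_lim_map_comp_hom[OF O(1,3,4) \<theta>[OF AB(1)] m \<eta>[OF AB(1)]]
        \<theta>\<eta>[OF AB(1)] \<eta>n[OF AB, symmetric] \<zeta>n[OF AB, symmetric] \<theta>\<eta>[OF AB(2)] .
    show "pro_comp (fobj L A) (fobj L B) (fobj M B) (\<theta> B) (fmap L A B h) \<in> pro_hom (fobj L A) (fobj M B)"
      by (rule pro_comp_hom[OF O(1,2,4) l \<theta>[OF AB(2)]])
    show "pro_comp (fobj L A) (fobj M A) (fobj M B) (fmap M A B h) (\<theta> A) \<in> pro_hom (fobj L A) (fobj M B)"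
      by (rule pro_comp_hom[OF O(1,3,4) \<theta>[OF AB(1)] m])
  qed
  have "pro_nat_iso L M \<theta>" unfolding pro_nat_iso_def using iso nat by blast
  then show thesis using that \<theta>\<eta> by blast
qed

text \<open>The homomorphism whose point map is \<open>factor_iso\<close>. Since that comparison is
  an open bijection, S A together with this map is an abstract spectrum.\<close>

definition factor_counit ::
  "('a gorder, 'a \<Rightarrow> 'a, 's gorder, 's \<Rightarrow> 's) functr \<Rightarrow>
   ('a gorder \<Rightarrow> nat gorder \<Rightarrow> ('a \<Rightarrow> nat set) \<Rightarrow> nat \<Rightarrow> 's) \<Rightarrow> 'a gorder \<Rightarrow> 'a \<Rightarrow> 's set" where
  "factor_counit S \<alpha> A = spec_hom A (fobj S A) (factor_iso S \<alpha> A)"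

context
  fixes S :: "('a gorder, 'a \<Rightarrow> 'a, 's gorder, 's \<Rightarrow> 's) functr" and \<alpha>
  assumes fac: "IKp_factorization S \<alpha>"
begin

lemma factor_counit_spec_map:
  "heyting_algebra A \<Longrightarrow> spec_map A (fobj S A) (factor_counit S \<alpha> A) = factor_iso S \<alpha> A"
  unfolding factor_counit_def by (rule spec_hom_inverse[OF factor_iso_open[OF fac]])

lemma factor_counit_spectrum:
  assumes A: "heyting_algebra A"
  shows "is_spectrum A (fobj S A) (factor_counit S \<alpha> A)"
  unfolding is_spectrum_def factor_counit_spec_map[OF A]
  using A factor_obj[OF fac A] factor_iso_bij[OF fac A] spec_hom_hom[OF A factor_obj(1)[OF fac A] factor_iso_open[OF fac A]]
  by (simp add: factor_counit_def)

text \<open>Homomorphisms are determined by their point maps, and on points the claim is that the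
  comparison turns \<open>fmap S B A h\<close> into inverse image of filters along h.\<close>

lemma factor_counit_natural:
  assumes A: "heyting_algebra A" and B: "heyting_algebra B" and h: "h \<in> ha_hom A B"
  shows "compose (carrier A) (factor_counit S \<alpha> B) h =
    compose (carrier A) (UU_map (fobj S B) (fobj S A) (fmap S B A h)) (factor_counit S \<alpha> A)"
proof (rule spec_map_inj)
  note SA = spectrumD[OF factor_counit_spectrum[OF A]] and SB = spectrumD[OF factor_counit_spectrum[OF B]]
  note r = hom_UU_restrict[OF A SB(2) SA(2) factor_map[OF fac A B h] SA(4)]
  show "compose (carrier A) (factor_counit S \<alpha> B) h \<in> ha_hom A (UU (fobj S B))"
    by (rule ha_hom_compose[OF A h SB(4)])
  show "compose (carrier A) (UU_map (fobj S B) (fobj S A) (fmap S B A h)) (factor_counit S \<alpha> A) \<in> ha_hom A (UU (fobj S B))"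
    by (rule r(1))
  show "spec_map A (fobj S B) (compose (carrier A) (factor_counit S \<alpha> B) h) =
    spec_map A (fobj S B) (compose (carrier A) (UU_map (fobj S B) (fobj S A) (fmap S B A h)) (factor_counit S \<alpha> A))"
    unfolding r(2) factor_counit_spec_map[OF A]
  proof (rule extensionalityI[of _ "carrier (fobj S B)"])
    fix x assume x: "x \<in> carrier (fobj S B)"
    have "spec_map A (fobj S B) (compose (carrier A) (factor_counit S \<alpha> B) h) x = {a \<in> carrier A. h a \<in> factor_iso S \<alpha> B x}"
      using x ha_hom_closed[OF h] unfolding factor_counit_spec_map[OF B, symmetric]
      by (auto simp: spec_map_apply compose_eq)
    then show "spec_map A (fobj S B) (compose (carrier A) (factor_counit S \<alpha> B) h) x =
        compose (carrier (fobj S B)) (factor_iso S \<alpha> A) (fmap S B A h) x"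
      using x factor_iso_natural[OF fac A B h x] by (simp add: compose_eq)
  qed (simp_all add: spec_map_def compose_def)
qed

lemma factor_right_adjoint: "right_adjoint_to_U S (factor_counit S \<alpha>) TYPE('x gorder)"
  unfolding right_adjoint_to_U_def HA_Obj IKp_Obj
  by (intro conjI ballI factor_functor[OF fac] U_functor_is_functor spectrumD(4)[OF factor_counit_spectrum]
      factor_counit_natural spectrum_universal[OF factor_counit_spectrum])
    (simp_all add: HA_Obj IKp_Obj)

lemma factor_profinite_completion:
  "profinite_completion (op_functr (comp_functr U_pro_functor S))
     (\<lambda>A. compose (carrier A) (U_pro_lim_iso (fobj S A)) (factor_counit S \<alpha> A)) TYPE(('j, 'n, 'k) pro)"
proof -
  let ?L = "op_functr (comp_functr U_pro_functor S)"
  have o: "fobj ?L A = U_pro_obj (fobj S A)" for A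
    by (simp add: op_functr_def comp_functr_def U_pro_functor_def)
  have m: "fmap ?L A B h = U_pro_map (fobj S B) (fobj S A) (fmap S B A h)" for A B h
    by (simp add: op_functr_def comp_functr_def U_pro_functor_def)
  note po = factor_obj(1)[OF fac]
  \<comment> \<open>S reverses arrows and \<open>U_pro_map\<close> reverses them again, so
    functoriality follows from that of both.\<close>
  have F: "is_functor HA_cat Pro_cat ?L"
    unfolding is_functor_def o m
  proof (intro conjI ballI)
    fix A :: "'a gorder" assume "A \<in> Obj HA_cat"
    then have A: "heyting_algebra A" by (simp add: HA_Obj)
    show "U_pro_obj (fobj S A) \<in> Obj Pro_cat" using U_pro_obj_pro_object[OF po[OF A]] by simp
    have "fmap S A A (\<lambda>a\<in>carrier A. a) = (\<lambda>x\<in>carrier (fobj S A). x)"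
      using factor_functor[OF fac] A by (simp add: is_functor_def HA_Obj)
    then show "U_pro_map (fobj S A) (fobj S A) (fmap S A A (Ident HA_cat A)) = Ident Pro_cat (U_pro_obj (fobj S A))"
      using U_pro_map_id[OF po[OF A]] by simp
    fix B h assume "B \<in> Obj HA_cat" "h \<in> Arr HA_cat A B"
    then have B: "heyting_algebra B" and h: "h \<in> ha_hom A B" by (simp_all add: HA_Obj)
    note Sh = factor_map[OF fac A B h]
    show "U_pro_map (fobj S B) (fobj S A) (fmap S B A h) \<in> Arr Pro_cat (U_pro_obj (fobj S A)) (U_pro_obj (fobj S B))"
      using U_pro_map_hom[OF po[OF B] po[OF A] Sh] by simp
    fix C k assume "C \<in> Obj HA_cat" "k \<in> Arr HA_cat B C"
    then have C: "heyting_algebra C" and k: "k \<in> ha_hom B C" by (simp_all add: HA_Obj)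
    have "fmap S C A (compose (carrier A) k h) = compose (carrier (fobj S C)) (fmap S B A h) (fmap S C B k)"
      using factor_functor[OF fac] A B C h k by (simp add: is_functor_def HA_Obj)
    then show "U_pro_map (fobj S C) (fobj S A) (fmap S C A (Cmp HA_cat A B C k h)) =
      Cmp Pro_cat (U_pro_obj (fobj S A)) (U_pro_obj (fobj S B)) (U_pro_obj (fobj S C))
        (U_pro_map (fobj S C) (fobj S B) (fmap S C B k)) (U_pro_map (fobj S B) (fobj S A) (fmap S B A h))"
      using U_pro_map_compose[OF po[OF C] po[OF B] po[OF A] factor_map[OF fac B C k] Sh] by simp
  qed
  show ?thesis
    unfolding profinite_completion_def o m
  proof (intro conjI ballI)
    fix A :: "'a gorder" assume "A \<in> Obj HA_cat"
    then have A: "heyting_algebra A" by (simp add: HA_Obj)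
    note sp = factor_counit_spectrum[OF A]
    show "compose (carrier A) (U_pro_lim_iso (fobj S A)) (factor_counit S \<alpha> A) \<in> ha_hom A (pro_lim (U_pro_obj (fobj S A)))"
      by (rule completion_map_hom[OF sp])
    show "bij_betw (\<lambda>\<phi>. compose (carrier A) (pro_lim_map (U_pro_obj (fobj S A)) Y \<phi>)
          (compose (carrier A) (U_pro_lim_iso (fobj S A)) (factor_counit S \<alpha> A)))
        (pro_hom (U_pro_obj (fobj S A)) Y) (ha_hom A (pro_lim Y))"
      if "Y \<in> Obj Pro_cat" for Y :: "('j, 'n, 'k) pro"
      by (rule completion_universal[OF sp]) (use that in simp)
    fix B :: "'a gorder" and h assume "B \<in> Obj HA_cat" and h: "h \<in> ha_hom A B"
    then have B: "heyting_algebra B" by (simp add: HA_Obj)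
    show "compose (carrier A) (compose (carrier B) (U_pro_lim_iso (fobj S B)) (factor_counit S \<alpha> B)) h =
      compose (carrier A) (pro_lim_map (U_pro_obj (fobj S A)) (U_pro_obj (fobj S B))
          (U_pro_map (fobj S B) (fobj S A) (fmap S B A h)))
        (compose (carrier A) (U_pro_lim_iso (fobj S A)) (factor_counit S \<alpha> A))"
      by (rule completion_natural[OF sp factor_counit_spectrum[OF B] h factor_map[OF fac A B h]
            factor_counit_natural[OF A B h]])
  qed (fact F, rule forget_is_functor)
qed

end

theorem theorem4p13:
  shows
    "is_functor (op_cat HA_cat) Sh_cat
       (Spec_bar :: ('a gorder, 'a \<Rightarrow> 'a, ('a \<Rightarrow> nat set) psh,
                     nat gorder \<Rightarrow> ('a \<Rightarrow> nat set) \<Rightarrow> ('a \<Rightarrow> nat set)) functr) \<and>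
     (\<exists>(S :: ('a gorder, 'a \<Rightarrow> 'a, 'a set gorder, 'a set \<Rightarrow> 'a set) functr) \<alpha>.
        IKp_factorization S \<alpha>) \<and>
     (\<forall>(S :: ('a gorder, 'a \<Rightarrow> 'a, 's gorder, 's \<Rightarrow> 's) functr) \<alpha>. IKp_factorization S \<alpha> \<longrightarrow>
        (\<exists>\<epsilon>. right_adjoint_to_U S \<epsilon> TYPE('s gorder) \<and>
             right_adjoint_to_U S \<epsilon> TYPE('x gorder) \<and>
             profinite_completion (op_functr (comp_functr U_pro_functor S))
               (\<lambda>A. compose (carrier A) (U_pro_lim_iso (fobj S A)) (\<epsilon> A))
               TYPE(('j, 'n, 'k) pro) \<and>
             (\<forall>(L :: ('a gorder, 'a \<Rightarrow> 'a, ('i, 'm, 'h) pro, 'i \<Rightarrow> ('i \<times> ('h \<Rightarrow> 'h)) set) functr) \<eta>.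
                profinite_completion L \<eta> TYPE(('i, 'm, 'h) pro) \<and>
                profinite_completion L \<eta> TYPE(('s set, unit, 's set) pro) \<longrightarrow>
                (\<exists>\<theta>. pro_nat_iso L (op_functr (comp_functr U_pro_functor S)) \<theta> \<and>
                     (\<forall>A\<in>Obj HA_cat.
                        compose (carrier A)
                          (pro_lim_map (fobj L A) (U_pro_obj (fobj S A)) (\<theta> A)) (\<eta> A) =
                        compose (carrier A) (U_pro_lim_iso (fobj S A)) (\<epsilon> A))))))"
proof (intro conjI allI impI, goal_cases)
  case 1
  show ?case by (rule Spec_bar_functor)
next
  case 2
  show ?case using canonical_factorization by blast
next
  case fac: (3 S \<alpha>)
  let ?M = "op_functr (comp_functr U_pro_functor S)"
  let ?\<zeta> = "\<lambda>A. compose (carrier A) (U_pro_lim_iso (fobj S A)) (factor_counit S \<alpha> A)"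
  have M: "fobj ?M A = U_pro_obj (fobj S A)" for A
    by (simp add: op_functr_def comp_functr_def U_pro_functor_def)
  have "\<exists>\<theta>. pro_nat_iso L ?M \<theta> \<and> (\<forall>A\<in>Obj HA_cat.
      compose (carrier A) (pro_lim_map (fobj L A) (U_pro_obj (fobj S A)) (\<theta> A)) (\<eta> A) = ?\<zeta> A)"
    if L: "profinite_completion L \<eta> TYPE(('i, 'm, 'h) pro)" "profinite_completion L \<eta> TYPE(('s set, unit, 's set) pro)"
    for L :: "('a gorder, 'a \<Rightarrow> 'a, ('i, 'm, 'h) pro, 'i \<Rightarrow> ('i \<times> ('h \<Rightarrow> 'h)) set) functr" and \<eta>
  proof -
    obtain \<theta> where "pro_nat_iso L ?M \<theta>"
      "\<And>A. A \<in> Obj HA_cat \<Longrightarrow> compose (carrier A) (pro_lim_map (fobj L A) (fobj ?M A) (\<theta> A)) (\<eta> A) = ?\<zeta> A"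
      \<comment> \<open>The completion built from S has its universal property for test objects of
        every type; it is instantiated at the type of L and at its own type.\<close>
      using pro_completion_unique[OF L factor_profinite_completion[OF fac] factor_profinite_completion[OF fac]] by blast
    then show ?thesis unfolding M by blast
  qed
  then show ?case
    by (intro exI[of _ "factor_counit S \<alpha>"] conjI allI impI factor_right_adjoint[OF fac]
        factor_profinite_completion[OF fac]) blast
qed

end
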